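(* Consider the adaptive distributed estimation scheme described in the context, and assume (A.1)–(A.5) hold. Then for every $\tau_0$ with $$0\le \tau_0<\tau_1-\tau_2-\frac{1}{2+\varepsilon_1},$$ and for every pair of agents $n,l\in\{1,\dots,N\}$, $$\mathbb{P}_{\theta^*}\Big(\lim_{t\to\infty}(t+1)^{\tau_0}\,\|\mathbf{x}_n(t)-\mathbf{x}_l(t)\|=0\Big)=1.$$
   Context: There are $N$ agents indexed $n=1,\dots,N$ and an unknown deterministic parameter $\theta^*\in\mathbb{R}^M$. All random objects are defined on a probability space with filtration $\{\mathcal{F}_t\}_{t\ge 0}$; $\mathbb{P}_{\theta^*}$ and $\mathbb{E}_{\theta^*}$ denote probability and expectation. Inequalities between random variables are understood almost surely. Observation model: agent $n$ observes, at times $t=0,1,2,\dots$, the vector $\mathbf{y}_n(t)=H_n\theta^*+\zeta_n(t)\in\mathbb{R}^{M_n}$. Here $H_n\in\mathbb{R}^{M_n\times M}$ is deterministic. For each $n$, $\{\zeta_n(t)\}_t$ is a zero-mean, temporally i.i.d. sequence with finite covariance $R_n$, which is nonsingular and unknown to the agents. Each $\zeta_n(t)$ is $\mathcal{F}_{t+1}$-measurable and independent of $\mathcal{F}_t$. For $n\neq l$ the sequences $\{\zeta_n(t)\}$ and $\{\zeta_l(t)\}$ are mutually uncorrelated. Communication model: $\{L_t\}$ is a sequence of random $N\times N$ Laplacian matrices of simple undirected graphs on $\{1,\dots,N\}$ (the Laplacian is degree matrix minus adjacency matrix). The random neighborhood of agent $n$ at time $t$ is $\Omega_n(t)=\{l: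 (L_t)_{nl}=-1\}$. Algorithm. The weights are $\alpha_t=a/(t+1)^{\tau_1}$ and $\beta_t=b/(t+1)^{\tau_2}$, and $\{\gamma_t\}$ is a sequence of positive reals with $\gamma_t\to 0$. The estimates $\mathbf{x}_n(t)\in\mathbb{R}^M$ have deterministic initial values $\mathbf{x}_n(0)$ and evolve as $$\mathbf{x}_n(t+1)=\mathbf{x}_n(t)-\beta_t\sum_{l\in\Omega_n(t)}(\mathbf{x}_n(t)-\mathbf{x}_l(t))+\alpha_t K_n(t)\big(\mathbf{y}_n(t)-H_n\mathbf{x}_n(t)\big).$$ The gains are $$K_n(t)=(G_n(t)+\gamma_t I_M)^{-1}H_n^T(Q_n(t)+\gamma_t I_{M_n})^{-1}.$$ The matrices $Q_n(t)$ start from a positive semidefinite initial value and are updated as the sample covariance $$Q_n(t+1)=\frac1t\sum_{s=0}^{t}\mathbf{y}_n(s)\mathbf{y}_n(s)^T-\Big(\frac1t\sum_{s=0}^{t-1}\mathbf{y}_n(s)\Big)\Big(\frac1t\sum_{s=0}^{t-1}\mathbf{y}_n(s)\Big)^T.$$ The matrices $G_n(t)$ start from positive semidefinite $G_n(0)$ and evolve as $$G_n(t+1)=G_n(t)-\beta_t\sum_{l\in\Omega_n(t)}(G_n(t)-G_l(t))+\alpha_t\big(H_n^T(Q_n(t)+\gamma_tI_{M_n})^{-1}H_n-G_n(t)\big).$$ Assumptions: (A.1) $\overline{\Sigma}_c=\frac1N\sum_{n=1}^N H_n^TR_n^{-1}H_n$ is invertible. (A.2) $\{L_t\}$ is temporally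 i.i.d., $L_t$ is $\mathcal{F}_{t+1}$-measurable and independent of $\mathcal{F}_t$, and $\lambda_2(\overline{L})>0$, where $\overline{L}=\mathbb{E}_{\theta^*}[L_t]$ and $\lambda_2$ denotes the second smallest eigenvalue. (A.3) $\{L_t\}$ and $\{\zeta_n(t)\}_{n}$ are mutually independent. (A.4) There is $\varepsilon_1>0$ with $\mathbb{E}_{\theta^*}\|\zeta_n(t)\|^{2+\varepsilon_1}<\infty$ for all $n$. (A.5) $a,b>0$, $0<\tau_2\le\tau_1\le 1$, and $\tau_1>\tau_2+\frac{1}{2+\varepsilon_1}+\frac12$.
   Formalization: The update of Q_n(t+1) divides by t and is undefined at t=0, so it is imposed only for t≥1; Q_n(1), like Q_n(0), is taken to be an arbitrary deterministic positive semidefinite initial value. *)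

theory Defs
  imports "HOL-Probability.Probability"
    "Jordan_Normal_Form.Matrix" "Jordan_Normal_Form.Char_Poly"
    "Jordan_Normal_Form.Gauss_Jordan_Elimination"
    "HOL-Computational_Algebra.Polynomial"
begin

definition vnorm :: "real Matrix.vec \<Rightarrow> real" where
  "vnorm v = sqrt (\<Sum>i<dim_vec v. (v $ i)\<^sup>2)"

definition minv :: "real mat \<Rightarrow> real mat" where
  "minv A = the (mat_inverse A)"

definition vsum :: "nat \<Rightarrow> ('i \<Rightarrow> real Matrix.vec) \<Rightarrow> 'i set \<Rightarrow> real Matrix.vec" where
  "vsum d f S = Matrix.vec d (\<lambda>k. \<Sum>s\<in>S. f s $ k)"

definition msum :: "nat \<Rightarrow> nat \<Rightarrow> ('i \<Rightarrow> real mat) \<Rightarrow> 'i set \<Rightarrow> real mat" where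
  "msum d1 d2 f S = Matrix.mat d1 d2 (\<lambda>(i,j). \<Sum>s\<in>S. f s $$ (i,j))"

definition outer :: "real Matrix.vec \<Rightarrow> real Matrix.vec \<Rightarrow> real mat" where
  "outer u v = Matrix.mat (dim_vec u) (dim_vec v) (\<lambda>(i,j). u $ i * v $ j)"

definition psd_mat :: "nat \<Rightarrow> real mat \<Rightarrow> bool" where
  "psd_mat d A \<longleftrightarrow> A \<in> carrier_mat d d \<and> transpose_mat A = A \<and>
     (\<forall>v \<in> carrier_vec d. 0 \<le> v \<bullet> (A *\<^sub>v v))"

definition graph_laplacian :: "nat \<Rightarrow> (nat \<Rightarrow> nat \<Rightarrow> bool) \<Rightarrow> real mat" where
  "graph_laplacian N E = Matrix.mat N N (\<lambda>(i,j).
      if i = j then real (card {k. k < N \<and> E i k}) else if E i j then -1 else 0)"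

definition is_graph_laplacian :: "nat \<Rightarrow> real mat \<Rightarrow> bool" where
  "is_graph_laplacian N A \<longleftrightarrow> (\<exists>E. (\<forall>i<N. \<forall>j<N. E i j = E j i) \<and> (\<forall>i<N. \<not> E i i)
      \<and> A = graph_laplacian N E)"

(* second smallest eigenvalue (with algebraic multiplicity) of a real matrix whose
   characteristic polynomial splits over the reals (e.g. symmetric matrices) *)
definition lambda2 :: "real mat \<Rightarrow> real" where
  "lambda2 A = sorted_list_of_multiset (proots (char_poly A)) ! 1"

definition gen_sigma :: "'a measure \<Rightarrow> ('a \<Rightarrow> real) set \<Rightarrow> 'a set set" where
  "gen_sigma M fs = sigma_sets (space M) (\<Union>f\<in>fs. {f -` B \<inter> space M | B. B \<in> sets borel})"

definition vcomps :: "nat \<Rightarrow> ('a \<Rightarrow> real Matrix.vec) \<Rightarrow> ('a \<Rightarrow> real) set" where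
  "vcomps d X = {(\<lambda>\<omega>. X \<omega> $ i) | i. i < d}"

definition mcomps :: "nat \<Rightarrow> ('a \<Rightarrow> real mat) \<Rightarrow> ('a \<Rightarrow> real) set" where
  "mcomps N X = {(\<lambda>\<omega>. X \<omega> $$ (i,j)) | i j. i < N \<and> j < N}"

definition vecfun :: "nat \<Rightarrow> ('a \<Rightarrow> real Matrix.vec) \<Rightarrow> 'a \<Rightarrow> nat \<Rightarrow> real" where
  "vecfun d X \<omega> = restrict (\<lambda>i. X \<omega> $ i) {..<d}"

end

theory Submission
  imports Defs "HOL-Real_Asymp.Real_Asymp"
begin

text \<open>
  Outside a null set the argument is deterministic. Three almost sure facts are used: the sample
  covariances converge (a strong law), the noise grows slower than \<open>t\<close> to any power above
  \<open>1 / (2 + \<epsilon>1)\<close> (Borel-Cantelli), and for large \<open>t\<close> every edge of positive probability occurs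
  in the window of the last \<open>t\<close>-to-the-\<open>\<delta>\<close> steps (independence and Borel-Cantelli). These
  edges connect all agents: otherwise the characteristic polynomial of the mean Laplacian would
  be divisible by the square of the variable, contradicting positivity of its second eigenvalue.

  Over a window the disagreement therefore contracts by a factor \<open>1 - c * \<beta> t\<close>, so an input of
  size \<open>w * t powr - \<tau>1\<close> produces a disagreement of size \<open>w * t powr - (\<tau>1 - \<tau>2 - \<delta>)\<close>.
  Applied to the matrices \<open>G\<close> this gives their convergence to the mean information matrix; hence
  the gains converge and the average of the matrices \<open>K * H\<close> tends to the identity. The averaged
  estimate is then stable and grows no faster than the noise; with this growth for \<open>w\<close> the
  contraction bound yields the claimed rate.
\<close>

subsection \<open>Disagreement of the agents and its contraction\<close>

text \<open>The limit of \<open>K * H\<close> for a single agent may be singular, as an agent need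
  not observe the whole parameter; only the average over the network is stable. Growth of the
  estimates therefore cannot be bounded agent by agent before the disagreement is controlled, while
  the disagreement is driven by the estimates themselves. The circle closes because the disagreement
  carries an extra factor that tends to zero. In the estimates the noise is an arbitrary input of
  known size and no cancellation is used: this is where \<open>1 / (2 + \<epsilon>1)\<close> is
  lost. Averaging of the noise matters for the sample covariances. There, products of two noise
  coordinates have moments of order \<open>1 + \<epsilon>1 / 2\<close>, possibly no variance, so the
  strong law is proved by truncation. A window of length t to the power \<delta> misses an edge with
  a probability decaying faster than any power of t, and the strict inequality for
  \<open>\<tau>0\<close> leaves room for a small \<delta>. Gains may be singular at early times, so
  their dimensions and limits are controlled for large t only.\<close>

definition mean :: "nat \<Rightarrow> (nat \<Rightarrow> real) \<Rightarrow> real" where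
  "mean N z = (\<Sum>k<N. z k) / real N"

text \<open>The Euclidean distance of z from the constant vectors; the mean is the orthogonal
  projection.\<close>

definition disagreement :: "nat \<Rightarrow> (nat \<Rightarrow> real) \<Rightarrow> real" where
  "disagreement N z = L2_set (\<lambda>k. z k - mean N z) {..<N}"

definition lap :: "nat \<Rightarrow> (nat \<Rightarrow> nat \<Rightarrow> bool) \<Rightarrow> (nat \<Rightarrow> real) \<Rightarrow> nat \<Rightarrow> real" where
  "lap N A z k = (\<Sum>j | j < N \<and> A k j. z k - z j)"

text \<open>The sum runs over ordered pairs: for symmetric \<open>A\<close> every edge counts twice,
  and the value is twice the Laplacian quadratic form of z.\<close>

definition edge_energy :: "nat \<Rightarrow> (nat \<Rightarrow> nat \<Rightarrow> bool) \<Rightarrow> (nat \<Rightarrow> real) \<Rightarrow> real" where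
  "edge_energy N A z = (\<Sum>k<N. \<Sum>j<N. if A k j then (z k - z j)\<^sup>2 else 0)"

lemma sum_filter_lessThan: "(\<Sum>j | j < (N::nat) \<and> P j. f j) = (\<Sum>j<N. if P j then f j else (0::real))"
proof -
  have "{j. j < N \<and> P j} = {..<N} \<inter> {j. P j}" by auto
  then show ?thesis by (simp only: sum.inter_restrict[OF finite_lessThan] mem_Collect_eq)
qed

lemma lap_alt: "lap N A z k = (\<Sum>j<N. if A k j then z k - z j else 0)"
  by (simp add: lap_def sum_filter_lessThan)

lemma mean_add: "mean N (\<lambda>k. f k + g k) = mean N f + mean N g"
  by (simp add: mean_def sum.distrib add_divide_distrib)

lemma mean_diff: "mean N (\<lambda>k. f k - g k) = mean N f - mean N g"
  by (simp add: mean_def sum_subtractf diff_divide_distrib)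

lemma mean_cmult: "mean N (\<lambda>k. c * f k) = c * mean N f"
  by (simp add: mean_def sum_distrib_left)

lemma disagreement_nonneg: "disagreement N z \<ge> 0"
  by (simp add: disagreement_def L2_set_nonneg)

lemma disagreement_add_le:
  "disagreement N (\<lambda>k. f k + g k) \<le> disagreement N f + disagreement N g"
proof -
  have "disagreement N (\<lambda>k. f k + g k)
      = L2_set (\<lambda>k. (f k - mean N f) + (g k - mean N g)) {..<N}"
    by (simp add: disagreement_def mean_add algebra_simps)
  also have "\<dots> \<le> disagreement N f + disagreement N g"
    unfolding disagreement_def by (rule L2_set_triangle_ineq)
  finally show ?thesis .
qed

lemma disagreement_sq: "(disagreement N z)\<^sup>2 = (\<Sum>k<N. (z k - mean N z)\<^sup>2)"
  by (simp add: disagreement_def L2_set_def sum_nonneg)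

lemma sum_minus_mean: "(\<Sum>k<N. z k - mean N z) = 0"
  by (cases "N = 0") (simp_all add: mean_def sum_subtractf)

text \<open>The mean is the best constant approximation: deviations from it sum to zero, so the
  cross term vanishes and a nonnegative square remains.\<close>

lemma disagreement_sq_le: "(disagreement N z)\<^sup>2 \<le> (\<Sum>k<N. (z k - c)\<^sup>2)"
proof -
  have "(\<Sum>k<N. (z k - c)\<^sup>2)
      = (\<Sum>k<N. (z k - mean N z)\<^sup>2 + 2 * (mean N z - c) * (z k - mean N z) + (mean N z - c)\<^sup>2)"
    by (intro sum.cong refl) (simp add: power2_eq_square algebra_simps)
  also have "\<dots> = (disagreement N z)\<^sup>2 + 2 * (mean N z - c) * (\<Sum>k<N. z k - mean N z)
      + real N * (mean N z - c)\<^sup>2"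
    by (simp add: sum.distrib disagreement_sq sum_distrib_left)
  finally show ?thesis by (simp add: sum_minus_mean)
qed

lemma disagreement_le_l1: "disagreement N z \<le> (\<Sum>k<N. \<bar>z k\<bar>)"
proof -
  have "(disagreement N z)\<^sup>2 \<le> (L2_set z {..<N})\<^sup>2"
    using disagreement_sq_le[of N z 0] by (simp add: L2_set_def sum_nonneg)
  then have "disagreement N z \<le> L2_set z {..<N}"
    by (rule power2_le_imp_le) (simp add: L2_set_nonneg)
  also have "\<dots> \<le> (\<Sum>k<N. \<bar>z k\<bar>)" by (rule L2_set_le_sum_abs)
  finally show ?thesis .
qed

lemma abs_minus_mean_le: "k < N \<Longrightarrow> \<bar>z k - mean N z\<bar> \<le> disagreement N z"
  unfolding disagreement_def
  using member_le_L2_set[of "{..<N}" k "\<lambda>k. \<bar>z k - mean N z\<bar>"]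
  by (simp add: L2_set_def)

lemma abs_diff_le_disagreement: "k < N \<Longrightarrow> j < N \<Longrightarrow> \<bar>z k - z j\<bar> \<le> 2 * disagreement N z"
  using abs_minus_mean_le[of k N z] abs_minus_mean_le[of j N z] by linarith

text \<open>Summation by parts on the graph: exchanging the two indices and adding both forms
  symmetrises the sum.\<close>

lemma sum_lap_mult:
  assumes "\<And>i j. i < N \<Longrightarrow> j < N \<Longrightarrow> A i j = A j i"
  shows "2 * (\<Sum>k<N. f k * lap N A z k)
      = (\<Sum>k<N. \<Sum>j<N. if A k j then (f k - f j) * (z k - z j) else 0)"
proof -
  have "(\<Sum>k<N. f k * lap N A z k) = (\<Sum>k<N. \<Sum>j<N. if A k j then f k * (z k - z j) else 0)"
    by (simp add: lap_alt sum_distrib_left if_distrib cong: if_cong)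
  moreover have "\<dots> = (\<Sum>k<N. \<Sum>j<N. if A k j then f j * (z j - z k) else 0)"
    by (subst sum.swap) (intro sum.cong refl, simp add: assms)
  ultimately have "2 * (\<Sum>k<N. f k * lap N A z k)
     = (\<Sum>k<N. \<Sum>j<N. if A k j then f k * (z k - z j) else 0)
     + (\<Sum>k<N. \<Sum>j<N. if A k j then f j * (z j - z k) else 0)" by simp
  also have "\<dots> = (\<Sum>k<N. \<Sum>j<N. if A k j then (f k - f j) * (z k - z j) else 0)"
    unfolding sum.distrib[symmetric]
    by (intro sum.cong refl) (simp add: algebra_simps)
  finally show ?thesis .
qed

lemma mean_lap:
  assumes "\<And>i j. i < N \<Longrightarrow> j < N \<Longrightarrow> A i j = A j i"
  shows "mean N (lap N A z) = 0"
  using sum_lap_mult[where A = A and f = "\<lambda>_. 1" and z = z, OF assms] by (simp add: mean_def cong: if_cong)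

lemma edge_energy_nonneg: "edge_energy N A z \<ge> 0"
  unfolding edge_energy_def by (intro sum_nonneg) auto

text \<open>Cauchy-Schwarz over at most N neighbours. Since the bound is the energy again, the
  second-order term of a step can be absorbed by the first-order one.\<close>

lemma lap_sq_sum_le: "(\<Sum>k<N. (lap N A z k)\<^sup>2) \<le> real N * edge_energy N A z"
  unfolding edge_energy_def sum_distrib_left
proof (rule sum_mono)
  fix k assume "k \<in> {..<N}"
  have "(lap N A z k)\<^sup>2 \<le> (\<Sum>j<N. (if A k j then z k - z j else 0)\<^sup>2) * (\<Sum>j<N. 1\<^sup>2)"
    using Cauchy_Schwarz_ineq_sum[of "\<lambda>j. if A k j then z k - z j else 0" "\<lambda>_. 1" "{..<N}"]
    by (simp add: lap_alt)
  also have "\<dots> = (\<Sum>n<N. real N * (if A k n then (z k - z n)\<^sup>2 else 0))"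
    unfolding sum_distrib_right by (intro sum.cong refl) simp
  finally show "(lap N A z k)\<^sup>2 \<le> (\<Sum>n<N. real N * (if A k n then (z k - z n)\<^sup>2 else 0))" .
qed

text \<open>Expanding the square gives the drop \<open>\<beta> * edge_energy N A z\<close> and an
  error of order \<open>\<beta>\<^sup>2\<close>; for \<open>2 * \<beta> * real N \<le> 1\<close> the
  error consumes at most half of the drop.\<close>

lemma disagreement_step:
  assumes sym: "\<And>i j. i < N \<Longrightarrow> j < N \<Longrightarrow> A i j = A j i"
    and \<beta>: "0 \<le> \<beta>" "2 * \<beta> * real N \<le> 1"
  shows "(disagreement N (\<lambda>k. z k - \<beta> * lap N A z k))\<^sup>2
     \<le> (disagreement N z)\<^sup>2 - \<beta> / 2 * edge_energy N A z"
proof -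
  have m: "mean N (\<lambda>k. z k - \<beta> * lap N A z k) = mean N z"
    by (simp add: mean_diff mean_cmult mean_lap[where A = A, OF sym])
  have c: "2 * (\<Sum>k<N. (z k - mean N z) * lap N A z k) = edge_energy N A z"
    unfolding edge_energy_def
    by (subst sum_lap_mult[where A = A and f = "\<lambda>k. z k - mean N z", OF sym], assumption, assumption)
      (intro sum.cong refl, simp add: power2_eq_square)
  have "(disagreement N (\<lambda>k. z k - \<beta> * lap N A z k))\<^sup>2
      = (\<Sum>k<N. (z k - mean N z)\<^sup>2 - \<beta> * (2 * ((z k - mean N z) * lap N A z k)) + \<beta>\<^sup>2 * (lap N A z k)\<^sup>2)"
    unfolding disagreement_sq m by (intro sum.cong refl) (simp add: power2_eq_square algebra_simps)
  also have "\<dots> = (disagreement N z)\<^sup>2 - \<beta> * (2 * (\<Sum>k<N. (z k - mean N z) * lap N A z k))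
      + \<beta>\<^sup>2 * (\<Sum>k<N. (lap N A z k)\<^sup>2)"
    by (simp only: sum.distrib sum_subtractf disagreement_sq sum_distrib_left)
  also have "\<dots> \<le> (disagreement N z)\<^sup>2 - \<beta> * edge_energy N A z + \<beta>\<^sup>2 * (real N * edge_energy N A z)"
    unfolding c using lap_sq_sum_le by (intro add_left_mono mult_left_mono) auto
  also have "\<beta>\<^sup>2 * (real N * edge_energy N A z) = (2 * \<beta> * real N) * (\<beta> / 2 * edge_energy N A z)"
    by (simp add: power2_eq_square)
  also have "\<dots> \<le> 1 * (\<beta> / 2 * edge_energy N A z)"
    using \<beta> edge_energy_nonneg by (intro mult_right_mono) auto
  finally show ?thesis by (simp add: algebra_simps)
qed

lemma disagreement_step_le:
  assumes sym: "\<And>i j. i < N \<Longrightarrow> j < N \<Longrightarrow> A i j = A j i"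
    and \<beta>: "0 \<le> \<beta>" "2 * \<beta> * real N \<le> 1"
  shows "disagreement N (\<lambda>k. z k - \<beta> * lap N A z k) \<le> disagreement N z"
proof (rule power2_le_imp_le)
  show "(disagreement N (\<lambda>k. z k - \<beta> * lap N A z k))\<^sup>2 \<le> (disagreement N z)\<^sup>2"
    using disagreement_step[where A = A and z = z, OF sym \<beta>]
      mult_nonneg_nonneg[OF \<beta>(1) edge_energy_nonneg[of N A z]] by simp
qed (rule disagreement_nonneg)

lemma abs_lap_le: "k < N \<Longrightarrow> \<bar>lap N A z k\<bar> \<le> sqrt (real N * edge_energy N A z)"
proof -
  assume "k < N"
  then have "(lap N A z k)\<^sup>2 \<le> (\<Sum>k<N. (lap N A z k)\<^sup>2)"
    by (intro member_le_sum) auto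
  then show ?thesis using lap_sq_sum_le[of N A z]
    by (intro real_le_rsqrt) simp
qed

lemma edge_le_energy: "k < N \<Longrightarrow> j < N \<Longrightarrow> A k j \<Longrightarrow> \<bar>z k - z j\<bar> \<le> sqrt (edge_energy N A z)"
proof -
  assume kj: "k < N" "j < N" "A k j"
  then have "(z k - z j)\<^sup>2 \<le> (\<Sum>j<N. if A k j then (z k - z j)\<^sup>2 else 0)"
    using member_le_sum[of j "{..<N}" "\<lambda>j. if A k j then (z k - z j)\<^sup>2 else 0"] by simp
  also have "\<dots> \<le> edge_energy N A z" unfolding edge_energy_def
    using member_le_sum[of k "{..<N}" "\<lambda>k. \<Sum>j<N. if A k j then (z k - z j)\<^sup>2 else 0"] kj
    by (simp add: sum_nonneg)
  finally show ?thesis by (intro real_le_rsqrt) simp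
qed

section \<open>Connectivity of the union graph and contraction over a window\<close>

definition connected_edges :: "nat \<Rightarrow> (nat \<times> nat) set \<Rightarrow> bool" where
  "connected_edges N E \<longleftrightarrow> (\<forall>k<N. \<forall>l<N. (k, l) \<in> E\<^sup>*)"

lemma relpow_diff_le:
  assumes "(k, l) \<in> E ^^ n" and "\<And>i j. (i, j) \<in> E \<Longrightarrow> \<bar>z i - z j\<bar> \<le> (\<eta>::real)"
  shows "\<bar>z k - z l\<bar> \<le> real n * \<eta>"
  using assms(1)
proof (induction n arbitrary: l)
  case (Suc n)
  then obtain i where "(k, i) \<in> E ^^ n" "(i, l) \<in> E" by auto
  with Suc.IH[of i] assms(2)[of i l] show ?case by (simp add: algebra_simps)
qed simp

text \<open>Every agent is joined to agent 0 by a path in E, and gaps add up along it. The constant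
  is the sum of the path lengths, so it depends on E and N alone; the summand 1 makes it
  positive.\<close>

lemma connected_disagreement_bound:
  assumes "connected_edges N E"
  shows "\<exists>C>0. \<forall>z \<eta>. \<eta> \<ge> 0 \<longrightarrow> (\<forall>i j. (i, j) \<in> E \<longrightarrow> \<bar>z i - z j\<bar> \<le> \<eta>) \<longrightarrow>
    disagreement N z \<le> C * \<eta>"
proof -
  have "\<exists>f. \<forall>k<N. \<forall>l<N. (k, l) \<in> E ^^ f k l"
    using assms unfolding connected_edges_def rtrancl_power by metis
  then obtain f where f: "\<And>k l. k < N \<Longrightarrow> l < N \<Longrightarrow> (k, l) \<in> E ^^ f k l" by blast
  define C where "C = 1 + (\<Sum>k<N. real (f k 0))"
  have "disagreement N z \<le> C * \<eta>"
    if \<eta>: "\<eta> \<ge> 0" "\<And>i j. (i, j) \<in> E \<Longrightarrow> \<bar>z i - z j\<bar> \<le> \<eta>" for z \<eta>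
  proof (cases "N = 0")
    case True then show ?thesis using \<eta> by (simp add: disagreement_def C_def)
  next
    case False
    have "disagreement N z = disagreement N (\<lambda>k. z k - z 0)"
      using False unfolding disagreement_def mean_diff by (simp add: mean_def)
    also have "\<dots> \<le> (\<Sum>k<N. \<bar>z k - z 0\<bar>)" by (rule disagreement_le_l1)
    also have "\<dots> \<le> (\<Sum>k<N. real (f k 0) * \<eta>)"
      using f False \<eta>(2) by (intro sum_mono relpow_diff_le[where E = E]) auto
    also have "\<dots> \<le> C * \<eta>" using \<eta>(1) by (simp add: C_def sum_distrib_right distrib_right)
    finally show ?thesis .
  qed
  moreover have "C > 0" unfolding C_def by (intro add_pos_nonneg sum_nonneg) auto
  ultimately show ?thesis by blast
qed

text \<open>
  Over a window the energy drop \<open>D\<close> bounds both the gap along each edge at the moment it is present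
  and the total displacement of every agent, so all gaps along edges of the union graph are
  of order \<open>sqrt (D / bmin)\<close> at the start of the window already.
\<close>
lemma window_contraction:
  assumes conn: "connected_edges N E" and EN: "E \<subseteq> {..<N} \<times> {..<N}"
  shows "\<exists>c>0. \<forall>A \<beta> h T bmin bmax. (\<forall>s i j. i < N \<longrightarrow> j < N \<longrightarrow> A s i j = A s j i) \<longrightarrow>
       (\<forall>s<T. bmin \<le> \<beta> s \<and> \<beta> s \<le> bmax) \<longrightarrow> 0 < bmin \<longrightarrow>
       2 * bmax * real N \<le> 1 \<longrightarrow> real T * bmax \<le> 1 \<longrightarrow>
       (\<forall>s<T. h (Suc s) = (\<lambda>k. h s k - \<beta> s * lap N (A s) (h s) k)) \<longrightarrow>
       (\<forall>i j. (i, j) \<in> E \<longrightarrow> (\<exists>s<T. A s i j)) \<longrightarrow>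
       disagreement N (h T) \<le> (1 - c * bmin) * disagreement N (h (0::nat))"
proof -
  obtain C where C0: "C > 0" and C': "\<forall>z \<eta>. \<eta> \<ge> 0 \<longrightarrow>
      (\<forall>i j. (i, j) \<in> E \<longrightarrow> \<bar>z i - z j\<bar> \<le> \<eta>) \<longrightarrow> disagreement N z \<le> C * \<eta>"
    using connected_disagreement_bound[OF conn] by auto
  note C = C0 C'[rule_format]
  \<comment> \<open>Origin of the constant: the gap along an edge at the start of the window is at
    most the gap \<open>sqrt (2 * D / bmin)\<close> when the edge is present, plus the displacements
    of its two ends, each at most \<open>sqrt (real N)\<close> times that. C passes from edges to
    the disagreement, and the result is squared.\<close>
  define C1 where "C1 = (1 + 2 * sqrt (real N))\<^sup>2 * 2 * C\<^sup>2"
  have C1: "C1 > 0" unfolding C1_def using C(1)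
    by (intro mult_pos_pos zero_less_power) (auto intro: add_pos_nonneg)
  show ?thesis
  proof (intro exI[of _ "1 / (2 * C1)"] conjI allI impI)
    show "1 / (2 * C1) > 0" using C1 by simp
    fix A :: "nat \<Rightarrow> nat \<Rightarrow> nat \<Rightarrow> bool" and \<beta> h T bmin bmax
    assume "\<forall>s i j. i < N \<longrightarrow> j < N \<longrightarrow> A s i j = A s j i"
      and b': "\<forall>s<T. bmin \<le> \<beta> s \<and> \<beta> s \<le> bmax" and bmin: "0 < bmin"
      and bN: "2 * bmax * real N \<le> 1" and bT: "real T * bmax \<le> 1"
      and h': "\<forall>s<T. h (Suc s) = (\<lambda>k. h s k - \<beta> s * lap N (A s) (h s) k)"
      and E: "\<forall>i j. (i, j) \<in> E \<longrightarrow> (\<exists>s<T. A s i j)"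
    then have sym: "\<And>s i j. i < N \<Longrightarrow> j < N \<Longrightarrow> A s i j = A s j i" by simp
    note b = b'[rule_format] and h = h'[rule_format]
    let ?V = "\<lambda>s. (disagreement N (h s))\<^sup>2"
    define D where "D = ?V 0 - ?V T"
    have bpos: "\<beta> s > 0" if "s < T" for s using b[OF that] bmin by linarith
    have bN': "2 * \<beta> s * real N \<le> 1" if "s < T" for s
    proof -
      have "2 * \<beta> s * real N \<le> 2 * bmax * real N" using b[OF that] by (intro mult_right_mono) auto
      with bN show ?thesis by simp
    qed
    have step: "?V (Suc s) \<le> ?V s - \<beta> s / 2 * edge_energy N (A s) (h s)" if "s < T" for s
      unfolding h[OF that] using bpos[OF that] bN'[OF that]
      by (intro disagreement_step sym) auto
    have dec: "?V (Suc s) \<le> ?V s" if "s < T" for s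
    proof -
      have "0 \<le> \<beta> s / 2 * edge_energy N (A s) (h s)"
        using bpos[OF that] edge_energy_nonneg[of N "A s" "h s"] by (intro mult_nonneg_nonneg) auto
      with step[OF that] show ?thesis by linarith
    qed
    have anti: "?V t \<le> ?V s" if "s \<le> t" "t \<le> T" for s t
      using that
    proof (induction rule: dec_induct)
      case (step n)
      with dec[of n] show ?case by simp
    qed simp
    have D0: "D \<ge> 0" using anti[of 0 T] by (simp add: D_def)
    \<comment> \<open>The energy at time s is paid out of the total drop D, because no other step of
      the window increases the disagreement.\<close>
    have en: "edge_energy N (A s) (h s) \<le> 2 * D / \<beta> s" if "s < T" for s
    proof -
      have "\<beta> s / 2 * edge_energy N (A s) (h s) \<le> D"
        using step[OF that] anti[of 0 s] anti[of "Suc s" T] that by (simp add: D_def)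
      then show ?thesis using bpos[OF that] by (simp add: field_simps)
    qed
    have move1: "\<bar>h (Suc s) k - h s k\<bar> \<le> bmax * sqrt (real N) * sqrt (2 * D / bmin)"
      if "s < T" "k < N" for s k
    proof -
      have "\<bar>h (Suc s) k - h s k\<bar> = \<beta> s * \<bar>lap N (A s) (h s) k\<bar>"
        unfolding h[OF that(1)] using bpos[OF that(1)] by (simp add: abs_mult)
      also have "\<dots> \<le> \<beta> s * sqrt (real N * edge_energy N (A s) (h s))"
        using that bpos[of s] by (intro mult_left_mono abs_lap_le) auto
      also have "\<dots> \<le> \<beta> s * sqrt (real N * (2 * D / bmin))"
      proof (intro mult_left_mono real_sqrt_le_mono)
        have "2 * D / \<beta> s \<le> 2 * D / bmin"
          using b[OF that(1)] bmin D0 by (intro divide_left_mono) auto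
        then show "edge_energy N (A s) (h s) \<le> 2 * D / bmin" using en[OF that(1)] by linarith
      qed (use bpos[OF that(1)] in auto)
      also have "\<dots> \<le> bmax * sqrt (real N * (2 * D / bmin))"
        using b[OF that(1)] D0 bmin by (intro mult_right_mono) auto
      finally show ?thesis by (simp only: real_sqrt_mult mult.assoc)
    qed
    have move: "\<bar>h s k - h 0 k\<bar> \<le> real s * (bmax * sqrt (real N) * sqrt (2 * D / bmin))"
      if "s \<le> T" "k < N" for s k
      using that(1)
    proof (induction s)
      case (Suc s)
      then show ?case using move1[of s k] that(2) by (simp add: algebra_simps)
    qed simp
    \<comment> \<open>By \<open>real T * bmax \<le> 1\<close> the step sizes of the whole window sum
      to at most one, so the displacement stays at the scale of the edge gaps.\<close>
    have move': "\<bar>h s k - h 0 k\<bar> \<le> sqrt (real N) * sqrt (2 * D / bmin)"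
      if "s < T" "k < N" for s k
    proof -
      have "bmax > 0" using b[OF that(1)] bmin by linarith
      then have "real s * bmax \<le> real T * bmax" using that(1) by (intro mult_right_mono) auto
      then have "real s * bmax \<le> 1" using bT by linarith
      then have "(real s * bmax) * (sqrt (real N) * sqrt (2 * D / bmin)) \<le> 1 * (sqrt (real N) * sqrt (2 * D / bmin))"
        using D0 bmin by (intro mult_right_mono) auto
      moreover have "\<bar>h s k - h 0 k\<bar> \<le> (real s * bmax) * (sqrt (real N) * sqrt (2 * D / bmin))"
        using move[of s k] that by (simp only: mult.assoc less_imp_le)
      ultimately show ?thesis by linarith
    qed
    let ?e = "(1 + 2 * sqrt (real N)) * sqrt (2 * D / bmin)"
    have "disagreement N (h 0) \<le> C * ?e"
    proof (rule C(2))
      show "?e \<ge> 0" using D0 bmin by auto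
      fix i j assume ij: "(i, j) \<in> E"
      then obtain s where s: "s < T" "A s i j" using E by blast
      have ijN: "i < N" "j < N" using ij EN by auto
      have "\<bar>h s i - h s j\<bar> \<le> sqrt (edge_energy N (A s) (h s))"
        using ijN s by (intro edge_le_energy) auto
      also have "\<dots> \<le> sqrt (2 * D / bmin)"
      proof (rule real_sqrt_le_mono)
        have "2 * D / \<beta> s \<le> 2 * D / bmin"
          using b[OF s(1)] bmin D0 by (intro divide_left_mono) auto
        then show "edge_energy N (A s) (h s) \<le> 2 * D / bmin" using en[OF s(1)] by linarith
      qed
      finally show "\<bar>h 0 i - h 0 j\<bar> \<le> ?e"
        using move'[OF s(1) ijN(1)] move'[OF s(1) ijN(2)] by (simp add: algebra_simps)
    qed
    then have "?V 0 \<le> (C * ?e)\<^sup>2"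
      using disagreement_nonneg by (intro power_mono) auto
    also have "\<dots> = C1 * (D / bmin)"
      using D0 bmin by (simp add: C1_def power_mult_distrib)
    finally have "bmin / C1 * ?V 0 \<le> D" using C1 bmin by (simp add: field_simps)
    then have VT: "?V T \<le> (1 - bmin / C1) * ?V 0" by (simp add: D_def algebra_simps)
    \<comment> \<open>Taking roots needs a nonnegative factor. If the initial disagreement is
      positive, \<open>?V T \<ge> 0\<close> forces \<open>bmin / C1 \<le> 1\<close>. The estimate
      \<open>1 - u \<le> (1 - u / 2)\<^sup>2\<close> accounts for the 2 in
      \<open>1 / (2 * C1)\<close>.\<close>
    show "disagreement N (h T) \<le> (1 - 1 / (2 * C1) * bmin) * disagreement N (h 0)"
    proof (cases "disagreement N (h 0) = 0")
      case True
      then have "?V T \<le> 0" using anti[of 0 T] by simp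
      then have "disagreement N (h T) = 0" by simp
      with True show ?thesis by simp
    next
      case False
      then have "?V 0 > 0" by simp
      have "0 \<le> (1 - bmin / C1) * ?V 0"
        using VT zero_le_power2[of "disagreement N (h T)"] by linarith
      then have x1: "bmin / C1 \<le> 1" using \<open>?V 0 > 0\<close> by (simp add: zero_le_mult_iff)
      have "1 - bmin / C1 \<le> (1 - 1 / (2 * C1) * bmin)\<^sup>2"
        by (simp add: power2_eq_square algebra_simps)
      then have "?V T \<le> (1 - 1 / (2 * C1) * bmin)\<^sup>2 * ?V 0"
        using VT mult_right_mono[OF _ less_imp_le[OF \<open>?V 0 > 0\<close>]] by fastforce
      then have "?V T \<le> ((1 - 1 / (2 * C1) * bmin) * disagreement N (h 0))\<^sup>2"
        by (simp add: power_mult_distrib)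
      moreover have "(1 - bmin / C1) / 2 + 1 / 2 = 1 - 1 / (2 * C1) * bmin"
        using C1 by (simp add: field_simps)
      then have "0 \<le> 1 - 1 / (2 * C1) * bmin" using x1 by (metis add_nonneg_nonneg diff_ge_0_iff_ge divide_nonneg_nonneg zero_le_numeral zero_le_one)
      then have "0 \<le> (1 - 1 / (2 * C1) * bmin) * disagreement N (h 0)"
        using disagreement_nonneg by (rule mult_nonneg_nonneg)
      ultimately show ?thesis by (rule power2_le_imp_le)
    qed
  qed
qed

section \<open>Consensus with inputs\<close>

lemma lap_diff: "lap N A (\<lambda>k. f k - g k) k = lap N A f k - lap N A g k"
  unfolding lap_def sum_subtractf[symmetric] by (intro sum.cong refl) simp

text \<open>The difference to the unforced run \<open>h\<close> obeys the same linear recursion,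
  started at zero and fed with the residuals. Averaging does not increase the disagreement, so each
  of the T residuals adds at most \<open>real N * \<rho>\<close>.\<close>

lemma perturbed_window:
  fixes z h :: "nat \<Rightarrow> nat \<Rightarrow> real"
  assumes sym: "\<And>s i j. i < N \<Longrightarrow> j < N \<Longrightarrow> A s i j = A s j i"
    and \<beta>: "\<And>s. s < T \<Longrightarrow> 0 \<le> \<beta> s \<and> 2 * \<beta> s * real N \<le> 1"
    and h0: "h 0 = z 0"
    and h: "\<And>s. h (Suc s) = (\<lambda>k. h s k - \<beta> s * lap N (A s) (h s) k)"
    and res: "\<And>s k. s < T \<Longrightarrow> k < N \<Longrightarrow> \<bar>z (Suc s) k - (z s k - \<beta> s * lap N (A s) (z s) k)\<bar> \<le> \<rho>"
  shows "disagreement N (z T) \<le> disagreement N (h T) + real T * (real N * \<rho>)"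
proof -
  have *: "disagreement N (\<lambda>k. z s k - h s k) \<le> real s * (real N * \<rho>)" if "s \<le> T" for s
    using that
  proof (induction s)
    case 0
    then show ?case by (simp add: h0 disagreement_def mean_def L2_set_def)
  next
    case (Suc s)
    define d r where "d = (\<lambda>k. z s k - h s k)"
      and "r = (\<lambda>k. z (Suc s) k - (z s k - \<beta> s * lap N (A s) (z s) k))"
    have "(\<lambda>k. z (Suc s) k - h (Suc s) k) = (\<lambda>k. (d k - \<beta> s * lap N (A s) d k) + r k)"
      by (simp add: d_def r_def h lap_diff algebra_simps)
    then have "disagreement N (\<lambda>k. z (Suc s) k - h (Suc s) k)
        \<le> disagreement N (\<lambda>k. d k - \<beta> s * lap N (A s) d k) + disagreement N r"
      using disagreement_add_le by simp
    also have "\<dots> \<le> disagreement N d + (\<Sum>k<N. \<bar>r k\<bar>)"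
      using Suc.prems \<beta>[of s]
      by (intro add_mono disagreement_le_l1 disagreement_step_le sym) auto
    also have "\<dots> \<le> real s * (real N * \<rho>) + (\<Sum>k<N. \<rho>)"
      unfolding d_def r_def using Suc.prems
      by (intro add_mono Suc.IH sum_mono res) auto
    finally show ?case by (simp add: algebra_simps)
  qed
  have "disagreement N (z T) \<le> disagreement N (h T) + disagreement N (\<lambda>k. z T k - h T k)"
    using disagreement_add_le[of N "h T" "\<lambda>k. z T k - h T k"] by simp
  then show ?thesis using *[of T] by simp
qed

text \<open>
  The constant \<open>C\<close> does not depend on \<open>w\<close>, the bound on the inputs: this is what allows
  \<open>w\<close> to grow with the trajectory itself in the bootstrap for the estimates.
\<close>
theorem consensus_rate:
  fixes z :: "nat \<Rightarrow> nat \<Rightarrow> real"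
  assumes conn: "connected_edges N E" and EN: "E \<subseteq> {..<N} \<times> {..<N}"
    and sym: "\<And>s i j. i < N \<Longrightarrow> j < N \<Longrightarrow> A s i j = A s j i"
    and b: "b > 0" and \<beta>: "\<And>t. \<beta> t = b / (real t + 1) powr \<tau>2"
    and exps: "0 < \<delta>" "\<delta> < \<tau>2" "\<delta> < 1 - \<tau>2" "\<tau>1 \<le> 1" "0 \<le> \<tau>1 - \<tau>2 - \<delta>"
    and window: "\<forall>\<^sub>F t in sequentially. \<forall>(i, j)\<in>E. \<exists>s. t - nat \<lceil>real t powr \<delta>\<rceil> \<le> s \<and> s < t \<and> A s i j"
  shows "\<exists>C>0. \<forall>w\<ge>1. \<forall>t. (\<forall>s k. t0 \<le> s \<longrightarrow> s < t \<longrightarrow> k < N \<longrightarrow>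
           \<bar>z (Suc s) k - (z s k - \<beta> s * lap N (A s) (z s) k)\<bar> \<le> w * (real s + 1) powr - \<tau>1)
         \<longrightarrow> disagreement N (z t) \<le> C * w * (real t + 1) powr - (\<tau>1 - \<tau>2 - \<delta>)"
proof -
  obtain c where c: "c > 0" and contr': "\<forall>A \<beta> h T bmin bmax. (\<forall>s i j. i < N \<longrightarrow> j < N \<longrightarrow> A s i j = A s j i) \<longrightarrow>
       (\<forall>s<T. bmin \<le> \<beta> s \<and> \<beta> s \<le> bmax) \<longrightarrow> 0 < bmin \<longrightarrow>
       2 * bmax * real N \<le> 1 \<longrightarrow> real T * bmax \<le> 1 \<longrightarrow>
       (\<forall>s<T. h (Suc s) = (\<lambda>k. h s k - \<beta> s * lap N (A s) (h s) k)) \<longrightarrow>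
       (\<forall>i j. (i, j) \<in> E \<longrightarrow> (\<exists>s<T. A s i j)) \<longrightarrow>
       disagreement N (h T) \<le> (1 - c * bmin) * disagreement N (h (0::nat))"
    using window_contraction[OF conn EN] by auto
  note contr = contr'[rule_format]
  have \<beta>': "\<beta> t = b * (real t + 1) powr - \<tau>2" for t by (simp add: \<beta> powr_minus_divide)
  define \<kappa> where "\<kappa> = \<tau>1 - \<tau>2 - \<delta>"
  define T where "T = (\<lambda>t::nat. nat \<lceil>real t powr \<delta>\<rceil>)"
  have \<kappa>: "0 \<le> \<kappa>" "\<kappa> \<le> 1" using exps by (auto simp: \<kappa>_def)
  \<comment> \<open>Five conditions on x = t + 1, in this order: the window is at most half of t;
    the step sizes in it, all taken at times of at least x / 2, are admissible for a single step;
    their sum over the window is at most 1; the relative change of \<open>x powr - \<kappa>\<close>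
    across the window is at most half of the contraction; the contraction factor is
    nonnegative.\<close>
  have "\<forall>\<^sub>F x in at_top. 4 * x powr \<delta> \<le> x - 1" using exps by real_asymp
  moreover have "\<forall>\<^sub>F x in at_top. 2 * (b * (x / 2) powr - \<tau>2) * real N \<le> 1" using exps b by real_asymp
  moreover have "\<forall>\<^sub>F x in at_top. 2 * x powr \<delta> * (b * (x / 2) powr - \<tau>2) \<le> 1" using exps b by real_asymp
  moreover have "\<forall>\<^sub>F x in at_top. 4 * x powr \<delta> / x \<le> c / 2 * (b * x powr - \<tau>2)" using exps b c by real_asymp
  moreover have "\<forall>\<^sub>F x in at_top. c * (b * x powr - \<tau>2) \<le> 1" using exps b c by real_asymp
  ultimately have "\<forall>\<^sub>F x in at_top. 4 * x powr \<delta> \<le> x - 1 \<and> 2 * (b * (x / 2) powr - \<tau>2) * real N \<le> 1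
     \<and> 2 * x powr \<delta> * (b * (x / 2) powr - \<tau>2) \<le> 1 \<and> 4 * x powr \<delta> / x \<le> c / 2 * (b * x powr - \<tau>2)
     \<and> c * (b * x powr - \<tau>2) \<le> 1" (is "eventually ?P _")
    by eventually_elim blast
  moreover have "filterlim (\<lambda>t::nat. real t + 1) at_top sequentially" by real_asymp
  ultimately have "\<forall>\<^sub>F t in sequentially. ?P (real t + 1)"
    unfolding filterlim_iff by fast
  then obtain t2 where t2: "\<And>t. t \<ge> t2 \<Longrightarrow> ?P (real t + 1)"
    and t2w: "\<And>t i j. t \<ge> t2 \<Longrightarrow> (i, j) \<in> E \<Longrightarrow> \<exists>s. t - T t \<le> s \<and> s < t \<and> A s i j"
  proof -
    assume *: "\<And>t2. (\<And>t. t \<ge> t2 \<Longrightarrow> ?P (real t + 1)) \<Longrightarrow>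
      (\<And>t i j. t \<ge> t2 \<Longrightarrow> (i, j) \<in> E \<Longrightarrow> \<exists>s. t - T t \<le> s \<and> s < t \<and> A s i j) \<Longrightarrow> thesis"
    assume "\<forall>\<^sub>F t in sequentially. ?P (real t + 1)"
    from eventually_conj[OF this window] obtain t2 where
      "\<forall>t\<ge>t2. ?P (real t + 1) \<and> (\<forall>(i, j)\<in>E. \<exists>s. t - T t \<le> s \<and> s < t \<and> A s i j)"
      unfolding eventually_sequentially T_def by blast
    then show thesis by (intro *[of t2]) auto
  qed
  \<comment> \<open>With \<open>2 * t0 + 1\<close> a window ending at t3 or later starts no earlier
    than t0, where the residual bound begins. In C the sum settles all times before t3,
    \<open>8 * real N / (c * b)\<close> is the level at which half a contraction balances the input
    of one window, and 1 gives positivity. None of them involves w.\<close>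
  define t3 where "t3 = max t2 (2 * t0 + 1)"
  define C where "C = 1 + 8 * real N / (c * b) + (\<Sum>t<t3. disagreement N (z t) * (real t + 1) powr \<kappa>)"
  have C8: "8 * real N / (c * b) \<le> C"
    unfolding C_def using sum_nonneg[of "{..<t3}" "\<lambda>t. disagreement N (z t) * (real t + 1) powr \<kappa>"]
      disagreement_nonneg by simp
  have Cpos: "C > 0" unfolding C_def using c b disagreement_nonneg
    by (intro add_pos_nonneg sum_nonneg) auto
  have "disagreement N (z t) \<le> C * w * (real t + 1) powr - \<kappa>"
    if w: "w \<ge> 1" and res: "\<And>s k. t0 \<le> s \<Longrightarrow> s < t \<Longrightarrow> k < N \<Longrightarrow>
           \<bar>z (Suc s) k - (z s k - \<beta> s * lap N (A s) (z s) k)\<bar> \<le> w * (real s + 1) powr - \<tau>1" for w t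
    using res
  proof (induction t rule: less_induct)
    case (less t)
    show ?case
    proof (cases "t < t3")
      case True
      have "disagreement N (z t) * (real t + 1) powr \<kappa> \<le> (\<Sum>t<t3. disagreement N (z t) * (real t + 1) powr \<kappa>)"
        using True disagreement_nonneg by (intro member_le_sum) auto
      also have "\<dots> \<le> C" unfolding C_def using c b by simp
      also have "C \<le> C * w" using w Cpos by simp
      finally show ?thesis by (simp add: powr_minus field_simps)
    next
      case False
      then have t: "t \<ge> t2" "t \<ge> 2 * t0 + 1" by (auto simp: t3_def)
      define x where "x = real t + 1"
      \<comment> \<open>The induction hypothesis is used at the start of the window ending at t: a
        single step need not contract at all.\<close>
      define s0 where "s0 = t - T t"
      define bmin bmax where "bmin = b * x powr - \<tau>2" and "bmax = b * (x / 2) powr - \<tau>2"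
      have x1: "x \<ge> 1" by (simp add: x_def)
      note P = t2[OF t(1), folded x_def, folded bmin_def bmax_def]
      have "real (T t) \<le> real t powr \<delta> + 1" unfolding T_def
        by (simp add: of_nat_nat ceiling_le_iff)
      also have "\<dots> \<le> x powr \<delta> + x powr \<delta>"
        using exps x1 by (intro add_mono powr_mono2 ge_one_powr_ge_zero) (auto simp: x_def)
      finally have Tx: "real (T t) \<le> 2 * x powr \<delta>" by simp
      have "2 * real (T t) \<le> real t" using Tx P by (simp add: x_def)
      then have Tt: "2 * T t \<le> t" by linarith
      have "real t powr \<delta> > 0" using t by simp
      then have T1: "T t \<ge> 1" unfolding T_def by (simp add: Suc_le_eq)
      have s0: "s0 \<ge> t0" "s0 < t" "s0 + T t = t" using Tt T1 t by (auto simp: s0_def)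
      have s0x: "x / 2 \<le> real s0 + 1" using Tt by (simp add: s0_def x_def of_nat_diff)
      have bm: "bmin \<le> \<beta> s \<and> \<beta> s \<le> bmax" if "s0 \<le> s" "s < t" for s
      proof
        have "real s + 1 \<le> x" using that by (simp add: x_def)
        then have "x powr - \<tau>2 \<le> (real s + 1) powr - \<tau>2" using exps by (intro powr_mono2') auto
        then show "bmin \<le> \<beta> s" unfolding \<beta>' bmin_def using b by (intro mult_left_mono) auto
        have "x / 2 \<le> real s + 1" using that s0x by linarith
        then have "(real s + 1) powr - \<tau>2 \<le> (x / 2) powr - \<tau>2" using exps x1 by (intro powr_mono2') auto
        then show "\<beta> s \<le> bmax" unfolding \<beta>' bmax_def using b by (intro mult_left_mono) auto
      qed
      have bmin0: "bmin > 0" unfolding bmin_def using b x1 by simp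
      define \<rho> where "\<rho> = w * (x / 2) powr - \<tau>1"
      define h where "h = rec_nat (z s0) (\<lambda>s hs k. hs k - \<beta> (s0 + s) * lap N (A (s0 + s)) hs k)"
      have h0: "h 0 = z s0" and hS: "\<And>s. h (Suc s) = (\<lambda>k. h s k - \<beta> (s0 + s) * lap N (A (s0 + s)) (h s) k)"
        by (simp_all add: h_def)
      have "disagreement N (h (T t)) \<le> (1 - c * bmin) * disagreement N (h 0)"
      proof (rule contr[where A = "\<lambda>s. A (s0 + s)" and \<beta> = "\<lambda>s. \<beta> (s0 + s)" and bmax = bmax])
        show "real (T t) * bmax \<le> 1"
        proof -
          have "bmax \<ge> 0" unfolding bmax_def using b by simp
          then have "real (T t) * bmax \<le> 2 * x powr \<delta> * bmax" using Tx by (rule mult_right_mono[rotated])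
          then show ?thesis using P by linarith
        qed
        fix i j assume "(i, j) \<in> E"
        then obtain s where "t - T t \<le> s" "s < t" "A s i j" using t2w[OF t(1)] by blast
        then show "\<exists>s<T t. A (s0 + s) i j" using s0
          by (intro exI[of _ "s - s0"]) (auto simp: s0_def)
      qed (use P bmin0 sym hS bm s0 in auto)
      moreover have "disagreement N (z (s0 + T t)) \<le> disagreement N (h (T t)) + real (T t) * (real N * \<rho>)"
      proof (rule perturbed_window[where z = "\<lambda>s. z (s0 + s)" and A = "\<lambda>s. A (s0 + s)" and \<beta> = "\<lambda>s. \<beta> (s0 + s)"])
        show "0 \<le> \<beta> (s0 + s) \<and> 2 * \<beta> (s0 + s) * real N \<le> 1" if "s < T t" for s
        proof -
          have *: "bmin \<le> \<beta> (s0 + s)" "\<beta> (s0 + s) \<le> bmax" using bm[of "s0 + s"] that s0 by auto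
          then have "2 * \<beta> (s0 + s) * real N \<le> 2 * bmax * real N" by (intro mult_right_mono) auto
          then show ?thesis using * bmin0 P by linarith
        qed
        show "\<bar>z (s0 + Suc s) k - (z (s0 + s) k - \<beta> (s0 + s) * lap N (A (s0 + s)) (z (s0 + s)) k)\<bar> \<le> \<rho>"
          if "s < T t" "k < N" for s k
        proof -
          have "x / 2 \<le> real (s0 + s) + 1" using s0x by simp
          then have "(real (s0 + s) + 1) powr - \<tau>1 \<le> (x / 2) powr - \<tau>1" using exps x1 by (intro powr_mono2') auto
          then have "w * (real (s0 + s) + 1) powr - \<tau>1 \<le> \<rho>" unfolding \<rho>_def using w by (intro mult_left_mono) auto
          moreover have "t0 \<le> s0 + s" "s0 + s < t" using that s0 by auto
          ultimately show ?thesis using less.prems[of "s0 + s" k] that by force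
        qed
      qed (use sym h0 hS in auto)
      moreover have "disagreement N (z s0) \<le> C * w * (real s0 + 1) powr - \<kappa>"
        using s0 less.prems by (intro less.IH) auto
      ultimately have "disagreement N (z t) \<le> (1 - c * bmin) * (C * w * (real s0 + 1) powr - \<kappa>) + real (T t) * (real N * \<rho>)"
        unfolding s0(3) h0 using P by (smt (verit) mult_left_mono)
      \<comment> \<open>Half of the contraction pays for moving the reference time from s0 to t: as
        \<open>\<kappa> \<le> 1\<close>, the ratio of the two powers is at most
        \<open>x / (real s0 + 1)\<close>, hence at most \<open>1 + c * bmin / 2\<close>.\<close>
      also have "(1 - c * bmin) * (C * w * (real s0 + 1) powr - \<kappa>) \<le> (1 - c * bmin / 2) * (C * w * x powr - \<kappa>)"
      proof -
        have r1: "x / (real s0 + 1) \<ge> 1" using s0 by (simp add: x_def)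
        have "(real s0 + 1) powr - \<kappa> = (x / (real s0 + 1)) powr \<kappa> * x powr - \<kappa>"
          using x1 by (simp add: powr_divide powr_minus field_simps)
        also have "\<dots> \<le> (x / (real s0 + 1)) powr 1 * x powr - \<kappa>"
          using r1 \<kappa> by (intro mult_right_mono powr_mono) auto
        also have "(x / (real s0 + 1)) powr 1 = 1 + real (T t) / (real s0 + 1)"
          using s0(3) by (simp add: x_def field_simps)
        also have "real (T t) / (real s0 + 1) \<le> 2 * x powr \<delta> / (x / 2)"
          using s0x Tx x1 by (intro frac_le) auto
        also have "2 * x powr \<delta> / (x / 2) \<le> c * bmin / 2" using P by simp
        finally have *: "(real s0 + 1) powr - \<kappa> \<le> (1 + c * bmin / 2) * x powr - \<kappa>"
          by (simp add: mult_right_mono)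
        have "(1 - c * bmin) * (real s0 + 1) powr - \<kappa> \<le> (1 - c * bmin) * ((1 + c * bmin / 2) * x powr - \<kappa>)"
          using P by (intro mult_left_mono *) auto
        also have "\<dots> = ((1 - c * bmin) * (1 + c * bmin / 2)) * x powr - \<kappa>" by simp
        also have "\<dots> \<le> (1 - c * bmin / 2) * x powr - \<kappa>"
        proof (intro mult_right_mono)
          have "(1 - c * bmin) * (1 + c * bmin / 2) = 1 - c * bmin / 2 - (c * bmin)\<^sup>2 / 2"
            by (simp add: field_simps power2_eq_square)
          then show "(1 - c * bmin) * (1 + c * bmin / 2) \<le> 1 - c * bmin / 2"
            using zero_le_power2[of "c * bmin"] by linarith
        qed auto
        finally have "C * w * ((1 - c * bmin) * (real s0 + 1) powr - \<kappa>) \<le> C * w * ((1 - c * bmin / 2) * x powr - \<kappa>)"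
          using Cpos w by (intro mult_left_mono) auto
        then show ?thesis by (simp only: ac_simps)
      qed
      \<comment> \<open>The other half absorbs the input collected in the window, by the choice of
        C.\<close>
      also have "real (T t) * (real N * \<rho>) \<le> c * bmin / 2 * (C * w * x powr - \<kappa>)"
      proof -
        have "(x / 2) powr - \<tau>1 \<le> 2 * x powr - \<tau>1"
        proof -
          have "(x / 2) powr - \<tau>1 = 2 powr \<tau>1 * x powr - \<tau>1"
            using x1 by (simp add: powr_divide powr_minus field_simps)
          moreover have "2 powr \<tau>1 \<le> (2::real) powr 1" using exps by (intro powr_mono) auto
          ultimately show ?thesis by (simp add: mult_right_mono)
        qed
        then have "\<rho> \<le> w * (2 * x powr - \<tau>1)" unfolding \<rho>_def using w by (intro mult_left_mono) auto
        then have "real (T t) * (real N * \<rho>) \<le> (2 * x powr \<delta>) * (real N * (w * (2 * x powr - \<tau>1)))"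
          using Tx w unfolding \<rho>_def by (intro mult_mono) auto
        also have "\<dots> = 4 * real N * w * (x powr \<delta> * x powr - \<tau>1)" by simp
        also have "x powr \<delta> * x powr - \<tau>1 = x powr - \<tau>2 * x powr - \<kappa>"
          by (simp add: powr_add[symmetric] \<kappa>_def)
        also have "4 * real N * w * (x powr - \<tau>2 * x powr - \<kappa>)
           = c * bmin / 2 * (8 * real N / (c * b) * w * x powr - \<kappa>)"
          using c b by (simp add: bmin_def field_simps)
        also have "\<dots> \<le> c * bmin / 2 * (C * w * x powr - \<kappa>)"
          using C8 c bmin0 w by (intro mult_left_mono mult_right_mono) auto
        finally show ?thesis .
      qed
      finally show ?thesis by (simp add: x_def algebra_simps)
    qed
  qed
  then show ?thesis using Cpos unfolding \<kappa>_def by blast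
qed

subsection \<open>Limits of matrices and their inverses\<close>

text \<open>The carrier condition on the sequence is only eventual: an inverse may have any
  dimension as long as the matrix is singular.\<close>

definition mat_tendsto :: "nat \<Rightarrow> nat \<Rightarrow> (nat \<Rightarrow> real mat) \<Rightarrow> real mat \<Rightarrow> bool" where
  "mat_tendsto nr nc A B \<longleftrightarrow> (\<forall>\<^sub>F t in sequentially. A t \<in> carrier_mat nr nc) \<and> B \<in> carrier_mat nr nc \<and>
     (\<forall>i<nr. \<forall>j<nc. (\<lambda>t. A t $$ (i, j)) \<longlonglongrightarrow> B $$ (i, j))"

lemma mat_tendstoI:
  assumes "\<forall>\<^sub>F t in sequentially. A t \<in> carrier_mat nr nc" "B \<in> carrier_mat nr nc"
    and "\<And>i j. i < nr \<Longrightarrow> j < nc \<Longrightarrow> (\<lambda>t. A t $$ (i, j)) \<longlonglongrightarrow> B $$ (i, j)"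
  shows "mat_tendsto nr nc A B"
  using assms by (simp add: mat_tendsto_def)

lemma mat_tendsto_const: "B \<in> carrier_mat nr nc \<Longrightarrow> mat_tendsto nr nc (\<lambda>_. B) B"
  by (simp add: mat_tendsto_def)

lemma tendsto_eventually_cong:
  "f \<longlonglongrightarrow> L \<Longrightarrow> L = L' \<Longrightarrow> \<forall>\<^sub>F t in sequentially. f t = g t \<Longrightarrow> g \<longlonglongrightarrow> L'"
  by (simp add: Lim_transform_eventually)

lemma index_mult_mat_sum:
  fixes A B :: "'a :: semiring_0 mat"
  assumes "A \<in> carrier_mat nr n" "B \<in> carrier_mat n nc" "i < nr" "j < nc"
  shows "(A * B) $$ (i, j) = (\<Sum>k<n. A $$ (i, k) * B $$ (k, j))"
  using assms by (auto simp: scalar_prod_def lessThan_atLeast0 intro!: sum.cong)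

lemma mat_tendsto_mult:
  assumes A: "mat_tendsto nr n A A'" and B: "mat_tendsto n nc B B'"
  shows "mat_tendsto nr nc (\<lambda>t. A t * B t) (A' * B')"
proof (rule mat_tendstoI)
  have ev: "\<forall>\<^sub>F t in sequentially. A t \<in> carrier_mat nr n \<and> B t \<in> carrier_mat n nc"
    using A B by (simp add: mat_tendsto_def eventually_conj)
  then show "\<forall>\<^sub>F t in sequentially. A t * B t \<in> carrier_mat nr nc"
    by eventually_elim (meson mult_carrier_mat)
  show "A' * B' \<in> carrier_mat nr nc"
    using A B unfolding mat_tendsto_def by (meson mult_carrier_mat)
  fix i j assume ij: "i < nr" "j < nc"
  have "(\<lambda>t. \<Sum>k<n. A t $$ (i, k) * B t $$ (k, j)) \<longlonglongrightarrow> (\<Sum>k<n. A' $$ (i, k) * B' $$ (k, j))"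
    using A B ij by (intro tendsto_sum tendsto_mult) (auto simp: mat_tendsto_def)
  moreover have "(\<Sum>k<n. A' $$ (i, k) * B' $$ (k, j)) = (A' * B') $$ (i, j)"
    using A B ij by (intro index_mult_mat_sum[symmetric]) (auto simp: mat_tendsto_def)
  moreover have "\<forall>\<^sub>F t in sequentially. (\<Sum>k<n. A t $$ (i, k) * B t $$ (k, j)) = (A t * B t) $$ (i, j)"
    using ev by eventually_elim (intro index_mult_mat_sum[symmetric], use ij in auto)
  ultimately show "(\<lambda>t. (A t * B t) $$ (i, j)) \<longlonglongrightarrow> (A' * B') $$ (i, j)"
    by (rule tendsto_eventually_cong)
qed

lemma mat_tendsto_add_smult_one:
  assumes A: "mat_tendsto n n A A'" and \<gamma>: "\<gamma> \<longlonglongrightarrow> (0::real)"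
  shows "mat_tendsto n n (\<lambda>t. A t + \<gamma> t \<cdot>\<^sub>m 1\<^sub>m n) A'"
proof (rule mat_tendstoI)
  have ev: "\<forall>\<^sub>F t in sequentially. A t \<in> carrier_mat n n" using A by (simp add: mat_tendsto_def)
  then show "\<forall>\<^sub>F t in sequentially. A t + \<gamma> t \<cdot>\<^sub>m 1\<^sub>m n \<in> carrier_mat n n"
    by eventually_elim auto
  show "A' \<in> carrier_mat n n" using A by (simp add: mat_tendsto_def)
  fix i j assume ij: "i < n" "j < n"
  have "(\<lambda>t. A t $$ (i, j) + \<gamma> t * (if i = j then 1 else 0)) \<longlonglongrightarrow> A' $$ (i, j) + 0 * (if i = j then 1 else 0)"
    using A ij \<gamma> by (intro tendsto_intros) (auto simp: mat_tendsto_def)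
  then show "(\<lambda>t. (A t + \<gamma> t \<cdot>\<^sub>m 1\<^sub>m n) $$ (i, j)) \<longlonglongrightarrow> A' $$ (i, j)"
    using ij by simp
qed

lemma det_tendsto:
  assumes A: "mat_tendsto n n A A'"
  shows "(\<lambda>t. det (A t)) \<longlonglongrightarrow> det A'"
proof -
  let ?d = "\<lambda>A. \<Sum>p | p permutes {0..<n}. signof p * (\<Prod>i = 0..<n. A $$ (i, p i))"
  have "(\<lambda>t. ?d (A t)) \<longlonglongrightarrow> ?d A'"
    using A by (intro tendsto_sum tendsto_mult tendsto_const tendsto_prod)
      (auto simp: mat_tendsto_def dest: permutes_in_image)
  moreover have "?d A' = det A'" using A by (intro det_def'[symmetric]) (simp add: mat_tendsto_def)
  moreover have "\<forall>\<^sub>F t in sequentially. ?d (A t) = det (A t)"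
    using A unfolding mat_tendsto_def by (auto elim!: eventually_mono intro: det_def'[symmetric])
  ultimately show ?thesis by (rule tendsto_eventually_cong)
qed

lemma mat_delete_tendsto:
  assumes A: "mat_tendsto n n A A'" and ij: "i < n" "j < n"
  shows "mat_tendsto (n - 1) (n - 1) (\<lambda>t. mat_delete (A t) i j) (mat_delete A' i j)"
proof (rule mat_tendstoI)
  have ev: "\<forall>\<^sub>F t in sequentially. A t \<in> carrier_mat n n" using A by (simp add: mat_tendsto_def)
  then show "\<forall>\<^sub>F t in sequentially. mat_delete (A t) i j \<in> carrier_mat (n - 1) (n - 1)"
    by eventually_elim (auto simp: mat_delete_def)
  show "mat_delete A' i j \<in> carrier_mat (n - 1) (n - 1)"
    using A by (auto simp: mat_delete_def mat_tendsto_def)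
  fix k l assume kl: "k < n - 1" "l < n - 1"
  let ?k = "if k < i then k else Suc k" and ?l = "if l < j then l else Suc l"
  have "(\<lambda>t. A t $$ (?k, ?l)) \<longlonglongrightarrow> A' $$ (?k, ?l)"
    using A kl by (auto simp: mat_tendsto_def)
  moreover have "A' $$ (?k, ?l) = mat_delete A' i j $$ (k, l)"
    using A kl by (auto simp: mat_tendsto_def mat_delete_def)
  moreover have "\<forall>\<^sub>F t in sequentially. A t $$ (?k, ?l) = mat_delete (A t) i j $$ (k, l)"
    using ev by eventually_elim (use kl in \<open>auto simp: mat_delete_def\<close>)
  ultimately show "(\<lambda>t. mat_delete (A t) i j $$ (k, l)) \<longlonglongrightarrow> mat_delete A' i j $$ (k, l)"
    by (rule tendsto_eventually_cong)
qed

lemma smult_smult_mat: "k \<cdot>\<^sub>m (l \<cdot>\<^sub>m A) = (k * l) \<cdot>\<^sub>m (A :: real mat)"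
  by (rule eq_matI) auto

lemma one_smult_mat: "1 \<cdot>\<^sub>m A = (A :: real mat)"
  by (rule eq_matI) auto

text \<open>Cramer's rule, obtained by evaluating \<open>B * (A * adj_mat A)\<close> in two ways.
  The closed formula makes the entries rational functions of those of A; continuity and
  measurability of \<open>minv\<close> both rest on it.\<close>

lemma minv_eq_adj:
  assumes A: "A \<in> carrier_mat n n" and d: "det A \<noteq> 0"
  shows "minv A = (1 / det A) \<cdot>\<^sub>m adj_mat A"
proof -
  have "A \<in> Units (ring_mat TYPE(real) n ())" by (rule det_non_zero_imp_unit[OF A d])
  then obtain B where B: "mat_inverse A = Some B" using mat_inverse(1)[OF A, where b = "()"] by (cases "mat_inverse A") auto
  from mat_inverse(2)[OF A B] have AB: "A * B = 1\<^sub>m n" "B * A = 1\<^sub>m n" "B \<in> carrier_mat n n" by auto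
  note adj = adj_mat[OF A]
  have "B = B * ((1 / det A) \<cdot>\<^sub>m (A * adj_mat A))"
    using AB d by (simp add: adj(2) smult_smult_mat one_smult_mat)
  also have "\<dots> = (1 / det A) \<cdot>\<^sub>m (B * (A * adj_mat A))"
    using A AB adj by (intro mult_smult_distrib) auto
  also have "B * (A * adj_mat A) = B * A * adj_mat A"
    using A AB adj by (intro assoc_mult_mat[symmetric]) auto
  also have "\<dots> = adj_mat A" using AB adj by simp
  finally show ?thesis using B by (simp add: minv_def)
qed

lemma minv_mult_left:
  assumes A: "A \<in> carrier_mat n n" and d: "det A \<noteq> 0"
  shows "minv A * A = 1\<^sub>m n"
  using adj_mat[OF A] A d
  by (simp add: minv_eq_adj[OF A d] smult_smult_mat one_smult_mat mult_smult_assoc_mat[of _ n n _ n])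

text \<open>All singular matrices share one value, whatever it is. A constant is measurable, which
  is how this case is handled later.\<close>

lemma minv_singular:
  assumes A: "A \<in> carrier_mat n n" and d: "det A = 0"
  shows "minv A = the None"
proof (cases "mat_inverse A")
  case (Some B)
  from mat_inverse(2)[OF A Some] have "A * B = 1\<^sub>m n" "B \<in> carrier_mat n n" by auto
  then have "det A * det B = 1" using det_mult[OF A, of B] by simp
  with d show ?thesis by simp
qed (simp add: minv_def)

lemma invertible_mat_det:
  fixes A :: "real mat"
  assumes A: "A \<in> carrier_mat n n" and inv: "invertible_mat A"
  shows "det A \<noteq> 0"
proof -
  obtain B where B: "A * B = 1\<^sub>m n" "B * A = 1\<^sub>m (dim_row B)"
    using inv A unfolding invertible_mat_def inverts_mat_def by auto
  from arg_cong[OF B(1), of dim_col] arg_cong[OF B(2), of dim_col] A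
  have "B \<in> carrier_mat n n" by auto
  then have "det A * det B = 1" using det_mult[OF A, of B] B by simp
  then show ?thesis by auto
qed

text \<open>The determinant is continuous, so \<open>det (A t)\<close> is eventually nonzero and the
  adjugate formula passes to the limit entry by entry.\<close>

lemma minv_tendsto:
  assumes A: "mat_tendsto n n A A'" and inv: "invertible_mat A'"
  shows "mat_tendsto n n (\<lambda>t. minv (A t)) (minv A')"
proof -
  have A': "A' \<in> carrier_mat n n" and ev: "\<forall>\<^sub>F t in sequentially. A t \<in> carrier_mat n n"
    using A by (auto simp: mat_tendsto_def)
  note d' = invertible_mat_det[OF A' inv] and dt = det_tendsto[OF A]
  have "\<forall>\<^sub>F t in sequentially. det (A t) \<noteq> 0" using tendsto_imp_eventually_ne[OF dt d'] .
  with ev have ev': "\<forall>\<^sub>F t in sequentially. A t \<in> carrier_mat n n \<and> det (A t) \<noteq> 0"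
    by (rule eventually_conj)
  show ?thesis
  proof (rule mat_tendstoI)
    show "\<forall>\<^sub>F t in sequentially. minv (A t) \<in> carrier_mat n n"
      using ev' by eventually_elim (auto simp: minv_eq_adj[where n = n] intro!: smult_carrier_mat adj_mat(1))
    show "minv A' \<in> carrier_mat n n" using A' d'
      by (auto simp: minv_eq_adj[where n = n] intro!: smult_carrier_mat adj_mat(1))
    fix i j assume ij: "i < n" "j < n"
    have "(\<lambda>t. 1 / det (A t) * ((- 1) ^ (j + i) * det (mat_delete (A t) j i))) \<longlonglongrightarrow>
      1 / det A' * ((- 1) ^ (j + i) * det (mat_delete A' j i))"
      using ij by (intro tendsto_intros dt d' det_tendsto[OF mat_delete_tendsto[OF A]])
    moreover have "1 / det A' * ((- 1) ^ (j + i) * det (mat_delete A' j i)) = minv A' $$ (i, j)"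
      using A' d' ij by (auto simp: minv_eq_adj[where n = n] adj_mat_def cofactor_def)
    moreover have "\<forall>\<^sub>F t in sequentially. 1 / det (A t) * ((- 1) ^ (j + i) * det (mat_delete (A t) j i)) = minv (A t) $$ (i, j)"
      using ev' by eventually_elim (use ij in \<open>auto simp: minv_eq_adj[where n = n] adj_mat_def cofactor_def\<close>)
    ultimately show "(\<lambda>t. minv (A t) $$ (i, j)) \<longlonglongrightarrow> minv A' $$ (i, j)"
      by (rule tendsto_eventually_cong)
  qed
qed

subsection \<open>A double root of the characteristic polynomial\<close>

lemma sum_const_poly: "(\<Sum>k\<in>I. [:f k:]) = [:\<Sum>k\<in>I. f k:]"
  by (induction I rule: infinite_finite_induct) auto

text \<open>Row sums over S and over its complement vanish separately. Hence adding up the columns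
  of the characteristic matrix that belong to S leaves X times the indicator of S, and likewise for
  the complement. Put in places p and q, these two columns contribute one factor X each to the
  determinant.\<close>

lemma X_sq_dvd_char_poly:
  fixes A :: "real mat"
  assumes A: "A \<in> carrier_mat N N"
    and S: "p \<in> S" "p < N" "q \<notin> S" "q < N"
    and row: "\<And>i. i < N \<Longrightarrow> (\<Sum>j<N. if j \<in> S then A $$ (i, j) else 0) = 0"
      "\<And>i. i < N \<Longrightarrow> (\<Sum>j<N. if j \<notin> S then A $$ (i, j) else 0) = 0"
  shows "[:0, 1:] ^ 2 dvd char_poly A"
proof -
  let ?X = "[:0, 1:] :: real poly"
  let ?C = "char_poly_matrix A"
  \<comment> \<open>The column operations as a matrix: columns p and q are the indicators of S and
    of its complement, the others are unit vectors.\<close>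
  define e where "e = (\<lambda>i j. if j = p then of_bool (i \<in> S) else if j = q then of_bool (i \<notin> S)
     else of_bool (i = j) :: real poly)"
  define P where "P = mat N N (\<lambda>(i, j). e i j)"
  \<comment> \<open>P minus the identity has nonzero entries only in columns p and q, while its rows
    p and q vanish; so its square is zero, and twice the identity minus P is the inverse of
    P.\<close>
  define P' where "P' = mat N N (\<lambda>(i, j). 2 * of_bool (i = j) - e i j)"
  define d where "d = (\<lambda>j. if j = p \<or> j = q then ?X else 1)"
  define D where "D = mat N N (\<lambda>(i, j). of_bool (i = j) * d j)"
  define B where "B = mat N N (\<lambda>(i, j). if j = p \<or> j = q then e i j else ?C $$ (i, j))"
  have carr: "?C \<in> carrier_mat N N" "P \<in> carrier_mat N N" "P' \<in> carrier_mat N N"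
    "D \<in> carrier_mat N N" "B \<in> carrier_mat N N"
    using A by (auto simp: P_def P'_def D_def B_def)
  have pq: "p \<noteq> q" using S by auto
  have C: "?C $$ (i, j) = of_bool (i = j) * ?X - [:A $$ (i, j):]" if "i < N" "j < N" for i j
    using A that by (auto simp: char_poly_matrix_def)
  have sum_if: "(\<Sum>k<N. f k * of_bool (k = j)) = f j" if "j < N" for j and f :: "nat \<Rightarrow> real poly"
    using that by (simp add: of_bool_def if_distrib cong: if_cong)
  have "?C * P = B * D"
  proof (rule eq_matI)
    fix i j assume "i < dim_row (B * D)" "j < dim_col (B * D)"
    then have ij: "i < N" "j < N" using carr by auto
    have r: "(B * D) $$ (i, j) = (if j = p \<or> j = q then e i j else ?C $$ (i, j)) * d j"
    proof -
      have "(B * D) $$ (i, j) = (\<Sum>k<N. (B $$ (i, k) * d j) * of_bool (k = j))"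
        unfolding index_mult_mat_sum[OF carr(5,4) ij] using ij by (intro sum.cong refl) (simp add: D_def)
      then show ?thesis using ij by (simp add: sum_if B_def)
    qed
    have l: "(?C * P) $$ (i, j) = (\<Sum>k<N. ?C $$ (i, k) * e k j)"
      unfolding index_mult_mat_sum[OF carr(1,2) ij] using ij by (intro sum.cong refl) (simp add: P_def)
    have cs: "(\<Sum>k<N. ?C $$ (i, k) * of_bool (k \<in> T)) = of_bool (i \<in> T) * ?X - [:\<Sum>k<N. if k \<in> T then A $$ (i, k) else 0:]" for T
    proof -
      have "(\<Sum>k<N. ?C $$ (i, k) * of_bool (k \<in> T))
          = (\<Sum>k<N. (of_bool (i \<in> T) * ?X) * of_bool (k = i) - [:if k \<in> T then A $$ (i, k) else 0:])"
        using ij by (intro sum.cong refl) (auto simp: C)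
      also have "\<dots> = of_bool (i \<in> T) * ?X - (\<Sum>k<N. [:if k \<in> T then A $$ (i, k) else 0:])"
        using ij by (simp only: sum_subtractf sum_if)
      also have "(\<Sum>k<N. [:if k \<in> T then A $$ (i, k) else 0:]) = [:\<Sum>k<N. if k \<in> T then A $$ (i, k) else 0:]"
        by (rule sum_const_poly)
      finally show ?thesis .
    qed
    show "(?C * P) $$ (i, j) = (B * D) $$ (i, j)"
    proof (cases "j = p \<or> j = q")
      case True
      then show ?thesis unfolding l r using cs[of S] cs[of "- S"] row[OF ij(1)] pq
        by (auto simp: e_def d_def cong: if_cong)
    next
      case False
      then show ?thesis unfolding l r using ij by (simp add: e_def d_def sum_if)
    qed
  qed (use carr in auto)
  then have dets: "det ?C * det P = det B * det D"
    using det_mult[OF carr(1,2)] det_mult[OF carr(5,4)] by simp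
  have "P * P' = 1\<^sub>m N"
  proof (rule eq_matI)
    fix i j assume "i < dim_row (1\<^sub>m N)" "j < dim_col (1\<^sub>m N)"
    then have ij: "i < N" "j < N" by auto
    have l: "(P * P') $$ (i, j) = (\<Sum>k<N. e i k * (2 * of_bool (k = j) - e k j))"
      unfolding index_mult_mat_sum[OF carr(2,3) ij] using ij by (intro sum.cong refl) (simp add: P_def P'_def)
    have "(\<Sum>k<N. e i k * e k j) = 2 * e i j - of_bool (i = j)"
    proof -
      have z: "(e i k - of_bool (i = k)) * (e k j - of_bool (k = j)) = 0" for k
        using S by (auto simp: e_def)
      have e1: "e k k = 1" for k using S by (auto simp: e_def)
      have "e i k * e k j = e i j * of_bool (k = j) + (e i j - of_bool (i = j)) * of_bool (k = i)" for k
      proof (cases "k = i")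
        case True
        then show ?thesis by (cases "i = j") (simp_all add: e1)
      next
        case False
        then show ?thesis using z[of k] by (cases "k = j") (simp_all add: e1)
      qed
      then have "(\<Sum>k<N. e i k * e k j)
          = (\<Sum>k<N. e i j * of_bool (k = j)) + (\<Sum>k<N. (e i j - of_bool (i = j)) * of_bool (k = i))"
        by (simp only: sum.distrib)
      then show ?thesis using ij by (simp only: sum_if)
    qed
    moreover have "(\<Sum>k<N. e i k * (2 * of_bool (k = j) - e k j))
        = (\<Sum>k<N. 2 * e i k * of_bool (k = j)) - (\<Sum>k<N. e i k * e k j)"
      unfolding sum_subtractf[symmetric] by (intro sum.cong refl) (simp add: algebra_simps)
    ultimately show "(P * P') $$ (i, j) = 1\<^sub>m N $$ (i, j)"
      unfolding l using ij by (simp add: sum_if)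
  qed (use carr in auto)
  then have PP: "det P * det P' = 1" using det_mult[OF carr(2,3)] by simp
  have "upper_triangular D" unfolding upper_triangular_def by (auto simp: D_def)
  then have "det D = (\<Prod>i<N. d i)"
    using det_upper_triangular[OF _ carr(4)] by (simp add: prod_list_diag_prod D_def lessThan_atLeast0)
  also have "\<dots> = d p * (d q * (\<Prod>i\<in>{..<N} - {p} - {q}. d i))"
    using S pq by (simp add: prod.remove[of "{..<N}" p] prod.remove[of "{..<N} - {p}" q])
  also have "(\<Prod>i\<in>{..<N} - {p} - {q}. d i) = 1" by (intro prod.neutral) (auto simp: d_def)
  finally have "det D = ?X ^ 2" by (simp add: d_def power2_eq_square)
  moreover have "char_poly A = det ?C * (det P * det P')" by (simp add: PP char_poly_def)
  then have "char_poly A = det D * (det B * det P')" by (simp add: dets mult.assoc[symmetric])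
  ultimately show ?thesis by simp
qed

text \<open>Zero occurs at least twice in the sorted list of roots. If the entry at index 1 were
  positive, so would be all later ones, and only the first entry could be zero.\<close>

lemma lambda2_nonpos:
  assumes A: "A \<in> carrier_mat N N" and d: "[:0, 1:] ^ 2 dvd char_poly A"
  shows "lambda2 A \<le> 0"
proof -
  let ?M = "proots (char_poly A)"
  define xs where "xs = sorted_list_of_multiset ?M"
  have nz: "char_poly A \<noteq> 0" using degree_monic_char_poly[OF A] by auto
  have xs: "sorted xs" "mset xs = ?M" by (auto simp: xs_def)
  have "2 \<le> order 0 (char_poly A)" using d nz order_divides[of 0 2 "char_poly A"] by simp
  then have c: "2 \<le> count (mset xs) 0" using nz xs by simp
  show ?thesis
  proof (cases xs)
    case (Cons a ys)
    show ?thesis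
    proof (cases ys)
      case (Cons b zs)
      have "b \<le> 0"
      proof (rule ccontr)
        assume "\<not> b \<le> 0"
        then have "0 \<notin> set (b # zs)" using xs(1) \<open>xs = a # ys\<close> Cons by auto
        then have "count (mset ys) 0 = 0" unfolding Cons by (simp only: count_eq_zero_iff set_mset_mset not_False_eq_True)
        moreover have "count (mset xs) 0 \<le> 1 + count (mset ys) 0" using \<open>xs = a # ys\<close> by simp
        ultimately show False using c by linarith
      qed
      then show ?thesis using \<open>xs = a # ys\<close> Cons by (simp add: lambda2_def xs_def[symmetric])
    qed (use c \<open>xs = a # ys\<close> in \<open>simp split: if_splits\<close>)
  qed (use c in simp)
qed

subsection \<open>A strong law of large numbers\<close>

lemma cesaro_mean_tendsto:
  fixes a :: "nat \<Rightarrow> real"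
  assumes "a \<longlonglongrightarrow> L"
  shows "(\<lambda>n. (\<Sum>s<n. a s) / real n) \<longlonglongrightarrow> L"
proof (rule LIMSEQ_I)
  fix \<epsilon> :: real assume \<epsilon>: "\<epsilon> > 0"
  obtain n0 where n0: "\<And>n. n \<ge> n0 \<Longrightarrow> \<bar>a n - L\<bar> < \<epsilon> / 2"
    using LIMSEQ_D[OF assms, of "\<epsilon> / 2"] \<epsilon> by auto
  define K where "K = (\<Sum>s<n0. \<bar>a s - L\<bar>)"
  have "(\<lambda>n. K / real n) \<longlonglongrightarrow> 0" by (rule lim_const_over_n)
  then obtain n1 where n1: "\<And>n. n \<ge> n1 \<Longrightarrow> \<bar>K / real n\<bar> < \<epsilon> / 2"
    using LIMSEQ_D[of "\<lambda>n. K / real n" 0 "\<epsilon> / 2"] \<epsilon> by (auto simp del: abs_divide)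
  show "\<exists>no. \<forall>n\<ge>no. norm ((\<Sum>s<n. a s) / real n - L) < \<epsilon>"
  proof (intro exI[of _ "n0 + n1 + 1"] allI impI)
    fix n assume n: "n \<ge> n0 + n1 + 1"
    have "(\<Sum>s<n. a s) / real n - L = (\<Sum>s<n. a s - L) / real n"
      using n by (simp add: sum_subtractf field_simps)
    then have "\<bar>(\<Sum>s<n. a s) / real n - L\<bar> \<le> (\<Sum>s<n. \<bar>a s - L\<bar>) / real n"
      by (simp add: divide_right_mono)
    also have "(\<Sum>s<n. \<bar>a s - L\<bar>) = K + (\<Sum>s = n0..<n. \<bar>a s - L\<bar>)"
      unfolding K_def lessThan_atLeast0 using n by (simp add: sum.atLeastLessThan_concat)
    also have "(\<Sum>s = n0..<n. \<bar>a s - L\<bar>) \<le> (\<Sum>s = n0..<n. \<epsilon> / 2)"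
      using n0 by (intro sum_mono) (auto intro: less_imp_le)
    also have "\<dots> \<le> real n * (\<epsilon> / 2)" using \<epsilon> by (auto intro!: mult_right_mono)
    finally have "\<bar>(\<Sum>s<n. a s) / real n - L\<bar> \<le> (K + real n * (\<epsilon> / 2)) / real n"
      by (simp add: divide_right_mono)
    also have "\<dots> = K / real n + \<epsilon> / 2" using n by (simp add: field_simps)
    also have "\<dots> < \<epsilon>" using n1[of n] n by linarith
    finally show "norm ((\<Sum>s<n. a s) / real n - L) < \<epsilon>" by simp
  qed
qed

text \<open>Monotonicity squeezes T between its values at the neighbouring powers
  \<open>k ^ q\<close> and \<open>(k + 1) ^ q\<close>, and the ratio of these powers tends to
  1.\<close>

lemma mono_subsequence_average_tendsto:
  fixes T :: "nat \<Rightarrow> real"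
  assumes mono: "\<And>m n. m \<le> n \<Longrightarrow> T m \<le> T n" and T0: "\<And>n. T n \<ge> 0" and q: "q > 0"
    and lim: "(\<lambda>k. T (k ^ q) / real (k ^ q)) \<longlonglongrightarrow> \<mu>"
  shows "(\<lambda>n. T n / real n) \<longlonglongrightarrow> \<mu>"
proof -
  \<comment> \<open>The base of the largest q-th power not exceeding n.\<close>
  define k where "k = (\<lambda>n::nat. nat \<lfloor>root q (real n)\<rfloor>)"
  have k1: "k n ^ q \<le> n" for n
  proof -
    have "real (k n) \<le> root q (real n)" unfolding k_def by (intro of_nat_floor real_root_ge_zero) simp
    then have "real (k n) ^ q \<le> root q (real n) ^ q" by (intro power_mono) auto
    also have "\<dots> = real n" using q by simp
    finally show ?thesis by (metis of_nat_le_iff of_nat_power)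
  qed
  have k2: "n \<le> (k n + 1) ^ q" for n
  proof -
    have "root q (real n) \<le> real (k n + 1)" unfolding k_def by simp linarith
    then have "root q (real n) ^ q \<le> real (k n + 1) ^ q" by (intro power_mono real_root_ge_zero) auto
    then have "real n \<le> real ((k n + 1) ^ q)" using q by simp
    then show ?thesis by (simp only: of_nat_le_iff)
  qed
  have kinf: "filterlim k at_top sequentially"
    unfolding filterlim_at_top
  proof
    fix Z
    show "\<forall>\<^sub>F n in sequentially. Z \<le> k n"
      using eventually_ge_at_top[of "Z ^ q"]
    proof eventually_elim
      case (elim n)
      then have "real (Z ^ q) \<le> real n" by (simp only: of_nat_le_iff)
      then have "root q (real Z ^ q) \<le> root q (real n)" using q by simp
      then have "real Z \<le> root q (real n)" using q by (simp add: real_root_power_cancel)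
      then show ?case unfolding k_def by (simp add: le_nat_iff le_floor_iff)
    qed
  qed
  have r1: "(\<lambda>k. (real k / real (Suc k)) ^ q) \<longlonglongrightarrow> 1 ^ q" by (intro tendsto_power) real_asymp
  have r2: "(\<lambda>k. (real (Suc k) / real k) ^ q) \<longlonglongrightarrow> 1 ^ q" by (intro tendsto_power) real_asymp
  have "(\<lambda>k. T (k ^ q) / real (k ^ q) * (real k / real (Suc k)) ^ q) \<longlonglongrightarrow> \<mu> * 1 ^ q"
    by (intro tendsto_mult lim r1)
  then have lo: "(\<lambda>n. T (k n ^ q) / real (k n ^ q) * (real (k n) / real (Suc (k n))) ^ q) \<longlonglongrightarrow> \<mu> * 1 ^ q"
    by (rule filterlim_compose[OF _ kinf])
  have "(\<lambda>k. T (Suc k ^ q) / real (Suc k ^ q) * (real (Suc k) / real k) ^ q) \<longlonglongrightarrow> \<mu> * 1 ^ q"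
    by (intro tendsto_mult r2 LIMSEQ_Suc[OF lim])
  then have up: "(\<lambda>n. T (Suc (k n) ^ q) / real (Suc (k n) ^ q) * (real (Suc (k n)) / real (k n)) ^ q) \<longlonglongrightarrow> \<mu> * 1 ^ q"
    by (rule filterlim_compose[OF _ kinf])
  have ev: "\<forall>\<^sub>F n in sequentially. k n \<ge> 1 \<and> n \<ge> 1"
    using kinf eventually_ge_at_top[of 1] by (simp add: filterlim_at_top eventually_conj)
  show ?thesis
  proof (rule tendsto_sandwich)
    show "\<forall>\<^sub>F n in sequentially. T (k n ^ q) / real (k n ^ q) * (real (k n) / real (Suc (k n))) ^ q \<le> T n / real n"
      using ev
    proof eventually_elim
      case (elim n)
      have "T (k n ^ q) / real (k n ^ q) * (real (k n) / real (Suc (k n))) ^ q = T (k n ^ q) / real ((k n + 1) ^ q)"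
        using elim by (simp add: power_divide)
      also have "\<dots> \<le> T n / real n"
        using elim k2[of n] mono[OF k1] T0 by (intro frac_le) (auto simp only: of_nat_le_iff of_nat_0_less_iff)
      finally show ?case .
    qed
    show "\<forall>\<^sub>F n in sequentially. T n / real n \<le> T (Suc (k n) ^ q) / real (Suc (k n) ^ q) * (real (Suc (k n)) / real (k n)) ^ q"
      using ev
    proof eventually_elim
      case (elim n)
      have kp: "0 < k n ^ q" using elim by simp
      have "T n / real n \<le> T (Suc (k n) ^ q) / real (k n ^ q)"
      proof (rule frac_le)
        show "T n \<le> T (Suc (k n) ^ q)" using k2[of n] by (intro mono) simp
        show "real (k n ^ q) \<le> real n" using k1 by (simp only: of_nat_le_iff)
        show "0 < real (k n ^ q)" using kp by (simp only: of_nat_0_less_iff)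
      qed (rule T0)
      also have "\<dots> = T (Suc (k n) ^ q) / real (Suc (k n) ^ q) * (real (Suc (k n)) / real (k n)) ^ q"
        using elim by (simp add: power_divide del: of_nat_Suc)
      finally show ?case .
    qed
  qed (use lo up in auto)
qed

context prob_space
begin

text \<open>Markov's inequality for the moment of order r gives exceedance probabilities of order
  \<open>(real s + 1) powr - (p * r)\<close>. They are summable, so Borel-Cantelli applies.\<close>

lemma AE_eventually_abs_le_powr:
  fixes X :: "nat \<Rightarrow> 'a \<Rightarrow> real"
  assumes [measurable]: "\<And>s. X s \<in> borel_measurable M"
    and mom: "\<And>s. integrable M (\<lambda>\<omega>. \<bar>X s \<omega>\<bar> powr r)" "\<And>s. expectation (\<lambda>\<omega>. \<bar>X s \<omega>\<bar> powr r) \<le> C"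
    and r: "r > 0" "p * r > 1"
  shows "AE \<omega> in M. \<forall>\<^sub>F s in sequentially. \<bar>X s \<omega>\<bar> \<le> (real s + 1) powr p"
proof -
  define A where "A = (\<lambda>s. {\<omega>\<in>space M. \<bar>X s \<omega>\<bar> powr r \<ge> ((real s + 1) powr p) powr r})"
  have [measurable]: "A s \<in> sets M" for s unfolding A_def by measurable
  have pm: "prob (A s) \<le> C * (real s + 1) powr - (p * r)" for s
  proof -
    have "prob (A s) \<le> expectation (\<lambda>\<omega>. \<bar>X s \<omega>\<bar> powr r) / (((real s + 1) powr p) powr r)"
      unfolding A_def by (rule integral_Markov_inequality_measure[OF mom(1), where A = "{}"]) auto
    also have "\<dots> \<le> C / (((real s + 1) powr p) powr r)"
      using mom(2) by (intro divide_right_mono) auto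
    also have "\<dots> = C * (real s + 1) powr - (p * r)" by (simp add: powr_powr powr_minus_divide)
    finally show ?thesis .
  qed
  have "summable (\<lambda>s. real s powr - (p * r))" using r by (simp add: summable_real_powr_iff)
  then have "summable (\<lambda>s. real (Suc s) powr - (p * r))" by (subst summable_Suc_iff)
  then have "summable (\<lambda>s. C * (real s + 1) powr - (p * r))" by (intro summable_mult) (simp add: add.commute)
  then have "summable (\<lambda>s. prob (A s))"
    by (rule summable_comparison_test') (use pm in auto)
  then have "AE \<omega> in M. \<forall>\<^sub>F s in sequentially. \<omega> \<in> space M - A s"
    by (intro borel_cantelli_AE1) (auto simp: emeasure_eq_measure)
  then show ?thesis
  proof (rule AE_mp, intro AE_I2 impI)
    fix \<omega> assume \<omega>: "\<omega> \<in> space M" and "\<forall>\<^sub>F s in sequentially. \<omega> \<in> space M - A s"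
    from this(2) show "\<forall>\<^sub>F s in sequentially. \<bar>X s \<omega>\<bar> \<le> (real s + 1) powr p"
    proof eventually_elim
      case (elim s)
      then have "\<bar>X s \<omega>\<bar> powr r < ((real s + 1) powr p) powr r" using \<omega> by (auto simp: A_def)
      moreover have "((real s + 1) powr p) powr r \<le> \<bar>X s \<omega>\<bar> powr r" if "(real s + 1) powr p \<le> \<bar>X s \<omega>\<bar>"
        using that r by (intro powr_mono2) auto
      ultimately show ?case by linarith
    qed
  qed
qed

text \<open>Truncation at level s + 1, then Chebyshev along the sparse times \<open>k ^ q\<close>;
  the partial sums of nonnegative variables are monotone, which fills the gaps. The moment of order
  \<open>1 + \<delta>\<close> is what products of two noise coordinates can offer, as their variance
  may be infinite.\<close>

lemma strong_law_nonneg: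
  fixes X :: "nat \<Rightarrow> 'a \<Rightarrow> real"
  assumes indep: "indep_vars (\<lambda>_. borel) X UNIV"
    and nn: "\<And>s \<omega>. \<omega> \<in> space M \<Longrightarrow> X s \<omega> \<ge> 0"
    and int: "\<And>s. integrable M (X s)" "\<And>s. expectation (X s) = \<mu>"
    and mom: "\<And>s. integrable M (\<lambda>\<omega>. X s \<omega> powr (1 + \<delta>))" "\<And>s. expectation (\<lambda>\<omega>. X s \<omega> powr (1 + \<delta>)) \<le> C"
    and \<delta>: "0 < \<delta>" "\<delta> \<le> 1"
  shows "AE \<omega> in M. (\<lambda>n. (\<Sum>s<n. X s \<omega>) / real n) \<longlonglongrightarrow> \<mu>"
proof -
  have Xm [measurable]: "X s \<in> borel_measurable M" for s using int(1) by (rule borel_measurable_integrable)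
  have C0: "C \<ge> 0"
    by (rule order_trans[OF Bochner_Integration.integral_nonneg mom(2)[of 0]]) simp
  \<comment> \<open>Values above the level are set to zero rather than capped. By the growth bound
    below, almost every path is truncated only finitely often.\<close>
  define f where "f = (\<lambda>(s::nat) x::real. if x \<le> real s + 1 then x else 0)"
  have fm [measurable]: "f s \<in> borel_measurable borel" for s unfolding f_def by measurable
  define Y where "Y = (\<lambda>s \<omega>. f s (X s \<omega>))"
  have Ym [measurable]: "Y s \<in> borel_measurable M" for s unfolding Y_def by measurable
  have Yb: "0 \<le> Y s \<omega>" "Y s \<omega> \<le> real s + 1" "Y s \<omega> \<le> X s \<omega>" if "\<omega> \<in> space M" for s \<omega>
    using nn[OF that, of s] by (auto simp: Y_def f_def)
  have Yi: "integrable M (Y s)" for s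
    by (rule integrable_const_bound[where B = "real s + 1"]) (use Yb in auto)
  define m where "m = (\<lambda>s. expectation (Y s))"
  have "AE \<omega> in M. \<forall>\<^sub>F s in sequentially. \<bar>X s \<omega>\<bar> \<le> (real s + 1) powr 1"
  proof (rule AE_eventually_abs_le_powr[where r = "1 + \<delta>" and C = C])
    have *: "\<bar>X s \<omega>\<bar> powr (1 + \<delta>) = X s \<omega> powr (1 + \<delta>)" if "\<omega> \<in> space M" for s \<omega>
      using nn[OF that] by simp
    show "integrable M (\<lambda>\<omega>. \<bar>X s \<omega>\<bar> powr (1 + \<delta>))" for s
      using mom(1)[of s] by (subst Bochner_Integration.integrable_cong[OF refl *])
    show "expectation (\<lambda>\<omega>. \<bar>X s \<omega>\<bar> powr (1 + \<delta>)) \<le> C" for s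
      using mom(2)[of s] by (subst Bochner_Integration.integral_cong[OF refl *])
  qed (use \<delta> in auto)
  then have XY: "AE \<omega> in M. (\<lambda>s. X s \<omega> - Y s \<omega>) \<longlonglongrightarrow> 0"
  proof (rule AE_mp, intro AE_I2 impI)
    fix \<omega> assume "\<omega> \<in> space M" "\<forall>\<^sub>F s in sequentially. \<bar>X s \<omega>\<bar> \<le> (real s + 1) powr 1"
    then have "\<forall>\<^sub>F s in sequentially. X s \<omega> - Y s \<omega> = 0"
      by (auto elim!: eventually_mono simp: Y_def f_def)
    then show "(\<lambda>s. X s \<omega> - Y s \<omega>) \<longlonglongrightarrow> 0" by (rule tendsto_eventually)
  qed
  have m\<mu>: "m \<longlonglongrightarrow> \<mu>"
  proof -
    \<comment> \<open>Where the truncation acts, X exceeds s + 1, so X is at most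
      \<open>(real s + 1) powr - \<delta>\<close> times its power of order
      \<open>1 + \<delta>\<close>: the bias is a vanishing multiple of the moment.\<close>
    have b: "\<bar>m s - \<mu>\<bar> \<le> C * (real s + 1) powr - \<delta>" for s
    proof -
      have "\<mu> - m s = expectation (\<lambda>\<omega>. X s \<omega> - Y s \<omega>)"
        unfolding m_def int(2)[of s, symmetric] using int(1) Yi by simp
      also have "\<dots> \<le> expectation (\<lambda>\<omega>. (real s + 1) powr - \<delta> * X s \<omega> powr (1 + \<delta>))"
      proof (intro integral_mono)
        fix \<omega> assume \<omega>: "\<omega> \<in> space M"
        show "X s \<omega> - Y s \<omega> \<le> (real s + 1) powr - \<delta> * X s \<omega> powr (1 + \<delta>)"
        proof (cases "X s \<omega> \<le> real s + 1")
          case False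
          then have "X s \<omega> powr - \<delta> \<le> (real s + 1) powr - \<delta>" using \<delta> by (intro powr_mono2') auto
          then have "X s \<omega> powr - \<delta> * X s \<omega> powr (1 + \<delta>) \<le> (real s + 1) powr - \<delta> * X s \<omega> powr (1 + \<delta>)"
            by (rule mult_right_mono) auto
          then show ?thesis using False by (simp add: Y_def f_def powr_add[symmetric])
        qed (auto simp: Y_def f_def)
      qed (use int Yi mom in auto)
      also have "\<dots> = (real s + 1) powr - \<delta> * expectation (\<lambda>\<omega>. X s \<omega> powr (1 + \<delta>))" by simp
      also have "\<dots> \<le> (real s + 1) powr - \<delta> * C" using mom by (intro mult_left_mono) auto
      finally have "\<mu> - m s \<le> C * (real s + 1) powr - \<delta>" by (simp add: mult.commute)
      moreover have "m s \<le> \<mu>" unfolding m_def int(2)[of s, symmetric]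
        by (intro integral_mono Yi int(1) Yb(3))
      ultimately show ?thesis by linarith
    qed
    have "(\<lambda>s. C * (real s + 1) powr - \<delta>) \<longlonglongrightarrow> C * 0"
      by (intro tendsto_mult tendsto_const) (use \<delta> in real_asymp)
    then have "(\<lambda>s. C * (real s + 1) powr - \<delta>) \<longlonglongrightarrow> 0" by simp
    then have "(\<lambda>s. m s - \<mu>) \<longlonglongrightarrow> 0"
      by (rule Lim_null_comparison[rotated]) (use b in simp)
    then show ?thesis by (simp add: LIM_zero_iff)
  qed
  define Z where "Z = (\<lambda>s \<omega>. Y s \<omega> - m s)"
  have Zm [measurable]: "Z s \<in> borel_measurable M" for s unfolding Z_def by measurable
  have mb: "0 \<le> m s" "m s \<le> real s + 1" for s
  proof -
    show "0 \<le> m s" unfolding m_def by (intro Bochner_Integration.integral_nonneg Yb(1))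
    have "m s \<le> expectation (\<lambda>_. real s + 1)" unfolding m_def by (intro integral_mono Yi Yb(2)) auto
    then show "m s \<le> real s + 1" by (simp add: prob_space)
  qed
  have Zb: "\<bar>Z s \<omega>\<bar> \<le> real s + 1" if "\<omega> \<in> space M" for s \<omega>
    using Yb[OF that, of s] mb[of s] by (auto simp: Z_def abs_le_iff)
  have Zi: "integrable M (Z s)" for s
    by (rule integrable_const_bound[where B = "real s + 1"]) (use Zb in auto)
  have ZZb: "\<bar>Z s \<omega> * Z r \<omega>\<bar> \<le> (real s + 1) * (real r + 1)" if "\<omega> \<in> space M" for s r \<omega>
    unfolding abs_mult by (intro mult_mono Zb that) auto
  have ZZi: "integrable M (\<lambda>\<omega>. Z s \<omega> * Z r \<omega>)" for s r
    by (rule integrable_const_bound[where B = "(real s + 1) * (real r + 1)"]) (use ZZb in auto)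
  have Z0: "expectation (Z s) = 0" for s
    unfolding Z_def using Yi by (simp add: m_def prob_space)
  have Zind: "indep_vars (\<lambda>_. borel) Z UNIV"
    unfolding Z_def Y_def by (rule indep_vars_compose2[OF indep]) measurable
  have Zcross: "expectation (\<lambda>\<omega>. Z s \<omega> * Z r \<omega>) = 0" if "s \<noteq> r" for s r
  proof -
    have "expectation (\<lambda>\<omega>. \<Prod>i\<in>{s, r}. Z i \<omega>) = (\<Prod>i\<in>{s, r}. expectation (Z i))"
      by (rule indep_vars_lebesgue_integral) (auto intro: indep_vars_subset[OF Zind] Zi)
    then show ?thesis using that Z0 by simp
  qed
  \<comment> \<open>Where Y is nonzero it is at most s + 1, so its square is at most
    \<open>(real s + 1) powr (1 - \<delta>)\<close> times the variable with bounded mean. Variances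
    may grow, but strictly slower than s.\<close>
  have Zsq: "expectation (\<lambda>\<omega>. Z s \<omega> * Z s \<omega>) \<le> C * (real s + 1) powr (1 - \<delta>)" for s
  proof -
    have Ysq: "integrable M (\<lambda>\<omega>. (Y s \<omega>)\<^sup>2)"
      by (rule integrable_const_bound[where B = "(real s + 1)\<^sup>2"]) (use Yb in \<open>auto intro!: AE_I2 power_mono\<close>)
    have "expectation (\<lambda>\<omega>. Z s \<omega> * Z s \<omega>) = variance (Y s)"
      by (simp add: Z_def m_def power2_eq_square)
    also have "\<dots> = expectation (\<lambda>\<omega>. (Y s \<omega>)\<^sup>2) - (m s)\<^sup>2"
      unfolding m_def by (rule variance_eq[OF Yi Ysq])
    also have "\<dots> \<le> expectation (\<lambda>\<omega>. (Y s \<omega>)\<^sup>2)" by simp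
    also have "\<dots> \<le> expectation (\<lambda>\<omega>. (real s + 1) powr (1 - \<delta>) * X s \<omega> powr (1 + \<delta>))"
    proof (intro integral_mono)
      fix \<omega> assume \<omega>: "\<omega> \<in> space M"
      show "(Y s \<omega>)\<^sup>2 \<le> (real s + 1) powr (1 - \<delta>) * X s \<omega> powr (1 + \<delta>)"
      proof (cases "Y s \<omega> = 0")
        case False
        then have y: "Y s \<omega> = X s \<omega>" "X s \<omega> > 0" "X s \<omega> \<le> real s + 1"
          using nn[OF \<omega>, of s] by (auto simp: Y_def f_def split: if_splits)
        have "(Y s \<omega>)\<^sup>2 = X s \<omega> powr (1 - \<delta>) * X s \<omega> powr (1 + \<delta>)"
          using y by (simp add: powr_add[symmetric])
        also have "\<dots> \<le> (real s + 1) powr (1 - \<delta>) * X s \<omega> powr (1 + \<delta>)"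
          using y \<delta> by (intro mult_right_mono powr_mono2) auto
        finally show ?thesis .
      qed simp
    qed (use Ysq mom in auto)
    also have "\<dots> = (real s + 1) powr (1 - \<delta>) * expectation (\<lambda>\<omega>. X s \<omega> powr (1 + \<delta>))" by simp
    also have "\<dots> \<le> (real s + 1) powr (1 - \<delta>) * C" using mom by (intro mult_left_mono) auto
    finally show ?thesis by (simp add: mult.commute)
  qed
  have var: "expectation (\<lambda>\<omega>. (\<Sum>s<n. Z s \<omega>)\<^sup>2) \<le> C * real n powr (2 - \<delta>)" for n
  proof -
    have "expectation (\<lambda>\<omega>. (\<Sum>s<n. Z s \<omega>)\<^sup>2) = (\<Sum>s<n. \<Sum>r<n. expectation (\<lambda>\<omega>. Z s \<omega> * Z r \<omega>))"
      by (simp add: power2_eq_square sum_product ZZi Bochner_Integration.integral_sum)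
    also have "\<dots> = (\<Sum>s<n. \<Sum>r<n. if r = s then expectation (\<lambda>\<omega>. Z s \<omega> * Z s \<omega>) else 0)"
      by (intro sum.cong refl) (auto simp: Zcross)
    also have "\<dots> = (\<Sum>s<n. expectation (\<lambda>\<omega>. Z s \<omega> * Z s \<omega>))" by simp
    also have "\<dots> \<le> (\<Sum>s<n. C * real n powr (1 - \<delta>))"
    proof (rule sum_mono)
      fix s assume "s \<in> {..<n}"
      then have "(real s + 1) powr (1 - \<delta>) \<le> real n powr (1 - \<delta>)" using \<delta> by (intro powr_mono2) auto
      then show "expectation (\<lambda>\<omega>. Z s \<omega> * Z s \<omega>) \<le> C * real n powr (1 - \<delta>)"
        using Zsq[of s] C0 mult_left_mono by fastforce
    qed
    also have "\<dots> = C * (real n powr 1 * real n powr (1 - \<delta>))" by simp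
    also have "\<dots> = C * real n powr (2 - \<delta>)" by (simp only: powr_add[symmetric]) simp
    finally show ?thesis .
  qed
  \<comment> \<open>Chebyshev at time n = \<open>k ^ q\<close> with threshold n / k leaves a bound
    proportional to \<open>n powr - \<delta> * k powr 2\<close>;
    \<open>real q * \<delta> \<ge> 4\<close> brings it down to the summable
    \<open>k powr - 2\<close>.\<close>
  obtain q :: nat where q: "real q * \<delta> \<ge> 4" "q > 0"
  proof -
    obtain q :: nat where "4 / \<delta> < real q" using reals_Archimedean2 by blast
    then have "real q * \<delta> \<ge> 4" "q > 0" using \<delta> by (auto simp: field_simps intro!: gr0I)
    then show thesis using that by blast
  qed
  define B where "B = (\<lambda>k::nat. {\<omega>\<in>space M. \<bar>\<Sum>s<Suc k ^ q. Z s \<omega>\<bar> \<ge> real (Suc k ^ q) / real (Suc k)})"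
  have [measurable]: "B k \<in> sets M" for k unfolding B_def by measurable
  have pB: "prob (B k) \<le> C * real (Suc k) powr - 2" for k
  proof -
    let ?n = "Suc k ^ q"
    have np: "real ?n > 0" by simp
    have "prob (B k) \<le> expectation (\<lambda>\<omega>. (\<Sum>s<?n. Z s \<omega>)\<^sup>2) / (real ?n / real (Suc k))\<^sup>2"
      unfolding B_def
    proof (rule second_moment_method)
      show "integrable M (\<lambda>x. (\<Sum>s<?n. Z s x)\<^sup>2)"
        by (simp add: power2_eq_square sum_product ZZi)
    qed auto
    also have "\<dots> \<le> C * real ?n powr (2 - \<delta>) / (real ?n / real (Suc k))\<^sup>2"
      by (intro divide_right_mono var) auto
    also have "\<dots> = C * (real ?n powr (2 - \<delta>) * real ?n powr - 2) * real (Suc k) powr 2"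
      using np by (simp add: powr_minus field_simps power_divide del: of_nat_Suc of_nat_power)
    also have "real ?n powr (2 - \<delta>) * real ?n powr - 2 = real ?n powr - \<delta>"
      by (simp only: powr_add[symmetric]) simp
    also have "real ?n = real (Suc k) powr real q" by (simp add: powr_realpow del: of_nat_Suc)
    also have "(real (Suc k) powr real q) powr - \<delta> = real (Suc k) powr - (real q * \<delta>)"
      by (simp add: powr_powr)
    also have "C * real (Suc k) powr - (real q * \<delta>) * real (Suc k) powr 2
        \<le> C * real (Suc k) powr - 4 * real (Suc k) powr 2"
      using q C0 by (intro mult_right_mono mult_left_mono powr_mono) auto
    also have "\<dots> = C * (real (Suc k) powr - 4 * real (Suc k) powr 2)" by simp
    also have "real (Suc k) powr - 4 * real (Suc k) powr 2 = real (Suc k) powr - 2"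
      by (simp only: powr_add[symmetric]) simp
    finally show ?thesis .
  qed
  have "summable (\<lambda>k. real (Suc k) powr - 2)"
    by (subst summable_Suc_iff) (simp add: summable_real_powr_iff)
  then have "summable (\<lambda>k. C * real (Suc k) powr - 2)" by (rule summable_mult)
  then have "summable (\<lambda>k. prob (B k))"
    by (rule summable_comparison_test') (use pB in auto)
  then have BC: "AE \<omega> in M. \<forall>\<^sub>F k in sequentially. \<omega> \<in> space M - B k"
    by (intro borel_cantelli_AE1) (auto simp: emeasure_eq_measure)
  show ?thesis
    using BC XY
  proof eventually_elim
    case (elim \<omega>)
    from elim(1) have \<omega>: "\<omega> \<in> space M" using eventually_happens by force
    let ?T = "\<lambda>n. \<Sum>s<n. X s \<omega>"
    have sp: "filterlim (\<lambda>k. Suc k ^ q) at_top sequentially"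
    proof (rule filterlim_subseq)
      show "strict_mono (\<lambda>k. Suc k ^ q)" using q by (intro strict_monoI power_strict_mono) auto
    qed
    have "(\<lambda>k. (\<Sum>s<Suc k ^ q. Z s \<omega>) / real (Suc k ^ q)) \<longlonglongrightarrow> 0"
    proof (rule Lim_null_comparison)
      show "(\<lambda>k. 1 / real (Suc k)) \<longlonglongrightarrow> 0" by real_asymp
      show "\<forall>\<^sub>F k in sequentially. norm ((\<Sum>s<Suc k ^ q. Z s \<omega>) / real (Suc k ^ q)) \<le> 1 / real (Suc k)"
        using elim(1)
      proof eventually_elim
        case (elim k)
        have "real (Suc k ^ q) > 0" by simp
        moreover have "\<bar>\<Sum>s<Suc k ^ q. Z s \<omega>\<bar> \<le> real (Suc k ^ q) / real (Suc k)"
          using elim \<omega> by (auto simp: B_def)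
        ultimately show ?case
          by (simp add: field_simps del: of_nat_Suc of_nat_power power_Suc)
      qed
    qed
    moreover have "(\<lambda>k. (\<Sum>s<Suc k ^ q. m s) / real (Suc k ^ q)) \<longlonglongrightarrow> \<mu>"
      by (rule filterlim_compose[OF cesaro_mean_tendsto[OF m\<mu>] sp])
    moreover have "(\<lambda>k. (\<Sum>s<Suc k ^ q. X s \<omega> - Y s \<omega>) / real (Suc k ^ q)) \<longlonglongrightarrow> 0"
      by (rule filterlim_compose[OF cesaro_mean_tendsto[OF elim(2)] sp])
    ultimately have "(\<lambda>k. (\<Sum>s<Suc k ^ q. Z s \<omega>) / real (Suc k ^ q) + (\<Sum>s<Suc k ^ q. m s) / real (Suc k ^ q)
      + (\<Sum>s<Suc k ^ q. X s \<omega> - Y s \<omega>) / real (Suc k ^ q)) \<longlonglongrightarrow> 0 + \<mu> + 0"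
      by (intro tendsto_add)
    then have "(\<lambda>k. ?T (Suc k ^ q) / real (Suc k ^ q)) \<longlonglongrightarrow> \<mu>"
      by (simp add: add_divide_distrib[symmetric] sum.distrib[symmetric] Z_def del: of_nat_Suc of_nat_power)
    then have "(\<lambda>k. ?T (k ^ q) / real (k ^ q)) \<longlonglongrightarrow> \<mu>" by (rule LIMSEQ_imp_Suc)
    then show ?case
    proof (rule mono_subsequence_average_tendsto[rotated 3])
      show "?T i \<le> ?T n" if "i \<le> n" for i n using that nn[OF \<omega>] by (intro sum_mono2) auto
      show "?T n \<ge> 0" for n using nn[OF \<omega>] by (intro sum_nonneg) auto
    qed (rule q)
  qed
qed

text \<open>Positive and negative parts are treated separately, because the previous law exploits
  monotone partial sums.\<close>

lemma strong_law_iid: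
  fixes X :: "nat \<Rightarrow> 'a \<Rightarrow> real"
  assumes indep: "indep_vars (\<lambda>_. borel) X UNIV"
    and ident: "\<And>s. distr M borel (X s) = distr M borel (X 0)"
    and mom: "integrable M (\<lambda>\<omega>. \<bar>X 0 \<omega>\<bar> powr (1 + \<delta>))" and \<delta>: "0 < \<delta>" "\<delta> \<le> 1"
  shows "AE \<omega> in M. (\<lambda>n. (\<Sum>s<n. X s \<omega>) / real n) \<longlonglongrightarrow> expectation (X 0)"
proof -
  have Xm [measurable]: "X s \<in> borel_measurable M" for s using indep by (auto simp: indep_vars_def)
  have E: "integrable M (\<lambda>\<omega>. g (X s \<omega>)) \<longleftrightarrow> integrable M (\<lambda>\<omega>. g (X 0 \<omega>))"
    "expectation (\<lambda>\<omega>. g (X s \<omega>)) = expectation (\<lambda>\<omega>. g (X 0 \<omega>))"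
    if [measurable]: "g \<in> borel_measurable borel" for g :: "real \<Rightarrow> real" and s
    using integrable_distr_eq[of "X s" M borel g] integrable_distr_eq[of "X 0" M borel g]
      integral_distr[of "X s" M borel g] integral_distr[of "X 0" M borel g] ident[of s] by simp_all
  have part: "AE \<omega> in M. (\<lambda>n. (\<Sum>s<n. g (X s \<omega>)) / real n) \<longlonglongrightarrow> expectation (\<lambda>\<omega>. g (X 0 \<omega>))"
      "integrable M (\<lambda>\<omega>. g (X 0 \<omega>))"
    if [measurable]: "g \<in> borel_measurable borel" and g: "\<And>x. 0 \<le> g x" "\<And>x. g x \<le> \<bar>x\<bar>" for g :: "real \<Rightarrow> real"
  proof -
    have m0: "integrable M (\<lambda>\<omega>. g (X 0 \<omega>) powr (1 + \<delta>))"
      by (rule Bochner_Integration.integrable_bound[OF mom])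
        (auto intro!: AE_I2 powr_mono2 g simp: less_imp_le[OF \<delta>(1)])
    have le: "g (X 0 \<omega>) \<le> 1 + g (X 0 \<omega>) powr (1 + \<delta>)" for \<omega>
    proof (cases "g (X 0 \<omega>) \<le> 1")
      case False
      then have "g (X 0 \<omega>) powr 1 \<le> g (X 0 \<omega>) powr (1 + \<delta>)" using \<delta> by (intro powr_mono) auto
      then show ?thesis using False by simp
    next
      case True
      then show ?thesis using powr_ge_zero[of "g (X 0 \<omega>)" "1 + \<delta>"] by linarith
    qed
    show i0: "integrable M (\<lambda>\<omega>. g (X 0 \<omega>))"
    proof (rule Bochner_Integration.integrable_bound)
      show "integrable M (\<lambda>\<omega>. 1 + g (X 0 \<omega>) powr (1 + \<delta>))" using m0 by simp
      show "AE \<omega> in M. norm (g (X 0 \<omega>)) \<le> norm (1 + g (X 0 \<omega>) powr (1 + \<delta>))"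
      proof (rule AE_I2)
        fix \<omega>
        show "norm (g (X 0 \<omega>)) \<le> norm (1 + g (X 0 \<omega>) powr (1 + \<delta>))"
          using le[of \<omega>] g(1)[of "X 0 \<omega>"] by simp
      qed
    qed measurable
    show "AE \<omega> in M. (\<lambda>n. (\<Sum>s<n. g (X s \<omega>)) / real n) \<longlonglongrightarrow> expectation (\<lambda>\<omega>. g (X 0 \<omega>))"
    proof (rule strong_law_nonneg[where \<delta> = \<delta> and C = "expectation (\<lambda>\<omega>. g (X 0 \<omega>) powr (1 + \<delta>))"])
      show "indep_vars (\<lambda>_. borel) (\<lambda>s \<omega>. g (X s \<omega>)) UNIV"
        by (rule indep_vars_compose2[OF indep]) simp
      show "integrable M (\<lambda>\<omega>. g (X s \<omega>))" for s using i0 E(1)[of g s] by simp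
      show "expectation (\<lambda>\<omega>. g (X s \<omega>)) = expectation (\<lambda>\<omega>. g (X 0 \<omega>))" for s by (rule E(2)) simp
      show "integrable M (\<lambda>\<omega>. g (X s \<omega>) powr (1 + \<delta>))" for s
        using m0 E(1)[of "\<lambda>x. g x powr (1 + \<delta>)" s] by simp
      show "expectation (\<lambda>\<omega>. g (X s \<omega>) powr (1 + \<delta>)) \<le> expectation (\<lambda>\<omega>. g (X 0 \<omega>) powr (1 + \<delta>))" for s
        using E(2)[of "\<lambda>x. g x powr (1 + \<delta>)" s] by simp
    qed (rule g(1), rule \<delta>, rule \<delta>)
  qed
  have p: "(\<lambda>x. max 0 x) \<in> borel_measurable (borel :: real measure)"
    "(\<lambda>x. max 0 (- x)) \<in> borel_measurable (borel :: real measure)" by simp_all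
  note P = part[OF p(1)] and N = part[OF p(2)]
  have eq: "max 0 x - max 0 (- x) = x" for x :: real by simp
  have mean: "expectation (X 0) = expectation (\<lambda>\<omega>. max 0 (X 0 \<omega>)) - expectation (\<lambda>\<omega>. max 0 (- X 0 \<omega>))"
    using Bochner_Integration.integral_diff[OF P(2) N(2)] by (simp add: eq)
  have "AE \<omega> in M. (\<lambda>n. (\<Sum>s<n. max 0 (X s \<omega>)) / real n) \<longlonglongrightarrow> expectation (\<lambda>\<omega>. max 0 (X 0 \<omega>))"
    by (rule P(1)) auto
  moreover have "AE \<omega> in M. (\<lambda>n. (\<Sum>s<n. max 0 (- X s \<omega>)) / real n) \<longlonglongrightarrow> expectation (\<lambda>\<omega>. max 0 (- X 0 \<omega>))"
    by (rule N(1)) auto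
  ultimately show ?thesis
  proof eventually_elim
    case (elim \<omega>)
    from tendsto_diff[OF elim] show ?case
      unfolding diff_divide_distrib[symmetric] sum_subtractf[symmetric] eq mean[symmetric] .
  qed
qed

end

subsection \<open>Driven consensus\<close>

text \<open>Steps of size at least \<open>a / (real t + 1)\<close> forget the initial error at least
  as fast as \<open>t powr - a\<close>. This includes \<tau> = 1, where the sum of the steps
  diverges only logarithmically.\<close>

lemma averaging_tendsto:
  fixes v :: "nat \<Rightarrow> real"
  assumes a: "a > 0" and \<tau>: "0 < \<tau>" "\<tau> \<le> 1" and \<alpha>: "\<And>t. \<alpha> t = a / (real t + 1) powr \<tau>"
    and rec: "\<forall>\<^sub>F t in sequentially. v (Suc t) = v t + \<alpha> t * (d t - v t)"
    and d: "d \<longlonglongrightarrow> L"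
  shows "v \<longlonglongrightarrow> L"
proof (rule LIMSEQ_I)
  fix \<epsilon> :: real assume \<epsilon>: "\<epsilon> > 0"
  have "\<forall>\<^sub>F t in sequentially. \<alpha> t < 1" unfolding \<alpha> using a \<tau> by real_asymp
  moreover have "\<forall>\<^sub>F t in sequentially. \<bar>d t - L\<bar> < \<epsilon> / 2"
    using tendstoD[OF d, of "\<epsilon> / 2"] \<epsilon> by (simp add: dist_real_def)
  ultimately have "\<forall>\<^sub>F t in sequentially. \<alpha> t < 1 \<and> \<bar>d t - L\<bar> < \<epsilon> / 2 \<and> v (Suc t) = v t + \<alpha> t * (d t - v t)"
    using rec by eventually_elim blast
  then obtain T where T: "\<And>t. t \<ge> T \<Longrightarrow> \<alpha> t < 1" "\<And>t. t \<ge> T \<Longrightarrow> \<bar>d t - L\<bar> < \<epsilon> / 2"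
     "\<And>t. t \<ge> T \<Longrightarrow> v (Suc t) = v t + \<alpha> t * (d t - v t)"
    unfolding eventually_sequentially by blast
  define e where "e = \<bar>v T - L\<bar>"
  have bound: "\<bar>v t - L\<bar> \<le> \<epsilon> / 2 + ((real T + 1) / (real t + 1)) powr a * e" if "t \<ge> T" for t
    using that
  proof (induction t rule: nat_induct_at_least)
    case base
    then show ?case using \<epsilon> by (simp add: e_def)
  next
    case (Suc t)
    have \<alpha>0: "\<alpha> t > 0" unfolding \<alpha> using a by simp
    have \<alpha>1: "a / (real t + 1) \<le> \<alpha> t"
    proof -
      have "(real t + 1) powr \<tau> \<le> (real t + 1) powr 1" using \<tau> by (intro powr_mono) auto
      then show ?thesis unfolding \<alpha> using a by (intro divide_left_mono) auto
    qed
    \<comment> \<open>From \<open>ln (1 + u) \<le> u\<close> and \<open>1 + u \<le> exp u\<close>.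
      The bound is written as a ratio so that it telescopes in the induction.\<close>
    have k: "1 - \<alpha> t \<le> ((real t + 1) / (real t + 2)) powr a"
    proof -
      have "(real t + 2) / (real t + 1) = 1 + 1 / (real t + 1)" by (simp add: field_simps)
      then have "ln ((real t + 2) / (real t + 1)) \<le> 1 / (real t + 1)"
        by (metis ln_add_one_self_le_self divide_nonneg_nonneg of_nat_0_le_iff zero_le_one add_nonneg_nonneg)
      then have "a * ln ((real t + 2) / (real t + 1)) \<le> a * (1 / (real t + 1))" using a by (intro mult_left_mono) auto
      then have "1 - \<alpha> t \<le> 1 + a * ln ((real t + 1) / (real t + 2))"
        using \<alpha>1 by (simp add: ln_div right_diff_distrib)
      also have "\<dots> \<le> exp (a * ln ((real t + 1) / (real t + 2)))" by (rule exp_ge_add_one_self)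
      also have "\<dots> = ((real t + 1) / (real t + 2)) powr a" by (simp add: powr_def)
      finally show ?thesis .
    qed
    have "v (Suc t) - L = (1 - \<alpha> t) * (v t - L) + \<alpha> t * (d t - L)"
      using T(3) Suc by (simp add: algebra_simps)
    then have "\<bar>v (Suc t) - L\<bar> \<le> \<bar>(1 - \<alpha> t) * (v t - L)\<bar> + \<bar>\<alpha> t * (d t - L)\<bar>" by linarith
    also have "\<dots> = (1 - \<alpha> t) * \<bar>v t - L\<bar> + \<alpha> t * \<bar>d t - L\<bar>"
      using T(1)[of t] \<alpha>0 Suc by (simp add: abs_mult)
    also have "\<dots> \<le> (1 - \<alpha> t) * (\<epsilon> / 2 + ((real T + 1) / (real t + 1)) powr a * e) + \<alpha> t * (\<epsilon> / 2)"
      using T(1)[of t] T(2)[of t] \<alpha>0 Suc by (intro add_mono mult_left_mono) auto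
    also have "\<dots> = \<epsilon> / 2 + (1 - \<alpha> t) * (((real T + 1) / (real t + 1)) powr a * e)"
      by (simp add: field_simps)
    also have "(1 - \<alpha> t) * (((real T + 1) / (real t + 1)) powr a * e)
       \<le> ((real t + 1) / (real t + 2)) powr a * (((real T + 1) / (real t + 1)) powr a * e)"
      by (intro mult_right_mono k) (auto simp: e_def)
    also have "\<dots> = ((real T + 1) / (real (Suc t) + 1)) powr a * e"
      by (simp add: powr_divide add.commute)
    finally show ?case by simp
  qed
  have "(\<lambda>t. ((real T + 1) / (real t + 1)) powr a * e) \<longlonglongrightarrow> 0"
    using a by real_asymp
  then have "\<forall>\<^sub>F t in sequentially. ((real T + 1) / (real t + 1)) powr a * e < \<epsilon> / 2"
    by (rule order_tendstoD) (use \<epsilon> in simp)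
  then obtain T' where
    T': "\<And>t. t \<ge> T' \<Longrightarrow> ((real T + 1) / (real t + 1)) powr a * e < \<epsilon> / 2"
    unfolding eventually_sequentially by blast
  show "\<exists>no. \<forall>n\<ge>no. norm (v n - L) < \<epsilon>"
  proof (intro exI allI impI)
    fix n assume "n \<ge> max T T'"
    then show "norm (v n - L) < \<epsilon>" using bound[of n] T'[of n] by simp
  qed
qed

text \<open>One fixed realization of the graph sequence. \<open>A s\<close> is the neighbourhood
  relation at time s, E collects edges that occur in every late window, and \<delta> is the exponent
  of the window length.\<close>

locale consensus_network =
  fixes N :: nat and E :: "(nat \<times> nat) set" and A :: "nat \<Rightarrow> nat \<Rightarrow> nat \<Rightarrow> bool"
    and a b \<tau>1 \<tau>2 \<delta> :: real and \<alpha> \<beta> :: "nat \<Rightarrow> real"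
  assumes N: "N > 0" and conn: "connected_edges N E" and EN: "E \<subseteq> {..<N} \<times> {..<N}"
    and sym: "\<And>s i j. i < N \<Longrightarrow> j < N \<Longrightarrow> A s i j = A s j i"
    and ab: "a > 0" "b > 0"
    and \<alpha>: "\<And>t. \<alpha> t = a / (real t + 1) powr \<tau>1" and \<beta>: "\<And>t. \<beta> t = b / (real t + 1) powr \<tau>2"
    and exps: "0 < \<delta>" "\<delta> < \<tau>2" "\<delta> < 1 - \<tau>2" "\<tau>1 \<le> 1" "0 < \<tau>1 - \<tau>2 - \<delta>"
    and window: "\<forall>\<^sub>F t in sequentially. \<forall>(i, j)\<in>E. \<exists>s. t - nat \<lceil>real t powr \<delta>\<rceil> \<le> s \<and> s < t \<and> A s i j"
begin

definition residual :: "(nat \<Rightarrow> nat \<Rightarrow> real) \<Rightarrow> nat \<Rightarrow> nat \<Rightarrow> real" where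
  "residual z s k = z (Suc s) k - (z s k - \<beta> s * lap N (A s) (z s) k)"

lemma rate:
  "\<exists>C>0. \<forall>w\<ge>1. \<forall>t. (\<forall>s k. t0 \<le> s \<longrightarrow> s < t \<longrightarrow> k < N \<longrightarrow> \<bar>residual z s k\<bar> \<le> w * (real s + 1) powr - \<tau>1)
         \<longrightarrow> disagreement N (z t) \<le> C * w * (real t + 1) powr - (\<tau>1 - \<tau>2 - \<delta>)"
  unfolding residual_def using exps
  by (intro consensus_rate[OF conn EN sym ab(2) \<beta> _ _ _ _ _ window]) auto

lemma \<alpha>_powr: "\<alpha> t = a * (real t + 1) powr - \<tau>1"
  by (simp add: \<alpha> powr_minus_divide)

lemma small_steps: "\<forall>\<^sub>F t in sequentially. \<alpha> t < 1 \<and> \<beta> t * real N + \<alpha> t \<le> 1"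
proof (intro eventually_conj)
  show "\<forall>\<^sub>F t in sequentially. \<alpha> t < 1" unfolding \<alpha> using exps ab by real_asymp
  have "(\<lambda>t. b / (real t + 1) powr \<tau>2 * real N) \<longlonglongrightarrow> 0 * real N"
    using exps ab by (intro tendsto_mult tendsto_const) real_asymp
  moreover have "(\<lambda>t. a / (real t + 1) powr \<tau>1) \<longlonglongrightarrow> 0" using exps ab by real_asymp
  ultimately have "(\<lambda>t. \<beta> t * real N + \<alpha> t) \<longlonglongrightarrow> 0 * real N + 0" unfolding \<alpha> \<beta> by (intro tendsto_add)
  then have "\<forall>\<^sub>F t in sequentially. \<beta> t * real N + \<alpha> t < 1" by (rule order_tendstoD) simp
  then show "\<forall>\<^sub>F t in sequentially. \<beta> t * real N + \<alpha> t \<le> 1" by eventually_elim simp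
qed

lemma mean_step:
  assumes "\<And>k. k < N \<Longrightarrow> z' k = z k - \<beta> t * lap N (A t) z k + c * u k"
  shows "mean N z' = mean N z + c * mean N u"
proof -
  have "mean N z' = mean N (\<lambda>k. z k - \<beta> t * lap N (A t) z k + c * u k)"
    unfolding mean_def using assms by simp
  then show ?thesis using mean_lap[where A = "A t", OF sym] by (simp add: mean_add mean_diff mean_cmult)
qed

text \<open>For large t a step is a convex combination of neighbouring values and the input, so
  everything stays bounded and the residuals are of order \<open>\<alpha> t\<close>. The consensus
  rate then sends the disagreement to zero, while the average obeys a scalar averaging recursion
  with input \<open>mean N (d t)\<close>.\<close>

theorem driven_consensus_tendsto:
  assumes rec: "\<forall>\<^sub>F t in sequentially. \<forall>k<N. z (Suc t) k = z t k - \<beta> t * lap N (A t) (z t) k + \<alpha> t * (d t k - z t k)"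
    and d: "\<And>k. k < N \<Longrightarrow> (\<lambda>t. d t k) \<longlonglongrightarrow> D k" and k: "k < N"
  shows "(\<lambda>t. z t k) \<longlonglongrightarrow> mean N D"
proof -
  have "\<exists>K. \<forall>t. \<bar>d t k\<bar> \<le> K" if "k < N" for k
    using convergent_imp_Bseq[OF convergentI[OF d[OF that]]] by (auto simp: Bseq_def)
  then obtain K where K: "\<And>t k. k < N \<Longrightarrow> \<bar>d t k\<bar> \<le> K k" by metis
  define C where "C = (\<Sum>k<N. \<bar>K k\<bar>)"
  have C: "\<bar>d t k\<bar> \<le> C" if "k < N" for t k
  proof -
    have "\<bar>K k\<bar> \<le> C" unfolding C_def using that by (intro member_le_sum) auto
    then show ?thesis using K[OF that, of t] by linarith
  qed
  obtain t0 where t0: "\<And>t. t \<ge> t0 \<Longrightarrow> \<beta> t * real N + \<alpha> t \<le> 1"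
    "\<And>t k. t \<ge> t0 \<Longrightarrow> k < N \<Longrightarrow> z (Suc t) k = z t k - \<beta> t * lap N (A t) (z t) k + \<alpha> t * (d t k - z t k)"
    using eventually_conj[OF small_steps rec] unfolding eventually_sequentially by blast
  \<comment> \<open>Bounds the inputs as well as the state at time t0; convex combinations cannot
    leave this range.\<close>
  define C' where "C' = C + (\<Sum>k<N. \<bar>z t0 k\<bar>)"
  have C0: "C \<ge> 0" unfolding C_def by (intro sum_nonneg) auto
  have CC': "C \<le> C'" unfolding C'_def by (simp add: sum_nonneg)
  have bd: "\<forall>k<N. \<bar>z t k\<bar> \<le> C'" if "t \<ge> t0" for t
    using that
  proof (induction t rule: nat_induct_at_least)
    case base
    show ?case
    proof (intro allI impI)
      fix k assume "k < N"
      then have "\<bar>z t0 k\<bar> \<le> (\<Sum>k<N. \<bar>z t0 k\<bar>)" by (intro member_le_sum) auto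
      then show "\<bar>z t0 k\<bar> \<le> C'" unfolding C'_def using C0 by linarith
    qed
  next
    case (Suc t)
    show ?case
    proof (intro allI impI)
      fix k assume k: "k < N"
      let ?S = "{j. j < N \<and> A t k j}"
      define g where "g = real (card ?S)"
      have fin: "finite ?S" by simp
      have "card ?S \<le> card {..<N}" by (intro card_mono) auto
      then have gN: "g \<le> real N" by (simp add: g_def)
      have \<alpha>0: "\<alpha> t \<ge> 0" and \<beta>0: "\<beta> t \<ge> 0" unfolding \<alpha> \<beta> using ab by auto
      have "\<beta> t * g \<le> \<beta> t * real N" using gN \<beta>0 by (rule mult_left_mono)
      then have c0: "1 - \<beta> t * g - \<alpha> t \<ge> 0" using t0(1)[of t] Suc by linarith
      have lap: "lap N (A t) (z t) k = g * z t k - (\<Sum>j\<in>?S. z t j)"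
        by (simp add: lap_def g_def sum_subtractf)
      have "z (Suc t) k = (1 - \<beta> t * g - \<alpha> t) * z t k + \<beta> t * (\<Sum>j\<in>?S. z t j) + \<alpha> t * d t k"
        using t0(2)[of t k] Suc k unfolding lap by (simp add: algebra_simps)
      then have "\<bar>z (Suc t) k\<bar> \<le> \<bar>(1 - \<beta> t * g - \<alpha> t) * z t k\<bar> + \<bar>\<beta> t * (\<Sum>j\<in>?S. z t j)\<bar> + \<bar>\<alpha> t * d t k\<bar>"
        by linarith
      also have "\<dots> = (1 - \<beta> t * g - \<alpha> t) * \<bar>z t k\<bar> + \<beta> t * \<bar>\<Sum>j\<in>?S. z t j\<bar> + \<alpha> t * \<bar>d t k\<bar>"
        using c0 \<alpha>0 \<beta>0 by (simp add: abs_mult)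
      also have "\<dots> \<le> (1 - \<beta> t * g - \<alpha> t) * C' + \<beta> t * (g * C') + \<alpha> t * C'"
      proof (intro add_mono mult_left_mono c0 \<alpha>0 \<beta>0)
        show "\<bar>z t k\<bar> \<le> C'" using Suc.IH k by blast
        show "\<bar>d t k\<bar> \<le> C'" using C[OF k, of t] CC' by linarith
        have "\<bar>\<Sum>j\<in>?S. z t j\<bar> \<le> (\<Sum>j\<in>?S. \<bar>z t j\<bar>)" by (rule sum_abs)
        also have "\<dots> \<le> (\<Sum>j\<in>?S. C')" using Suc.IH by (intro sum_mono) auto
        finally show "\<bar>\<Sum>j\<in>?S. z t j\<bar> \<le> g * C'" by (simp add: g_def)
      qed
      also have "\<dots> = C'" by (simp add: algebra_simps)
      finally show "\<bar>z (Suc t) k\<bar> \<le> C'" .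
    qed
  qed
  obtain R where R: "R > 0" "\<forall>w\<ge>1. \<forall>t. (\<forall>s k. t0 \<le> s \<longrightarrow> s < t \<longrightarrow> k < N \<longrightarrow> \<bar>residual z s k\<bar> \<le> w * (real s + 1) powr - \<tau>1)
         \<longrightarrow> disagreement N (z t) \<le> R * w * (real t + 1) powr - (\<tau>1 - \<tau>2 - \<delta>)"
    using rate by blast
  define w where "w = 1 + a * (C + C')"
  have w1: "w \<ge> 1" unfolding w_def using ab C0 CC' by simp
  have res: "\<bar>residual z s k\<bar> \<le> w * (real s + 1) powr - \<tau>1" if "t0 \<le> s" "k < N" for s k
  proof -
    have "\<bar>residual z s k\<bar> = \<alpha> s * \<bar>d s k - z s k\<bar>"
      unfolding residual_def t0(2)[OF that] using ab by (simp add: abs_mult \<alpha>)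
    also have "\<dots> \<le> \<alpha> s * (C + C')"
    proof (rule mult_left_mono)
      show "\<bar>d s k - z s k\<bar> \<le> C + C'" using C[OF that(2), of s] bd[OF that(1)] that(2) by force
    qed (use ab in \<open>simp add: \<alpha>\<close>)
    also have "\<dots> = a * (C + C') * (real s + 1) powr - \<tau>1" by (simp add: \<alpha>_powr)
    also have "\<dots> \<le> w * (real s + 1) powr - \<tau>1" unfolding w_def by (intro mult_right_mono) auto
    finally show ?thesis .
  qed
  have dis: "disagreement N (z t) \<le> R * w * (real t + 1) powr - (\<tau>1 - \<tau>2 - \<delta>)" for t
    using R(2) w1 res by blast
  have "(\<lambda>t. R * w * (real t + 1) powr - (\<tau>1 - \<tau>2 - \<delta>)) \<longlonglongrightarrow> R * w * 0"
    by (intro tendsto_mult tendsto_const) (use exps in real_asymp)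
  then have lim0: "(\<lambda>t. R * w * (real t + 1) powr - (\<tau>1 - \<tau>2 - \<delta>)) \<longlonglongrightarrow> 0" by simp
  have "(\<lambda>t. z t k - mean N (z t)) \<longlonglongrightarrow> 0"
  proof (rule Lim_null_comparison[OF _ lim0], rule always_eventually, rule allI)
    show "norm (z t k - mean N (z t)) \<le> R * w * (real t + 1) powr - (\<tau>1 - \<tau>2 - \<delta>)" for t
      using abs_minus_mean_le[OF k, of "z t"] dis[of t] by simp
  qed
  moreover have "(\<lambda>t. mean N (z t)) \<longlonglongrightarrow> mean N D"
  proof (rule averaging_tendsto[OF ab(1) _ exps(4) \<alpha>])
    show "\<tau>1 > 0" using exps by linarith
    show "(\<lambda>t. mean N (d t)) \<longlonglongrightarrow> mean N D"
      unfolding mean_def using d N by (intro tendsto_divide tendsto_sum tendsto_const) auto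
    show "\<forall>\<^sub>F t in sequentially. mean N (z (Suc t)) = mean N (z t) + \<alpha> t * (mean N (d t) - mean N (z t))"
      using rec
    proof eventually_elim
      case (elim t)
      then show ?case using mean_step[of "z (Suc t)" "z t" t "\<alpha> t" "\<lambda>k. d t k - z t k"]
        by (simp add: mean_diff)
    qed
  qed
  ultimately have "(\<lambda>t. (z t k - mean N (z t)) + mean N (z t)) \<longlonglongrightarrow> 0 + mean N D" by (rule tendsto_add)
  then show ?thesis by simp
qed

end

context consensus_network
begin

text \<open>
  The growth bound on the whole trajectory and the decay of the disagreement are proved together:
  the averages contract towards the inputs up to an error proportional to the disagreement, and
  \<^const>\<open>disagreement\<close> is a vanishing fraction of the largest past value.
\<close>
theorem driven_estimates_disagreement:
  fixes X :: "nat \<Rightarrow> nat \<Rightarrow> nat \<Rightarrow> real"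
  assumes rec: "\<forall>\<^sub>F t in sequentially. \<forall>k<N. \<forall>i<m. X (Suc t) k i = X t k i - \<beta> t * lap N (A t) (\<lambda>k. X t k i) k
        + \<alpha> t * (c t k i - (\<Sum>j<m. B t k i j * X t k j))"
    and B: "\<And>k i j. k < N \<Longrightarrow> i < m \<Longrightarrow> j < m \<Longrightarrow> (\<lambda>t. B t k i j) \<longlonglongrightarrow> B' k i j"
    and B': "\<And>i j. i < m \<Longrightarrow> j < m \<Longrightarrow> mean N (\<lambda>k. B' k i j) = of_bool (i = j)"
    and c: "\<forall>\<^sub>F t in sequentially. \<forall>k<N. \<forall>i<m. \<bar>c t k i\<bar> \<le> Cc * (real t + 1) powr p" and p: "p \<ge> 0"
  shows "\<exists>C. \<forall>\<^sub>F t in sequentially. \<forall>k<N. \<forall>l<N. \<forall>i<m.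
    \<bar>X t k i - X t l i\<bar> \<le> C * (real t + 1) powr (p - (\<tau>1 - \<tau>2 - \<delta>))"
proof -
  define \<kappa> where "\<kappa> = \<tau>1 - \<tau>2 - \<delta>"
  have \<kappa>: "\<kappa> > 0" using exps by (simp add: \<kappa>_def)
  have "\<exists>K. \<forall>t. \<bar>B t k i j\<bar> \<le> K" if "k < N" "i < m" "j < m" for k i j
    using convergent_imp_Bseq[OF convergentI[OF B[OF that]]] by (auto simp: Bseq_def)
  then obtain K where K: "\<And>t k i j. k < N \<Longrightarrow> i < m \<Longrightarrow> j < m \<Longrightarrow> \<bar>B t k i j\<bar> \<le> K k i j" by metis
  define CB where "CB = (\<Sum>k<N. \<Sum>i<m. \<Sum>j<m. \<bar>K k i j\<bar>)"
  have CB: "\<bar>B t k i j\<bar> \<le> CB" if "k < N" "i < m" "j < m" for t k i j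
  proof -
    have "\<bar>K k i j\<bar> \<le> (\<Sum>j<m. \<bar>K k i j\<bar>)" using that by (intro member_le_sum) auto
    also have "\<dots> \<le> (\<Sum>i<m. \<Sum>j<m. \<bar>K k i j\<bar>)"
      using that by (intro member_le_sum[of i "{..<m}" "\<lambda>i. \<Sum>j<m. \<bar>K k i j\<bar>"] sum_nonneg) auto
    also have "\<dots> \<le> CB" unfolding CB_def
      using that by (intro member_le_sum[of k "{..<N}" "\<lambda>k. \<Sum>i<m. \<Sum>j<m. \<bar>K k i j\<bar>"] sum_nonneg) auto
    finally show ?thesis using K[OF that, of t] by linarith
  qed
  have CB0: "CB \<ge> 0" unfolding CB_def by (intro sum_nonneg) auto
  define C1 where "C1 = \<bar>Cc\<bar>"
  have C10: "C1 \<ge> 0" by (simp add: C1_def)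
  obtain t0 where rec0: "\<And>t k i. t \<ge> t0 \<Longrightarrow> k < N \<Longrightarrow> i < m \<Longrightarrow> X (Suc t) k i = X t k i - \<beta> t * lap N (A t) (\<lambda>k. X t k i) k
        + \<alpha> t * (c t k i - (\<Sum>j<m. B t k i j * X t k j))"
    and c0: "\<And>t k i. t \<ge> t0 \<Longrightarrow> k < N \<Longrightarrow> i < m \<Longrightarrow> \<bar>c t k i\<bar> \<le> Cc * (real t + 1) powr p"
    and \<alpha>1: "\<And>t. t \<ge> t0 \<Longrightarrow> \<alpha> t < 1"
    using eventually_conj[OF rec eventually_conj[OF c small_steps]] unfolding eventually_sequentially by blast
  have c1: "\<bar>c t k i\<bar> \<le> C1 * (real t + 1) powr p" if "t \<ge> t0" "k < N" "i < m" for t k i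
  proof -
    have "Cc * (real t + 1) powr p \<le> C1 * (real t + 1) powr p" unfolding C1_def by (intro mult_right_mono) auto
    then show ?thesis using c0[OF that] by linarith
  qed
  have \<alpha>0: "\<alpha> t > 0" for t unfolding \<alpha> using ab by simp
  have "\<forall>i. \<exists>C>0. \<forall>w\<ge>1. \<forall>t. (\<forall>s k. t0 \<le> s \<longrightarrow> s < t \<longrightarrow> k < N \<longrightarrow>
           \<bar>residual (\<lambda>t k. X t k i) s k\<bar> \<le> w * (real s + 1) powr - \<tau>1)
         \<longrightarrow> disagreement N (\<lambda>k. X t k i) \<le> C * w * (real t + 1) powr - (\<tau>1 - \<tau>2 - \<delta>)"
    using rate[where z = "\<lambda>t k. X t k i" for i] by simp
  then obtain R where R0: "\<And>i. R i > 0" and R: "\<And>i w t. w \<ge> 1 \<Longrightarrow> (\<And>s k. t0 \<le> s \<Longrightarrow> s < t \<Longrightarrow> k < N \<Longrightarrow>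
           \<bar>residual (\<lambda>t k. X t k i) s k\<bar> \<le> w * (real s + 1) powr - \<tau>1)
         \<Longrightarrow> disagreement N (\<lambda>k. X t k i) \<le> R i * w * (real t + 1) powr - \<kappa>"
    unfolding \<kappa>_def by metis
  define CC where "CC = (\<Sum>i<m. R i)"
  have CC: "R i \<le> CC" if "i < m" for i
    unfolding CC_def using that R0 by (intro member_le_sum) (auto intro: less_imp_le)
  have CC0: "CC \<ge> 0" unfolding CC_def using R0 by (intro sum_nonneg) (auto intro: less_imp_le)
  define S where "S = (\<lambda>t. \<Sum>k<N. \<Sum>i<m. \<bar>X t k i\<bar>)"
  define x where "x = (\<lambda>t i. mean N (\<lambda>k. X t k i))"
  define av where "av = (\<lambda>t. \<Sum>i<m. \<bar>x t i\<bar>)"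
  define dis where "dis = (\<lambda>t i. disagreement N (\<lambda>k. X t k i))"
  have S0: "S t \<ge> 0" for t unfolding S_def by (intro sum_nonneg) auto
  have av0: "av t \<ge> 0" for t unfolding av_def by (intro sum_nonneg) auto
  have BX: "\<bar>\<Sum>j<m. B t k i j * X t k j\<bar> \<le> CB * S t" if "k < N" "i < m" for t k i
  proof -
    have "\<bar>\<Sum>j<m. B t k i j * X t k j\<bar> \<le> (\<Sum>j<m. \<bar>B t k i j\<bar> * \<bar>X t k j\<bar>)"
      unfolding abs_mult[symmetric] by (rule sum_abs)
    also have "\<dots> \<le> (\<Sum>j<m. CB * \<bar>X t k j\<bar>)" using CB that by (intro sum_mono mult_right_mono) auto
    also have "\<dots> = CB * (\<Sum>j<m. \<bar>X t k j\<bar>)" by (simp add: sum_distrib_left)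
    also have "\<dots> \<le> CB * S t" unfolding S_def
      using that CB0 by (intro mult_left_mono member_le_sum[of k "{..<N}" "\<lambda>k. \<Sum>i<m. \<bar>X t k i\<bar>"] sum_nonneg) auto
    finally show ?thesis .
  qed
  \<comment> \<open>A residual is at most \<open>\<alpha> s\<close> times the input bound plus
    \<open>CB * S s\<close>. Under the bound on S assumed in \<open>dis_bound\<close> this is
    proportional to Aa, with a factor fixed in advance; CC converts residuals into disagreement.
    Thus \<Gamma> does not depend on Aa, which is chosen only later.\<close>
  define \<Gamma> where "\<Gamma> = CC * (1 + a * C1 + 2 * a * CB * real N)"
  have \<Gamma>0: "\<Gamma> \<ge> 0" unfolding \<Gamma>_def using CC0 ab C10 CB0 by (intro mult_nonneg_nonneg add_nonneg_nonneg) auto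
  have dis_bound: "dis t i \<le> \<Gamma> * Aa * (real t + 1) powr (p - \<kappa>)"
    if Aa: "Aa \<ge> 1" and i: "i < m" and Sb: "\<And>s. t0 \<le> s \<Longrightarrow> s < t \<Longrightarrow> S s \<le> 2 * real N * Aa * (real s + 1) powr p" for t i Aa
  proof -
    define g where "g = 1 + a * C1 + 2 * a * CB * real N"
    \<comment> \<open>w depends on the horizon t; this is legitimate because the constant of the
      consensus rate is uniform in w.\<close>
    define w where "w = g * Aa * (real t + 1) powr p"
    have g1: "g \<ge> 1" unfolding g_def using ab C10 CB0 by simp
    have w1: "w \<ge> 1"
    proof -
      have "1 \<le> (real t + 1) powr p" using p by (intro ge_one_powr_ge_zero) auto
      moreover have "1 * 1 \<le> g * Aa" using g1 Aa by (intro mult_mono) auto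
      ultimately have "1 * 1 \<le> (g * Aa) * (real t + 1) powr p" by (intro mult_mono) auto
      then show ?thesis by (simp add: w_def)
    qed
    have "dis t i \<le> R i * w * (real t + 1) powr - \<kappa>"
      unfolding dis_def
    proof (rule R[OF w1])
      fix s k assume s: "t0 \<le> s" "s < t" and k: "k < N"
      have sp: "(real s + 1) powr p \<le> (real t + 1) powr p" using s p by (intro powr_mono2) auto
      have "\<bar>residual (\<lambda>t k. X t k i) s k\<bar> = \<alpha> s * \<bar>c s k i - (\<Sum>j<m. B s k i j * X s k j)\<bar>"
        unfolding residual_def using rec0[OF s(1) k i] \<alpha>0[of s] by (simp add: abs_mult)
      also have "\<dots> \<le> \<alpha> s * (C1 * (real s + 1) powr p + CB * (2 * real N * Aa * (real s + 1) powr p))"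
      proof (rule mult_left_mono)
        have "CB * S s \<le> CB * (2 * real N * Aa * (real s + 1) powr p)" using Sb[OF s] CB0 by (rule mult_left_mono)
        then show "\<bar>c s k i - (\<Sum>j<m. B s k i j * X s k j)\<bar> \<le> C1 * (real s + 1) powr p + CB * (2 * real N * Aa * (real s + 1) powr p)"
          using c1[OF s(1) k i] BX[OF k i, of s] by linarith
      qed (use \<alpha>0[of s] in simp)
      also have "\<dots> = (a * C1 * 1 + 2 * a * CB * real N * Aa) * (real s + 1) powr p * (real s + 1) powr - \<tau>1"
        by (simp add: \<alpha>_powr algebra_simps)
      also have "\<dots> \<le> (a * C1 * Aa + 2 * a * CB * real N * Aa) * (real t + 1) powr p * (real s + 1) powr - \<tau>1"
        using ab C10 CB0 Aa sp
        by (intro mult_right_mono mult_mono add_mono mult_left_mono) (auto intro!: mult_nonneg_nonneg add_nonneg_nonneg)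
      also have "\<dots> \<le> w * (real s + 1) powr - \<tau>1"
        unfolding w_def g_def using Aa by (intro mult_right_mono) (auto simp: algebra_simps)
      finally show "\<bar>residual (\<lambda>t k. X t k i) s k\<bar> \<le> w * (real s + 1) powr - \<tau>1" .
    qed
    also have "\<dots> \<le> CC * w * (real t + 1) powr - \<kappa>"
      using CC[OF i] w1 by (intro mult_right_mono) auto
    also have "\<dots> = CC * g * Aa * ((real t + 1) powr p * (real t + 1) powr - \<kappa>)"
      by (simp add: w_def)
    also have "(real t + 1) powr p * (real t + 1) powr - \<kappa> = (real t + 1) powr (p - \<kappa>)"
      by (simp add: powr_add[symmetric])
    finally show ?thesis by (simp add: \<Gamma>_def g_def)
  qed
  define q where "q = (\<lambda>t. (real t + 1) powr p)"
  have q1: "q t \<ge> 1" for t unfolding q_def using p by (intro ge_one_powr_ge_zero) auto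
  have qmono: "q t \<le> q (Suc t)" for t unfolding q_def using p by (intro powr_mono2) auto
  define r where "r = (\<lambda>t. (real t + 1) powr - \<kappa>)"
  have qr: "(real t + 1) powr (p - \<kappa>) = q t * r t" for t by (simp add: q_def r_def powr_add[symmetric])
  have r0: "r \<longlonglongrightarrow> 0" unfolding r_def using \<kappa> by real_asymp
  have S_le: "S t \<le> real N * av t + real N * (\<Sum>i<m. dis t i)" for t
  proof -
    have "S t \<le> (\<Sum>k<N. \<Sum>i<m. \<bar>x t i\<bar> + dis t i)" unfolding S_def
    proof (intro sum_mono)
      fix k i assume "k \<in> {..<N}"
      then show "\<bar>X t k i\<bar> \<le> \<bar>x t i\<bar> + dis t i"
        using abs_minus_mean_le[of k N "\<lambda>k. X t k i"] by (simp add: x_def dis_def)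
    qed
    then show ?thesis by (simp add: sum.distrib av_def distrib_left)
  qed
  \<comment> \<open>The error of the averaged feedback. It vanishes in the limit because
    \<open>B'\<close> averages to the identity, although the feedback of a single agent need not be
    stable.\<close>
  define \<Delta> where "\<Delta> = (\<lambda>t i j. mean N (\<lambda>k. B t k i j) - of_bool (i = j))"
  have \<Delta>: "(\<lambda>t. \<Delta> t i j) \<longlonglongrightarrow> 0" if "i < m" "j < m" for i j
  proof -
    have "(\<lambda>t. mean N (\<lambda>k. B t k i j)) \<longlonglongrightarrow> mean N (\<lambda>k. B' k i j)"
      unfolding mean_def using B that N by (intro tendsto_divide tendsto_sum tendsto_const) auto
    then show ?thesis unfolding \<Delta>_def B'[OF that] by (rule LIM_zero)
  qed
  have av_step: "av (Suc t) \<le> (1 - \<alpha> t) * av t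
      + \<alpha> t * (real m * C1 * q t + (\<Sum>i<m. \<Sum>j<m. \<bar>\<Delta> t i j\<bar> * \<bar>x t j\<bar>) + real m * CB * (\<Sum>j<m. dis t j))"
    if t: "t \<ge> t0" for t
  proof -
    \<comment> \<open>The averaged feedback splits into the mean feedback acting on the mean state,
      which is the identity up to \<Delta>, and the local feedbacks acting on deviations from the
      mean, which are bounded by the disagreement.\<close>
    have st: "\<bar>x (Suc t) i\<bar> \<le> (1 - \<alpha> t) * \<bar>x t i\<bar>
        + \<alpha> t * (C1 * q t + (\<Sum>j<m. \<bar>\<Delta> t i j\<bar> * \<bar>x t j\<bar>) + CB * (\<Sum>j<m. dis t j))" if i: "i < m" for i
    proof -
      let ?e = "mean N (\<lambda>k. \<Sum>j<m. B t k i j * (X t k j - x t j))"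
      have "mean N (\<lambda>k. \<Sum>j<m. B t k i j * X t k j)
          = mean N (\<lambda>k. (\<Sum>j<m. B t k i j * x t j) + (\<Sum>j<m. B t k i j * (X t k j - x t j)))"
        by (simp add: sum.distrib[symmetric] algebra_simps)
      also have "\<dots> = mean N (\<lambda>k. \<Sum>j<m. B t k i j * x t j) + ?e" by (rule mean_add)
      also have "mean N (\<lambda>k. \<Sum>j<m. B t k i j * x t j) = (\<Sum>j<m. mean N (\<lambda>k. B t k i j) * x t j)"
        unfolding mean_def by (subst sum.swap) (simp add: sum_divide_distrib sum_distrib_right)
      also have "\<dots> = (\<Sum>j<m. \<Delta> t i j * x t j) + (\<Sum>j<m. of_bool (i = j) * x t j)"
        unfolding \<Delta>_def sum.distrib[symmetric] by (intro sum.cong refl) (simp add: algebra_simps)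
      also have "(\<Sum>j<m. of_bool (i = j) * x t j) = (\<Sum>j<m. if i = j then x t j else 0)"
        by (intro sum.cong refl) simp
      also have "\<dots> = x t i" using i by simp
      finally have m1: "mean N (\<lambda>k. \<Sum>j<m. B t k i j * X t k j) = (\<Sum>j<m. \<Delta> t i j * x t j) + x t i + ?e" .
      have "x (Suc t) i = x t i + \<alpha> t * mean N (\<lambda>k. c t k i - (\<Sum>j<m. B t k i j * X t k j))"
        unfolding x_def by (rule mean_step) (use rec0[OF t _ i] in simp)
      then have "x (Suc t) i = (1 - \<alpha> t) * x t i + \<alpha> t * (mean N (\<lambda>k. c t k i) - (\<Sum>j<m. \<Delta> t i j * x t j) - ?e)"
        unfolding mean_diff m1 by (simp add: algebra_simps)
      then have "\<bar>x (Suc t) i\<bar> \<le> \<bar>(1 - \<alpha> t) * x t i\<bar> + \<bar>\<alpha> t * (mean N (\<lambda>k. c t k i) - (\<Sum>j<m. \<Delta> t i j * x t j) - ?e)\<bar>"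
        by linarith
      also have "\<dots> = (1 - \<alpha> t) * \<bar>x t i\<bar> + \<alpha> t * \<bar>mean N (\<lambda>k. c t k i) - (\<Sum>j<m. \<Delta> t i j * x t j) - ?e\<bar>"
        using \<alpha>0[of t] \<alpha>1[OF t] by (simp add: abs_mult)
      also have "\<dots> \<le> (1 - \<alpha> t) * \<bar>x t i\<bar> + \<alpha> t * (C1 * q t + (\<Sum>j<m. \<bar>\<Delta> t i j\<bar> * \<bar>x t j\<bar>) + CB * (\<Sum>j<m. dis t j))"
      proof (intro add_left_mono mult_left_mono)
        have mb: "\<bar>mean N f\<bar> \<le> C" if "\<And>k. k < N \<Longrightarrow> \<bar>f k\<bar> \<le> C" for f C
        proof -
          have "\<bar>\<Sum>k<N. f k\<bar> \<le> (\<Sum>k<N. \<bar>f k\<bar>)" by (rule sum_abs)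
          also have "\<dots> \<le> (\<Sum>k<N. C)" using that by (intro sum_mono) auto
          finally show ?thesis using N by (simp add: mean_def field_simps)
        qed
        have "\<bar>mean N (\<lambda>k. c t k i)\<bar> \<le> C1 * q t" unfolding q_def using c1[OF t _ i] by (intro mb)
        moreover have "\<bar>\<Sum>j<m. \<Delta> t i j * x t j\<bar> \<le> (\<Sum>j<m. \<bar>\<Delta> t i j\<bar> * \<bar>x t j\<bar>)"
          unfolding abs_mult[symmetric] by (rule sum_abs)
        moreover have "\<bar>?e\<bar> \<le> CB * (\<Sum>j<m. dis t j)"
        proof (rule mb)
          fix k assume k: "k < N"
          have "\<bar>\<Sum>j<m. B t k i j * (X t k j - x t j)\<bar> \<le> (\<Sum>j<m. \<bar>B t k i j * (X t k j - x t j)\<bar>)" by (rule sum_abs)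
          also have "\<dots> \<le> (\<Sum>j<m. CB * dis t j)"
            unfolding abs_mult using CB[OF k i] CB0 abs_minus_mean_le[OF k]
            by (intro sum_mono mult_mono) (auto simp: x_def dis_def)
          finally show "\<bar>\<Sum>j<m. B t k i j * (X t k j - x t j)\<bar> \<le> CB * (\<Sum>j<m. dis t j)" by (simp add: sum_distrib_left)
        qed
        ultimately show "\<bar>mean N (\<lambda>k. c t k i) - (\<Sum>j<m. \<Delta> t i j * x t j) - ?e\<bar>
            \<le> C1 * q t + (\<Sum>j<m. \<bar>\<Delta> t i j\<bar> * \<bar>x t j\<bar>) + CB * (\<Sum>j<m. dis t j)" by linarith
      qed (use \<alpha>0[of t] in simp)
      finally show ?thesis .
    qed
    have "av (Suc t) \<le> (\<Sum>i<m. (1 - \<alpha> t) * \<bar>x t i\<bar>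
        + \<alpha> t * (C1 * q t + (\<Sum>j<m. \<bar>\<Delta> t i j\<bar> * \<bar>x t j\<bar>) + CB * (\<Sum>j<m. dis t j)))"
      unfolding av_def using st by (intro sum_mono) auto
    also have "\<dots> = (1 - \<alpha> t) * av t
      + \<alpha> t * (\<Sum>i<m. C1 * q t + (\<Sum>j<m. \<bar>\<Delta> t i j\<bar> * \<bar>x t j\<bar>) + CB * (\<Sum>j<m. dis t j))"
      unfolding sum.distrib sum_distrib_left[symmetric] av_def ..
    also have "(\<Sum>i<m. C1 * q t + (\<Sum>j<m. \<bar>\<Delta> t i j\<bar> * \<bar>x t j\<bar>) + CB * (\<Sum>j<m. dis t j))
       = real m * C1 * q t + (\<Sum>i<m. \<Sum>j<m. \<bar>\<Delta> t i j\<bar> * \<bar>x t j\<bar>) + real m * CB * (\<Sum>j<m. dis t j)"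
      unfolding sum.distrib by simp
    finally show ?thesis .
  qed
  define \<eta> where "\<eta> = (\<lambda>t. \<Sum>i<m. \<Sum>j<m. \<bar>\<Delta> t i j\<bar>)"
  have "(\<lambda>t. \<Sum>i<m. \<Sum>j<m. \<bar>\<Delta> t i j\<bar>) \<longlonglongrightarrow> (\<Sum>i<m. \<Sum>j<m. \<bar>0\<bar>)"
    using \<Delta> by (intro tendsto_sum tendsto_rabs) auto
  then have "\<eta> \<longlonglongrightarrow> 0" by (simp add: \<eta>_def)
  then have "\<forall>\<^sub>F t in sequentially. \<eta> t < 1 / 4" by (rule order_tendstoD) simp
  moreover have "(\<lambda>t. real m * \<Gamma> * r t) \<longlonglongrightarrow> real m * \<Gamma> * 0" by (intro tendsto_mult tendsto_const r0)
  then have "\<forall>\<^sub>F t in sequentially. real m * \<Gamma> * r t < 1" by (rule order_tendstoD) simp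
  moreover have "(\<lambda>t. real m * CB * (real m * \<Gamma>) * r t) \<longlonglongrightarrow> real m * CB * (real m * \<Gamma>) * 0" by (intro tendsto_mult tendsto_const r0)
  then have "\<forall>\<^sub>F t in sequentially. real m * CB * (real m * \<Gamma>) * r t < 1 / 4" by (rule order_tendstoD) simp
  ultimately have "\<forall>\<^sub>F t in sequentially. \<eta> t < 1 / 4 \<and> real m * \<Gamma> * r t < 1 \<and> real m * CB * (real m * \<Gamma>) * r t < 1 / 4"
    by eventually_elim blast
  then obtain t1' where t1': "\<And>t. t \<ge> t1' \<Longrightarrow> \<eta> t < 1 / 4 \<and> real m * \<Gamma> * r t < 1 \<and> real m * CB * (real m * \<Gamma>) * r t < 1 / 4"
    unfolding eventually_sequentially by blast
  define t1 where "t1 = max t0 t1'"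
  have t1: "t1 \<ge> t0" "\<And>t. t \<ge> t1 \<Longrightarrow> \<eta> t < 1 / 4 \<and> real m * \<Gamma> * r t < 1 \<and> real m * CB * (real m * \<Gamma>) * r t < 1 / 4"
    using t1' by (auto simp: t1_def)
  \<comment> \<open>\<open>4 * real m * C1\<close> puts the input below a quarter of
    \<open>Aa * q t\<close>. The feedback error and the disagreement take one quarter each by the
    choice of t1, so the driving terms sum to less than \<open>Aa * q t\<close>. The remaining
    summands start the induction at t1.\<close>
  define Aa where "Aa = 1 + 4 * real m * C1 + av t1 + (\<Sum>s\<le>t1. S s)"
  have sumS: "(\<Sum>s\<le>t1. S s) \<ge> 0" using S0 by (intro sum_nonneg) auto
  have Aa1: "Aa \<ge> 1" unfolding Aa_def using C10 av0[of t1] sumS by simp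
  have Aa2: "4 * real m * C1 \<le> Aa" unfolding Aa_def using av0[of t1] sumS by simp
  have sdis: "(\<Sum>i<m. dis t i) \<le> real m * \<Gamma> * r t * (Aa * q t)"
    if "\<And>s. t0 \<le> s \<Longrightarrow> s < t \<Longrightarrow> S s \<le> 2 * real N * Aa * (real s + 1) powr p" for t
  proof -
    have "(\<Sum>i<m. dis t i) \<le> (\<Sum>i<m. \<Gamma> * Aa * (real t + 1) powr (p - \<kappa>))"
      using dis_bound[OF Aa1 _ that] by (intro sum_mono) auto
    then show ?thesis unfolding qr by (simp add: ac_simps)
  qed
  \<comment> \<open>A joint induction without circularity: the disagreement at a new time involves S
    only at strictly earlier times, and it is then used to bound S at the new time.\<close>
  have main: "av t \<le> Aa * q t \<and> (\<forall>s. t0 \<le> s \<longrightarrow> s \<le> t \<longrightarrow> S s \<le> 2 * real N * Aa * (real s + 1) powr p)" if "t \<ge> t1" for t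
    using that
  proof (induction t rule: nat_induct_at_least)
    case base
    have "av t1 \<le> Aa * 1" unfolding Aa_def using sumS C10 by simp
    also have "\<dots> \<le> Aa * q t1" using Aa1 q1 by (intro mult_left_mono) auto
    finally have "av t1 \<le> Aa * q t1" .
    moreover have "S s \<le> 2 * real N * Aa * (real s + 1) powr p" if "s \<le> t1" for s
    proof -
      have "S s \<le> (\<Sum>s\<le>t1. S s)" using that S0 by (intro member_le_sum) auto
      also have "\<dots> \<le> Aa" unfolding Aa_def using C10 av0[of t1] by simp
      also have "\<dots> \<le> 2 * real N * Aa" using N Aa1 by simp
      also have "\<dots> \<le> 2 * real N * Aa * q s" using mult_left_mono[OF q1[of s], of "2 * real N * Aa"] Aa1 by simp
      finally show ?thesis by (simp add: q_def)
    qed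
    ultimately show ?case by blast
  next
    case (Suc t)
    have tt0: "t \<ge> t0" using Suc.hyps t1 by simp
    note T = t1(2)[OF Suc.hyps] t1(2)[OF le_SucI[OF Suc.hyps]]
    have Aq: "Aa * q t \<ge> 0" using Aa1 q1[of t] by simp
    have d1: "(\<Sum>i<m. dis t i) \<le> real m * \<Gamma> * r t * (Aa * q t)" using Suc.IH by (intro sdis) auto
    have "(\<Sum>i<m. \<Sum>j<m. \<bar>\<Delta> t i j\<bar> * \<bar>x t j\<bar>) \<le> (\<Sum>i<m. \<Sum>j<m. \<bar>\<Delta> t i j\<bar> * av t)"
      unfolding av_def by (intro sum_mono mult_left_mono member_le_sum[of _ "{..<m}" "\<lambda>i. \<bar>x t i\<bar>"]) auto
    also have "\<dots> = \<eta> t * av t" by (simp add: \<eta>_def sum_distrib_right)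
    also have "\<dots> \<le> 1 / 4 * (Aa * q t)" using T Suc.IH av0[of t]
      by (intro mult_mono) auto
    finally have e1: "(\<Sum>i<m. \<Sum>j<m. \<bar>\<Delta> t i j\<bar> * \<bar>x t j\<bar>) \<le> 1 / 4 * (Aa * q t)" .
    have "real m * CB * (\<Sum>j<m. dis t j) \<le> real m * CB * (real m * \<Gamma> * r t * (Aa * q t))"
      using d1 CB0 by (intro mult_left_mono) auto
    also have "\<dots> = (real m * CB * (real m * \<Gamma>) * r t) * (Aa * q t)" by simp
    also have "\<dots> \<le> 1 / 4 * (Aa * q t)" using T Aq by (intro mult_right_mono) auto
    finally have e2: "real m * CB * (\<Sum>j<m. dis t j) \<le> 1 / 4 * (Aa * q t)" .
    have "4 * real m * C1 * q t \<le> Aa * q t" using Aa2 q1[of t] by (intro mult_right_mono) auto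
    then have e3: "real m * C1 * q t \<le> 1 / 4 * (Aa * q t)" by simp
    have "av (Suc t) \<le> (1 - \<alpha> t) * av t
      + \<alpha> t * (real m * C1 * q t + (\<Sum>i<m. \<Sum>j<m. \<bar>\<Delta> t i j\<bar> * \<bar>x t j\<bar>) + real m * CB * (\<Sum>j<m. dis t j))"
      by (rule av_step[OF tt0])
    also have "\<dots> \<le> (1 - \<alpha> t) * (Aa * q t) + \<alpha> t * (1 * (Aa * q t))"
    proof (intro add_mono mult_left_mono)
      show "real m * C1 * q t + (\<Sum>i<m. \<Sum>j<m. \<bar>\<Delta> t i j\<bar> * \<bar>x t j\<bar>) + real m * CB * (\<Sum>j<m. dis t j) \<le> 1 * (Aa * q t)"
        using e1 e2 e3 Aq by linarith
    qed (use Suc.IH \<alpha>0[of t] \<alpha>1[OF tt0] in auto)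
    also have "\<dots> = Aa * q t" by (simp add: algebra_simps)
    also have "\<dots> \<le> Aa * q (Suc t)" using qmono Aa1 by (intro mult_left_mono) auto
    finally have av1: "av (Suc t) \<le> Aa * q (Suc t)" .
    have Aq': "Aa * q (Suc t) \<ge> 0" using Aa1 q1[of "Suc t"] by simp
    have "(\<Sum>i<m. dis (Suc t) i) \<le> real m * \<Gamma> * r (Suc t) * (Aa * q (Suc t))" using Suc.IH by (intro sdis) auto
    also have "\<dots> \<le> 1 * (Aa * q (Suc t))" using T Aq' by (intro mult_right_mono) auto
    finally have "real N * (\<Sum>i<m. dis (Suc t) i) \<le> real N * (Aa * q (Suc t))" by (intro mult_left_mono) auto
    moreover have "real N * av (Suc t) \<le> real N * (Aa * q (Suc t))" using av1 by (intro mult_left_mono) auto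
    ultimately have "S (Suc t) \<le> 2 * real N * Aa * (real (Suc t) + 1) powr p"
      using S_le[of "Suc t"] by (simp add: q_def)
    then show ?case using Suc.IH av1 by (auto simp: le_Suc_eq)
  qed
  show ?thesis
  proof (intro exI eventually_sequentiallyI[of t1] allI impI)
    fix t k l i assume t: "t \<ge> t1" and kl: "k < N" "l < N" and i: "i < m"
    have "\<bar>X t k i - X t l i\<bar> \<le> 2 * dis t i"
      using abs_diff_le_disagreement[OF kl, of "\<lambda>k. X t k i"] by (simp add: dis_def)
    also have "\<dots> \<le> 2 * (\<Gamma> * Aa * (real t + 1) powr (p - \<kappa>))"
      using main[OF t] by (intro mult_left_mono dis_bound[OF Aa1 i]) auto
    finally show "\<bar>X t k i - X t l i\<bar> \<le> 2 * \<Gamma> * Aa * (real t + 1) powr (p - (\<tau>1 - \<tau>2 - \<delta>))"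
      by (simp add: \<kappa>_def)
  qed
qed

end

subsection \<open>Measurability with random dimensions\<close>

text \<open>
  \<^const>\<open>minv\<close> of a singular matrix is an unspecified matrix of unspecified dimension, and the gains may be
  singular at early times; so the dimensions of the estimates are random.
\<close>
definition random_vec :: "'a measure \<Rightarrow> ('a \<Rightarrow> real Matrix.vec) \<Rightarrow> bool" where
  "random_vec M X \<longleftrightarrow> (\<lambda>\<omega>. dim_vec (X \<omega>)) \<in> measurable M (count_space UNIV) \<and>
     (\<forall>i. (\<lambda>\<omega>. X \<omega> $ i) \<in> borel_measurable M)"

text \<open>Entries outside the range are replaced by zero here: products read their right factor
  inside its range only, and for the left factor \<open>row_entry\<close> supplies what is read
  beyond it.\<close>

definition random_mat :: "'a measure \<Rightarrow> ('a \<Rightarrow> real mat) \<Rightarrow> bool" where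
  "random_mat M A \<longleftrightarrow> (\<lambda>\<omega>. dim_row (A \<omega>)) \<in> measurable M (count_space UNIV) \<and>
     (\<lambda>\<omega>. dim_col (A \<omega>)) \<in> measurable M (count_space UNIV) \<and>
     (\<forall>i j. (\<lambda>\<omega>. if i < dim_row (A \<omega>) \<and> j < dim_col (A \<omega>) then A \<omega> $$ (i, j) else 0) \<in> borel_measurable M)"

text \<open>An entry beyond the end depends only on the overshoot, so it is a function of the
  dimension and measurable along with it.\<close>

lemma vec_index_beyond: "dim_vec v \<le> i \<Longrightarrow> v $ i = undef_vec (i - dim_vec v)"
  by transfer (auto simp: mk_vec_def)

lemma measurable_count_space_compose:
  assumes "d \<in> measurable M (count_space UNIV)" "\<And>x. g x \<in> space N"
  shows "(\<lambda>\<omega>. g (d \<omega>)) \<in> measurable M N"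
  by (rule measurable_compose[OF assms(1)]) (use assms(2) in auto)

lemma random_vecI:
  fixes X :: "'a \<Rightarrow> real Matrix.vec"
  assumes d: "(\<lambda>\<omega>. dim_vec (X \<omega>)) \<in> measurable M (count_space UNIV)"
    and f: "\<And>i. f i \<in> borel_measurable M"
    and eq: "\<And>i \<omega>. \<omega> \<in> space M \<Longrightarrow> i < dim_vec (X \<omega>) \<Longrightarrow> X \<omega> $ i = f i \<omega>"
  shows "random_vec M X"
  unfolding random_vec_def
proof (intro conjI allI d)
  fix i
  note [measurable] = d f
  have [measurable]: "(\<lambda>\<omega>. undef_vec (i - dim_vec (X \<omega>)) :: real) \<in> borel_measurable M"
    by (rule measurable_count_space_compose[OF d]) simp
  have [measurable]: "Measurable.pred M (\<lambda>\<omega>. i < dim_vec (X \<omega>))"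
    using measurable_count_space_compose[OF d, of "\<lambda>n. i < n"] by simp
  have "(\<lambda>\<omega>. if i < dim_vec (X \<omega>) then f i \<omega> else undef_vec (i - dim_vec (X \<omega>))) \<in> borel_measurable M"
    by measurable
  then show "(\<lambda>\<omega>. X \<omega> $ i) \<in> borel_measurable M"
    by (rule measurable_cong[THEN iffD1, rotated]) (auto simp: eq vec_index_beyond)
qed

lemma random_vec_carrierI:
  fixes X :: "'a \<Rightarrow> real Matrix.vec"
  assumes "\<And>\<omega>. \<omega> \<in> space M \<Longrightarrow> X \<omega> \<in> carrier_vec d"
    and "\<And>i. i < d \<Longrightarrow> (\<lambda>\<omega>. X \<omega> $ i) \<in> borel_measurable M"
  shows "random_vec M X"
proof (rule random_vecI[where f = "\<lambda>i \<omega>. if i < d then X \<omega> $ i else 0"])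
  show "(\<lambda>\<omega>. dim_vec (X \<omega>)) \<in> measurable M (count_space UNIV)"
    using assms(1) by (subst measurable_cong[where g = "\<lambda>_. d"]) auto
  show "(\<lambda>\<omega>. if i < d then X \<omega> $ i else 0) \<in> borel_measurable M" for i
    using assms(2) by (cases "i < d") auto
qed (use assms(1) in fastforce)

lemma random_matI:
  assumes r: "(\<lambda>\<omega>. dim_row (A \<omega>)) \<in> measurable M (count_space UNIV)"
    and c: "(\<lambda>\<omega>. dim_col (A \<omega>)) \<in> measurable M (count_space UNIV)"
    and f: "\<And>i j. f i j \<in> borel_measurable M"
    and eq: "\<And>i j \<omega>. \<omega> \<in> space M \<Longrightarrow> i < dim_row (A \<omega>) \<Longrightarrow> j < dim_col (A \<omega>) \<Longrightarrow> A \<omega> $$ (i, j) = f i j \<omega>"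
  shows "random_mat M A"
  unfolding random_mat_def
proof (intro conjI allI r c)
  fix i j
  note [measurable] = f
  have [measurable]: "Measurable.pred M (\<lambda>\<omega>. i < dim_row (A \<omega>))"
    using measurable_count_space_compose[OF r, of "\<lambda>n. i < n"] by simp
  have [measurable]: "Measurable.pred M (\<lambda>\<omega>. j < dim_col (A \<omega>))"
    using measurable_count_space_compose[OF c, of "\<lambda>n. j < n"] by simp
  have "(\<lambda>\<omega>. if i < dim_row (A \<omega>) \<and> j < dim_col (A \<omega>) then f i j \<omega> else 0) \<in> borel_measurable M"
    by measurable
  then show "(\<lambda>\<omega>. if i < dim_row (A \<omega>) \<and> j < dim_col (A \<omega>) then A \<omega> $$ (i, j) else 0) \<in> borel_measurable M"
    by (rule measurable_cong[THEN iffD1, rotated]) (auto simp: eq)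
qed

lemma random_mat_const: "random_mat M (\<lambda>_. A)"
  by (simp add: random_mat_def)

lemma random_mat_entry:
  assumes "random_mat M A" "\<And>\<omega>. \<omega> \<in> space M \<Longrightarrow> A \<omega> \<in> carrier_mat nr nc" "i < nr" "j < nc"
  shows "(\<lambda>\<omega>. A \<omega> $$ (i, j)) \<in> borel_measurable M"
proof -
  have "(\<lambda>\<omega>. if i < dim_row (A \<omega>) \<and> j < dim_col (A \<omega>) then A \<omega> $$ (i, j) else 0) \<in> borel_measurable M"
    using assms(1) by (simp add: random_mat_def)
  then show ?thesis
    by (rule measurable_cong[THEN iffD1, rotated]) (use assms in auto)
qed

lemma random_vec_cong: "(\<And>\<omega>. \<omega> \<in> space M \<Longrightarrow> X \<omega> = Y \<omega>) \<Longrightarrow> random_vec M X \<longleftrightarrow> random_vec M Y"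
  unfolding random_vec_def by (intro conj_cong all_cong1 measurable_cong) auto

lemma random_vec_add:
  fixes X Y :: "'a \<Rightarrow> real Matrix.vec"
  assumes "random_vec M X" "random_vec M Y"
  shows "random_vec M (\<lambda>\<omega>. X \<omega> + Y \<omega>)"
  using assms
  by (intro random_vecI[where f = "\<lambda>i \<omega>. X \<omega> $ i + Y \<omega> $ i"])
    (auto simp: random_vec_def intro!: borel_measurable_add borel_measurable_diff borel_measurable_times)

lemma random_vec_minus:
  fixes X Y :: "'a \<Rightarrow> real Matrix.vec"
  assumes "random_vec M X" "random_vec M Y"
  shows "random_vec M (\<lambda>\<omega>. X \<omega> - Y \<omega>)"
  using assms
  by (intro random_vecI[where f = "\<lambda>i \<omega>. X \<omega> $ i - Y \<omega> $ i"])
    (auto simp: random_vec_def intro!: borel_measurable_add borel_measurable_diff borel_measurable_times)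

lemma random_vec_smult:
  assumes "random_vec M X"
  shows "random_vec M (\<lambda>\<omega>. c \<cdot>\<^sub>v X \<omega>)"
  using assms
  by (intro random_vecI[where f = "\<lambda>i \<omega>. c * X \<omega> $ i"])
    (auto simp: random_vec_def intro!: borel_measurable_add borel_measurable_diff borel_measurable_times)

lemma borel_measurable_random_sum:
  fixes f :: "nat \<Rightarrow> 'a \<Rightarrow> real"
  assumes d: "d \<in> measurable M (count_space UNIV)" and f: "\<And>k. f k \<in> borel_measurable M"
  shows "(\<lambda>\<omega>. \<Sum>k<d \<omega>. f k \<omega>) \<in> borel_measurable M"
  by (rule measurable_compose_countable[OF _ d, where f = "\<lambda>n \<omega>. \<Sum>k<n. f k \<omega>"]) (use f in measurable)

text \<open>A scalar product runs over the dimension of its right operand; with mismatched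
  dimensions it reads beyond the end of a row, so these values have to be tracked too.\<close>

definition row_entry :: "real mat \<Rightarrow> nat \<Rightarrow> nat \<Rightarrow> real" where
  "row_entry A i k = (if i < dim_row A then row A i $ k else 0)"

lemma random_row_entry:
  assumes "random_mat M A"
  shows "(\<lambda>\<omega>. row_entry (A \<omega>) i k) \<in> borel_measurable M"
proof -
  have r: "(\<lambda>\<omega>. dim_row (A \<omega>)) \<in> measurable M (count_space UNIV)"
    and c: "(\<lambda>\<omega>. dim_col (A \<omega>)) \<in> measurable M (count_space UNIV)"
    and [measurable]: "(\<lambda>\<omega>. if i < dim_row (A \<omega>) \<and> k < dim_col (A \<omega>) then A \<omega> $$ (i, k) else 0) \<in> borel_measurable M"
    using assms by (auto simp: random_mat_def)
  have [measurable]: "Measurable.pred M (\<lambda>\<omega>. i < dim_row (A \<omega>))"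
    using measurable_count_space_compose[OF r, of "\<lambda>n. i < n"] by simp
  have [measurable]: "Measurable.pred M (\<lambda>\<omega>. k < dim_col (A \<omega>))"
    using measurable_count_space_compose[OF c, of "\<lambda>n. k < n"] by simp
  have [measurable]: "(\<lambda>\<omega>. undef_vec (k - dim_col (A \<omega>)) :: real) \<in> borel_measurable M"
    by (rule measurable_count_space_compose[OF c]) simp
  have "(\<lambda>\<omega>. if i < dim_row (A \<omega>) then (if k < dim_col (A \<omega>) then
      (if i < dim_row (A \<omega>) \<and> k < dim_col (A \<omega>) then A \<omega> $$ (i, k) else 0) else undef_vec (k - dim_col (A \<omega>))) else 0)
      \<in> borel_measurable M"
    by measurable
  then show ?thesis
    by (rule measurable_cong[THEN iffD1, rotated]) (auto simp: row_entry_def vec_index_beyond)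
qed

lemma random_vec_mult_mat_vec:
  assumes A: "random_mat M A" and X: "random_vec M X"
  shows "random_vec M (\<lambda>\<omega>. A \<omega> *\<^sub>v X \<omega>)"
proof (rule random_vecI[where f = "\<lambda>i \<omega>. \<Sum>k<dim_vec (X \<omega>). row_entry (A \<omega>) i k * X \<omega> $ k"])
  show "(\<lambda>\<omega>. dim_vec (A \<omega> *\<^sub>v X \<omega>)) \<in> measurable M (count_space UNIV)"
    using A by (simp add: random_mat_def)
  show "(\<lambda>\<omega>. \<Sum>k<dim_vec (X \<omega>). row_entry (A \<omega>) i k * X \<omega> $ k) \<in> borel_measurable M" for i
    using X random_row_entry[OF A]
    by (intro borel_measurable_random_sum borel_measurable_times) (auto simp: random_vec_def)
qed (auto simp: scalar_prod_def row_entry_def lessThan_atLeast0)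

lemma random_mat_mult:
  assumes A: "random_mat M A" and B: "random_mat M B"
  shows "random_mat M (\<lambda>\<omega>. A \<omega> * B \<omega>)"
proof (rule random_matI[where f = "\<lambda>i j \<omega>. \<Sum>k<dim_row (B \<omega>). row_entry (A \<omega>) i k *
     (if k < dim_row (B \<omega>) \<and> j < dim_col (B \<omega>) then B \<omega> $$ (k, j) else 0)"])
  show "(\<lambda>\<omega>. \<Sum>k<dim_row (B \<omega>). row_entry (A \<omega>) i k *
     (if k < dim_row (B \<omega>) \<and> j < dim_col (B \<omega>) then B \<omega> $$ (k, j) else 0)) \<in> borel_measurable M" for i j
    using B random_row_entry[OF A]
    by (intro borel_measurable_random_sum borel_measurable_times) (auto simp: random_mat_def)
qed (use A B in \<open>auto simp: random_mat_def scalar_prod_def row_entry_def lessThan_atLeast0 intro!: sum.cong\<close>)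

lemma det_measurable:
  assumes A: "\<And>\<omega>. \<omega> \<in> space M \<Longrightarrow> A \<omega> \<in> carrier_mat n n"
    and m: "\<And>i j. i < n \<Longrightarrow> j < n \<Longrightarrow> (\<lambda>\<omega>. A \<omega> $$ (i, j)) \<in> borel_measurable M"
  shows "(\<lambda>\<omega>. det (A \<omega>) :: real) \<in> borel_measurable M"
proof -
  have "(\<lambda>\<omega>. \<Sum>p | p permutes {0..<n}. signof p * (\<Prod>i = 0..<n. A \<omega> $$ (i, p i))) \<in> borel_measurable M"
    using m by (intro borel_measurable_sum borel_measurable_times borel_measurable_prod borel_measurable_const)
      (auto dest: permutes_in_image)
  then show ?thesis
    by (rule measurable_cong[THEN iffD1, rotated]) (intro det_def'[symmetric] A)
qed

text \<open>Two pieces, split by the event that the determinant vanishes: a constant matrix on it,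
  the adjugate formula off it. Even the dimension may differ between the two.\<close>

lemma random_mat_minv:
  assumes A: "\<And>\<omega>. \<omega> \<in> space M \<Longrightarrow> A \<omega> \<in> carrier_mat n n"
    and m: "\<And>i j. i < n \<Longrightarrow> j < n \<Longrightarrow> (\<lambda>\<omega>. A \<omega> $$ (i, j)) \<in> borel_measurable M"
  shows "random_mat M (\<lambda>\<omega>. minv (A \<omega>))"
proof -
  let ?J = "the (None :: real mat option)"
  have [measurable]: "(\<lambda>\<omega>. det (A \<omega>)) \<in> borel_measurable M" by (rule det_measurable[OF A m])
  have minv: "minv (A \<omega>) = (if det (A \<omega>) = 0 then ?J else (1 / det (A \<omega>)) \<cdot>\<^sub>m adj_mat (A \<omega>))"
    if "\<omega> \<in> space M" for \<omega>
    using minv_singular[OF A[OF that]] minv_eq_adj[OF A[OF that]] by simp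
  have cof [measurable]: "(\<lambda>\<omega>. det (mat_delete (A \<omega>) j i)) \<in> borel_measurable M" if "i < n" "j < n" for i j
  proof (rule det_measurable[where n = "n - 1"])
    show "mat_delete (A \<omega>) j i \<in> carrier_mat (n - 1) (n - 1)" if "\<omega> \<in> space M" for \<omega>
      using A[OF that] by (auto simp: mat_delete_def)
    fix k l assume kl: "k < n - 1" "l < n - 1"
    let ?k = "if k < j then k else Suc k" and ?l = "if l < i then l else Suc l"
    have "(\<lambda>\<omega>. A \<omega> $$ (?k, ?l)) \<in> borel_measurable M" using kl by (intro m) auto
    then show "(\<lambda>\<omega>. mat_delete (A \<omega>) j i $$ (k, l)) \<in> borel_measurable M"
      by (rule measurable_cong[THEN iffD1, rotated]) (use kl in \<open>auto dest!: A simp: mat_delete_def\<close>)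
  qed
  define f where "f = (\<lambda>i j \<omega>. if det (A \<omega>) = 0 then ?J $$ (i, j)
     else if i < n \<and> j < n then 1 / det (A \<omega>) * ((- 1) ^ (j + i) * det (mat_delete (A \<omega>) j i)) else 0)"
  have dims: "(\<lambda>\<omega>. if det (A \<omega>) = 0 then d else n) \<in> measurable M (count_space UNIV)" for d
    by measurable
  show ?thesis
  proof (rule random_matI[where f = f])
    show "(\<lambda>\<omega>. dim_row (minv (A \<omega>))) \<in> measurable M (count_space UNIV)"
      by (rule measurable_cong[THEN iffD1, rotated, OF dims[of "dim_row ?J"]])
        (use A in \<open>auto simp: minv adj_mat_def\<close>)
    show "(\<lambda>\<omega>. dim_col (minv (A \<omega>))) \<in> measurable M (count_space UNIV)"
      by (rule measurable_cong[THEN iffD1, rotated, OF dims[of "dim_col ?J"]])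
        (use A in \<open>auto simp: minv adj_mat_def\<close>)
    show "f i j \<in> borel_measurable M" for i j
    proof (cases "i < n \<and> j < n")
      case True
      then have "(\<lambda>\<omega>. det (mat_delete (A \<omega>) j i)) \<in> borel_measurable M" by (intro cof) auto
      note [measurable] = this
      show ?thesis unfolding f_def by measurable
    next
      case False
      then have *: "f i j = (\<lambda>\<omega>. if det (A \<omega>) = 0 then ?J $$ (i, j) else 0)" by (auto simp: f_def fun_eq_iff)
      show ?thesis unfolding * by measurable
    qed
    fix i j \<omega> assume \<omega>: "\<omega> \<in> space M" and ij: "i < dim_row (minv (A \<omega>))" "j < dim_col (minv (A \<omega>))"
    show "minv (A \<omega>) $$ (i, j) = f i j \<omega>"
    proof (cases "det (A \<omega>) = 0")
      case False
      then show ?thesis using ij A[OF \<omega>]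
        by (simp add: minv[OF \<omega>] f_def adj_mat_def cofactor_def)
    qed (simp add: f_def minv[OF \<omega>])
  qed
qed

lemma vnorm_measurable:
  assumes "random_vec M X"
  shows "(\<lambda>\<omega>. vnorm (X \<omega>)) \<in> borel_measurable M"
proof -
  have [measurable]: "(\<lambda>\<omega>. \<Sum>i<dim_vec (X \<omega>). (X \<omega> $ i)\<^sup>2) \<in> borel_measurable M"
    using assms by (intro borel_measurable_random_sum borel_measurable_power) (auto simp: random_vec_def)
  show ?thesis unfolding vnorm_def by measurable
qed

lemma sets_tendsto_zero:
  fixes f :: "nat \<Rightarrow> 'a \<Rightarrow> real"
  assumes [measurable]: "\<And>t. f t \<in> borel_measurable M"
  shows "{\<omega> \<in> space M. (\<lambda>t. f t \<omega>) \<longlonglongrightarrow> 0} \<in> sets M"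
proof -
  have "(\<lambda>t. f t \<omega>) \<longlonglongrightarrow> 0 \<longleftrightarrow> (\<forall>n::nat. \<exists>s. \<forall>t\<ge>s. \<bar>f t \<omega>\<bar> < 1 / real (Suc n))" for \<omega>
  proof
    assume "(\<lambda>t. f t \<omega>) \<longlonglongrightarrow> 0"
    then show "\<forall>n::nat. \<exists>s. \<forall>t\<ge>s. \<bar>f t \<omega>\<bar> < 1 / real (Suc n)"
      using LIMSEQ_D[of "\<lambda>t. f t \<omega>" 0 "1 / real (Suc n)" for n] by simp
  next
    assume *: "\<forall>n::nat. \<exists>s. \<forall>t\<ge>s. \<bar>f t \<omega>\<bar> < 1 / real (Suc n)"
    show "(\<lambda>t. f t \<omega>) \<longlonglongrightarrow> 0"
    proof (rule LIMSEQ_I)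
      fix r :: real assume "r > 0"
      then obtain n where "1 / real (Suc n) < r" using nat_approx_posE by blast
      then show "\<exists>no. \<forall>n\<ge>no. norm (f n \<omega> - 0) < r" using *[rule_format, of n] by fastforce
    qed
  qed
  then show ?thesis by simp
qed

subsection \<open>Random Laplacians\<close>

lemma is_graph_laplacian_entries:
  assumes "is_graph_laplacian N A"
  shows "\<exists>E. (\<forall>i<N. \<forall>j<N. E i j = E j i) \<and> (\<forall>i<N. \<not> E i i) \<and> A \<in> carrier_mat N N \<and>
    (\<forall>i<N. \<forall>j<N. A $$ (i, j) = (if i = j then real (card {k. k < N \<and> E i k}) else if E i j then -1 else 0))"
proof -
  obtain E where E: "\<forall>i<N. \<forall>j<N. E i j = E j i" "\<forall>i<N. \<not> E i i" "A = graph_laplacian N E"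
    using assms unfolding is_graph_laplacian_def by blast
  show ?thesis by (rule exI[of _ E]) (use E in \<open>simp add: graph_laplacian_def\<close>)
qed

lemma laplacian_carrier: "is_graph_laplacian N A \<Longrightarrow> A \<in> carrier_mat N N"
  using is_graph_laplacian_entries by blast

text \<open>Diagonal entries are degrees and hence nonnegative, so the value -1 marks exactly the
  edges and serves as the adjacency relation.\<close>

lemma laplacian_edge:
  assumes "is_graph_laplacian N A" "i < N" "j < N"
  shows "A $$ (i, j) = -1 \<longleftrightarrow> A $$ (j, i) = -1" "i \<noteq> j \<Longrightarrow> A $$ (i, j) = - of_bool (A $$ (i, j) = -1)"
proof -
  obtain E where E: "\<forall>i<N. \<forall>j<N. E i j = E j i"
    "\<forall>i<N. \<forall>j<N. A $$ (i, j) = (if i = j then real (card {k. k < N \<and> E i k}) else if E i j then -1 else 0)"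
    using is_graph_laplacian_entries[OF assms(1)] by blast
  have ij: "A $$ (i, j) = (if i = j then real (card {k. k < N \<and> E i k}) else if E i j then -1 else 0)"
    "A $$ (j, i) = (if j = i then real (card {k. k < N \<and> E j k}) else if E j i then -1 else 0)"
    "E i j = E j i"
    using E assms(2,3) by blast+
  show "A $$ (i, j) = -1 \<longleftrightarrow> A $$ (j, i) = -1" "i \<noteq> j \<Longrightarrow> A $$ (i, j) = - of_bool (A $$ (i, j) = -1)"
    using ij by auto
qed

lemma laplacian_row_sum:
  assumes "is_graph_laplacian N A" "i < N"
  shows "(\<Sum>j<N. A $$ (i, j)) = 0"
proof -
  obtain E where E: "\<forall>i<N. \<not> E i i"
    "\<forall>i<N. \<forall>j<N. A $$ (i, j) = (if i = j then real (card {k. k < N \<and> E i k}) else if E i j then -1 else 0)"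
    using is_graph_laplacian_entries[OF assms(1)] by blast
  have "(\<Sum>j<N. A $$ (i, j)) = (\<Sum>j<N. (if j = i then real (card {k. k < N \<and> E i k}) else 0) - (if E i j then 1 else 0))"
    using E assms(2) by (intro sum.cong refl) auto
  also have "\<dots> = real (card {k. k < N \<and> E i k}) - (\<Sum>j | j < N \<and> E i j. 1)"
    unfolding sum_filter_lessThan using assms(2) by (simp add: sum_subtractf)
  finally show ?thesis by simp
qed

lemma laplacian_abs_le:
  assumes "is_graph_laplacian N A" "i < N" "j < N"
  shows "\<bar>A $$ (i, j)\<bar> \<le> real N"
proof -
  obtain E where "\<forall>i<N. \<forall>j<N. A $$ (i, j) = (if i = j then real (card {k. k < N \<and> E i k}) else if E i j then -1 else 0)"
    using is_graph_laplacian_entries[OF assms(1)] by blast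
  then have E: "A $$ (i, j) = (if i = j then real (card {k. k < N \<and> E i k}) else if E i j then -1 else 0)"
    using assms(2,3) by blast
  have "card {k. k < N \<and> E i k} \<le> card {..<N}" by (intro card_mono) auto
  then show ?thesis using E assms(2) by auto
qed

lemma finite_laplacians: "finite {A. is_graph_laplacian N A}"
proof (rule finite_subset)
  show "{A. is_graph_laplacian N A} \<subseteq> (\<lambda>S. graph_laplacian N (\<lambda>i j. (i, j) \<in> S)) ` Pow ({..<N} \<times> {..<N})"
  proof
    fix A assume "A \<in> {A. is_graph_laplacian N A}"
    then obtain E where "A = graph_laplacian N E" by (auto simp: is_graph_laplacian_def)
    also have "\<dots> = graph_laplacian N (\<lambda>i j. (i, j) \<in> {(i, j). i < N \<and> j < N \<and> E i j})"
      unfolding graph_laplacian_def by (intro eq_matI) (auto intro!: arg_cong[where f = card])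
    finally show "A \<in> (\<lambda>S. graph_laplacian N (\<lambda>i j. (i, j) \<in> S)) ` Pow ({..<N} \<times> {..<N})"
      by (rule image_eqI) auto
  qed
qed simp

section \<open>Generated sigma-algebras and independence\<close>

lemma gen_sigma_generators: "(\<Union>f\<in>fs. {f -` B \<inter> space M | B. B \<in> sets borel}) \<subseteq> Pow (space M)"
  by auto

text \<open>\<open>gen_sigma\<close> is a bare set system; as the sigma-algebra of a measure it
  becomes accessible to measurability reasoning.\<close>

definition gen_measure :: "'a measure \<Rightarrow> ('a \<Rightarrow> real) set \<Rightarrow> 'a measure" where
  "gen_measure M fs = sigma (space M) (\<Union>f\<in>fs. {f -` B \<inter> space M | B. B \<in> sets borel})"

lemma sets_gen_measure: "sets (gen_measure M fs) = gen_sigma M fs"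
  and space_gen_measure: "space (gen_measure M fs) = space M"
  unfolding gen_measure_def gen_sigma_def using gen_sigma_generators[of M fs]
  by (simp_all add: sets_measure_of space_measure_of)

lemma measurable_gen_measure: "f \<in> fs \<Longrightarrow> f \<in> borel_measurable (gen_measure M fs)"
  by (rule measurableI) (auto simp: sets_gen_measure space_gen_measure gen_sigma_def)

context prob_space
begin

lemma indep_vars_gen_sigma:
  assumes "indep_sets (\<lambda>t. gen_sigma M (fs t)) UNIV"
    and "\<And>t. X t \<in> borel_measurable (gen_measure M (fs t))" "\<And>t. X t \<in> borel_measurable M"
  shows "indep_vars (\<lambda>_. borel) X UNIV"
  unfolding indep_vars_def2
proof (intro conjI ballI assms(3))
  show "indep_sets (\<lambda>t. {X t -` A \<inter> space M |A. A \<in> sets borel}) UNIV"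
    using assms(1)
  proof (rule indep_sets_mono_sets)
    fix t
    show "{X t -` A \<inter> space M |A. A \<in> sets borel} \<subseteq> gen_sigma M (fs t)"
      using measurable_sets[OF assms(2)[of t]] by (auto simp: sets_gen_measure space_gen_measure)
  qed
qed

text \<open>By independence the event is missed throughout the window with probability
  \<open>(1 - \<pi>) ^ T t\<close>, at most \<open>exp (- (\<pi> * real t powr \<delta>))\<close>.
  This is eventually below \<open>real t powr - 2\<close>, hence summable.\<close>

lemma AE_eventually_window_hit:
  assumes ind: "indep_sets (\<lambda>t. sets (S t)) UNIV"
    and B: "\<And>t. B t \<in> sets (S t)" and sp: "\<And>t. space (S t) = space M"
    and pr: "\<And>t. prob (B t) = \<pi>" "\<pi> > 0" and \<delta>: "0 < \<delta>" "\<delta> < 1"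
  shows "AE \<omega> in M. \<forall>\<^sub>F t in sequentially. \<exists>s. t - nat \<lceil>real t powr \<delta>\<rceil> \<le> s \<and> s < t \<and> \<omega> \<in> B s"
proof -
  define T where "T = (\<lambda>t::nat. nat \<lceil>real t powr \<delta>\<rceil>)"
  have Bs [measurable]: "B t \<in> sets M" for t
    using ind B unfolding indep_sets_def by blast
  have compl: "space M - B t \<in> sets (S t)" for t
    using sets.compl_sets[OF B[of t]] by (simp add: sp)
  define A where "A = (\<lambda>t. {\<omega>\<in>space M. \<forall>s\<in>{t - T t..<t}. \<omega> \<notin> B s})"
  have [measurable]: "A t \<in> sets M" for t unfolding A_def by measurable
  \<comment> \<open>Guarantees \<open>T t \<le> t\<close>: the subtraction of naturals does not
    truncate and the window has its full length.\<close>
  have "\<forall>\<^sub>F x in at_top. x powr \<delta> + 1 \<le> x" using \<delta> by real_asymp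
  moreover have "\<forall>\<^sub>F x in at_top. exp (- (\<pi> * x powr \<delta>)) \<le> x powr - 2" using \<delta> pr(2) by real_asymp
  ultimately have "\<forall>\<^sub>F x in at_top. x powr \<delta> + 1 \<le> x \<and> exp (- (\<pi> * x powr \<delta>)) \<le> x powr - 2"
    by (rule eventually_conj)
  then have ev: "\<forall>\<^sub>F t in sequentially. real t powr \<delta> + 1 \<le> real t \<and> exp (- (\<pi> * real t powr \<delta>)) \<le> real t powr - 2"
    using filterlim_real_sequentially unfolding filterlim_iff by blast
  have \<pi>1: "\<pi> \<le> 1" using pr(1)[of 0] prob_le_1 by metis
  have "\<forall>\<^sub>F t in sequentially. norm (prob (A t)) \<le> real t powr - 2"
    using ev eventually_gt_at_top[of 0]
  proof eventually_elim
    case (elim t)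
    have "real (T t) \<le> real t powr \<delta> + 1" unfolding T_def by (simp add: of_nat_nat ceiling_le_iff)
    then have Tt: "T t \<le> t" using elim by linarith
    have T1: "real t powr \<delta> \<le> real (T t)" unfolding T_def by (simp add: of_nat_ceiling)
    have "real t powr \<delta> > 0" using elim by simp
    then have Tp: "T t > 0" using T1 by linarith
    let ?J = "{t - T t..<t}"
    have "A t = (\<Inter>s\<in>?J. space M - B s)" using Tp Tt elim by (auto simp: A_def)
    also have "prob \<dots> = (\<Prod>s\<in>?J. prob (space M - B s))"
      using Tp Tt elim compl by (intro indep_setsD[OF ind]) auto
    also have "\<dots> = (1 - \<pi>) ^ T t" using Tt by (simp add: prob_compl pr)
    also have "\<dots> \<le> exp (- \<pi>) ^ T t" using \<pi>1 exp_ge_add_one_self[of "- \<pi>"] by (intro power_mono) auto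
    also have "\<dots> = exp (- (\<pi> * real (T t)))" by (simp add: exp_of_nat_mult[symmetric] mult.commute)
    also have "\<dots> \<le> exp (- (\<pi> * real t powr \<delta>))" using T1 pr(2) by (simp add: mult_left_mono)
    also have "\<dots> \<le> real t powr - 2" using elim by simp
    finally show ?case by simp
  qed
  then have "summable (\<lambda>t. prob (A t))"
    by (rule summable_comparison_test_ev) (simp add: summable_real_powr_iff)
  then have "AE \<omega> in M. \<forall>\<^sub>F t in sequentially. \<omega> \<in> space M - A t"
    by (intro borel_cantelli_AE1) (auto simp: emeasure_eq_measure)
  then show ?thesis
  proof eventually_elim
    case (elim \<omega>)
    then show ?case by eventually_elim (auto simp: A_def T_def)
  qed
qed

end

section \<open>Edges of positive probability in the random Laplacian\<close>

context prob_space
begin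

text \<open>Suppose l is not reachable from k, and let S be the set reachable from k. Edge
  probabilities are symmetric, so no edge of positive probability crosses between S and its
  complement in either direction. The rows of the mean Laplacian then sum to zero on both parts
  separately, which makes zero a double eigenvalue.\<close>

lemma expected_graph_connected:
  assumes lap: "\<And>\<omega>. \<omega> \<in> space M \<Longrightarrow> is_graph_laplacian N (L \<omega>)"
    and meas: "\<And>i j. i < N \<Longrightarrow> j < N \<Longrightarrow> (\<lambda>\<omega>. L \<omega> $$ (i, j)) \<in> borel_measurable M"
    and l2: "lambda2 (Matrix.mat N N (\<lambda>(i, j). expectation (\<lambda>\<omega>. L \<omega> $$ (i, j)))) > 0"
  shows "connected_edges N {(i, j). i < N \<and> j < N \<and> prob {\<omega>\<in>space M. L \<omega> $$ (i, j) = -1} > 0}"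
    (is "connected_edges N ?E")
proof (rule ccontr)
  let ?L = "Matrix.mat N N (\<lambda>(i, j). expectation (\<lambda>\<omega>. L \<omega> $$ (i, j)))"
  assume "\<not> ?thesis"
  then obtain k l where kl: "k < N" "l < N" "(k, l) \<notin> ?E\<^sup>*" by (auto simp: connected_edges_def)
  define S where "S = {j. (k, j) \<in> ?E\<^sup>*}"
  have int: "integrable M (\<lambda>\<omega>. L \<omega> $$ (i, j))" if "i < N" "j < N" for i j
    by (rule integrable_const_bound[where B = "real N"])
      (use that in \<open>auto intro!: AE_I2 laplacian_abs_le lap meas\<close>)
  have row: "(\<Sum>j<N. expectation (\<lambda>\<omega>. L \<omega> $$ (i, j))) = 0" if "i < N" for i
  proof -
    have "(\<Sum>j<N. expectation (\<lambda>\<omega>. L \<omega> $$ (i, j))) = expectation (\<lambda>\<omega>. \<Sum>j<N. L \<omega> $$ (i, j))"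
      by (rule Bochner_Integration.integral_sum[symmetric]) (use int that in auto)
    also have "\<dots> = expectation (\<lambda>_. 0)"
      by (rule Bochner_Integration.integral_cong[OF refl]) (use lap laplacian_row_sum that in auto)
    finally show ?thesis by simp
  qed
  have off: "expectation (\<lambda>\<omega>. L \<omega> $$ (i, j)) = - prob {\<omega>\<in>space M. L \<omega> $$ (i, j) = -1}"
    if ij: "i < N" "j < N" "i \<noteq> j" for i j
  proof -
    note [measurable] = meas[OF ij(1,2)]
    have "expectation (\<lambda>\<omega>. L \<omega> $$ (i, j)) = expectation (\<lambda>\<omega>. - indicator {\<omega>\<in>space M. L \<omega> $$ (i, j) = -1} \<omega>)"
    proof (rule Bochner_Integration.integral_cong[OF refl])
      fix \<omega> assume \<omega>: "\<omega> \<in> space M"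
      show "L \<omega> $$ (i, j) = - indicator {\<omega>\<in>space M. L \<omega> $$ (i, j) = -1} \<omega>"
        using laplacian_edge(2)[OF lap[OF \<omega>] ij] \<omega> by (auto simp: indicator_def split: if_splits)
    qed
    then show ?thesis by simp
  qed
  have psym: "prob {\<omega>\<in>space M. L \<omega> $$ (i, j) = -1} = prob {\<omega>\<in>space M. L \<omega> $$ (j, i) = -1}" if "i < N" "j < N" for i j
    using laplacian_edge(1)[OF lap that] by (intro arg_cong[where f = prob] Collect_cong conj_cong refl) auto
  have cut: "expectation (\<lambda>\<omega>. L \<omega> $$ (i, j)) = 0" if ij: "i < N" "j < N" "i \<in> S \<longleftrightarrow> j \<notin> S" for i j
  proof -
    have "\<not> prob {\<omega>\<in>space M. L \<omega> $$ (i, j) = -1} > 0"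
    proof
      assume pos: "prob {\<omega>\<in>space M. L \<omega> $$ (i, j) = -1} > 0"
      then have "(i, j) \<in> ?E" "(j, i) \<in> ?E" using ij psym[OF ij(1,2)] by auto
      then have "(k, i) \<in> ?E\<^sup>* \<longleftrightarrow> (k, j) \<in> ?E\<^sup>*" by (meson rtrancl.rtrancl_into_rtrancl)
      then show False using ij(3) by (auto simp: S_def)
    qed
    then have "prob {\<omega>\<in>space M. L \<omega> $$ (i, j) = -1} = 0" by (simp add: zero_less_measure_iff)
    then show ?thesis using off[OF ij(1,2)] ij(3) by auto
  qed
  have "[:0, 1:] ^ 2 dvd char_poly ?L"
  proof (rule X_sq_dvd_char_poly[where p = k and q = l and S = S])
    show "?L \<in> carrier_mat N N" by simp
    show "k \<in> S" by (simp add: S_def)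
    show "l \<notin> S" using kl by (simp add: S_def)
    fix i assume i: "i < N"
    let ?e = "\<lambda>j. expectation (\<lambda>\<omega>. L \<omega> $$ (i, j))"
    have "(\<Sum>j<N. if j \<in> S then ?e j else 0) + (\<Sum>j<N. if j \<notin> S then ?e j else 0) = (\<Sum>j<N. ?e j)"
      unfolding sum.distrib[symmetric] by (intro sum.cong refl) auto
    then have tot: "(\<Sum>j<N. if j \<in> S then ?e j else 0) + (\<Sum>j<N. if j \<notin> S then ?e j else 0) = 0"
      using row[OF i] by simp
    have L: "(\<Sum>j<N. if j \<in> S then ?L $$ (i, j) else 0) = (\<Sum>j<N. if j \<in> S then ?e j else 0)"
      "(\<Sum>j<N. if j \<notin> S then ?L $$ (i, j) else 0) = (\<Sum>j<N. if j \<notin> S then ?e j else 0)"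
      using i by (auto intro!: sum.cong)
    show "(\<Sum>j<N. if j \<in> S then ?L $$ (i, j) else 0) = 0" "(\<Sum>j<N. if j \<notin> S then ?L $$ (i, j) else 0) = 0"
    proof (atomize (full), cases "i \<in> S")
      case True
      then have "(\<Sum>j<N. if j \<notin> S then ?e j else 0) = 0" using cut[OF i] by (intro sum.neutral) auto
      with tot show "(\<Sum>j<N. if j \<in> S then ?L $$ (i, j) else 0) = 0 \<and> (\<Sum>j<N. if j \<notin> S then ?L $$ (i, j) else 0) = 0"
        unfolding L by simp
    next
      case False
      then have "(\<Sum>j<N. if j \<in> S then ?e j else 0) = 0" using cut[OF i] by (intro sum.neutral) auto
      with tot show "(\<Sum>j<N. if j \<in> S then ?L $$ (i, j) else 0) = 0 \<and> (\<Sum>j<N. if j \<notin> S then ?L $$ (i, j) else 0) = 0"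
        unfolding L by simp
    qed
  qed (use kl in auto)
  then have "lambda2 ?L \<le> 0" by (intro lambda2_nonpos) auto
  with l2 show False by simp
qed

lemma laplacian_event_sets:
  assumes lap: "\<And>\<omega>. \<omega> \<in> space M \<Longrightarrow> is_graph_laplacian N (L \<omega>)"
    and meas: "\<And>i j. i < N \<Longrightarrow> j < N \<Longrightarrow> (\<lambda>\<omega>. L \<omega> $$ (i, j)) \<in> borel_measurable M"
    and A: "A \<in> carrier_mat N N"
  shows "{\<omega>\<in>space M. L \<omega> = A} \<in> events"
proof -
  have [measurable]: "{\<omega>\<in>space M. L \<omega> $$ (i, j) = A $$ (i, j)} \<in> events" if "i < N" "j < N" for i j
    using meas[OF that] by measurable
  have "{\<omega>\<in>space M. L \<omega> = A} = {\<omega>\<in>space M. \<forall>i\<in>{..<N}. \<forall>j\<in>{..<N}. L \<omega> $$ (i, j) = A $$ (i, j)}"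
    using A lap laplacian_carrier by (auto intro!: eq_matI) force+
  also have "\<dots> \<in> events"
    by (intro sets.sets_Collect_finite_All) auto
  finally show ?thesis .
qed

text \<open>Equality of laws is given for single matrices. There are finitely many Laplacians of
  size N, so an edge event is a finite disjoint union of such events.\<close>

lemma edge_prob_eq:
  assumes lap: "\<And>\<omega>. \<omega> \<in> space M \<Longrightarrow> is_graph_laplacian N (L \<omega>)" "\<And>\<omega>. \<omega> \<in> space M \<Longrightarrow> is_graph_laplacian N (L' \<omega>)"
    and meas: "\<And>i j. i < N \<Longrightarrow> j < N \<Longrightarrow> (\<lambda>\<omega>. L \<omega> $$ (i, j)) \<in> borel_measurable M"
      "\<And>i j. i < N \<Longrightarrow> j < N \<Longrightarrow> (\<lambda>\<omega>. L' \<omega> $$ (i, j)) \<in> borel_measurable M"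
    and eq: "\<And>A. prob {\<omega>\<in>space M. L \<omega> = A} = prob {\<omega>\<in>space M. L' \<omega> = A}"
  shows "prob {\<omega>\<in>space M. L \<omega> $$ (i, j) = -1} = prob {\<omega>\<in>space M. L' \<omega> $$ (i, j) = -1}"
proof -
  let ?C = "{A. is_graph_laplacian N A \<and> A $$ (i, j) = -1}"
  have fin: "finite ?C" by (rule finite_subset[OF _ finite_laplacians]) auto
  have *: "prob {\<omega>\<in>space M. K \<omega> $$ (i, j) = -1} = (\<Sum>A\<in>?C. prob {\<omega>\<in>space M. K \<omega> = A})"
    if "\<And>\<omega>. \<omega> \<in> space M \<Longrightarrow> is_graph_laplacian N (K \<omega>)"
      "\<And>i j. i < N \<Longrightarrow> j < N \<Longrightarrow> (\<lambda>\<omega>. K \<omega> $$ (i, j)) \<in> borel_measurable M" for K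
  proof -
    have "{\<omega>\<in>space M. K \<omega> $$ (i, j) = -1} = (\<Union>A\<in>?C. {\<omega>\<in>space M. K \<omega> = A})" using that(1) by auto
    also have "prob \<dots> = (\<Sum>A\<in>?C. prob {\<omega>\<in>space M. K \<omega> = A})"
      using fin laplacian_event_sets[OF that] laplacian_carrier
      by (intro finite_measure_finite_Union) (auto simp: disjoint_family_on_def)
    finally show ?thesis .
  qed
  show ?thesis using *[OF lap(1) meas(1)] *[OF lap(2) meas(2)] eq by simp
qed

end

section \<open>Growth and averages of the noise of one agent\<close>

lemma vec_index_le_vnorm: "i < dim_vec v \<Longrightarrow> \<bar>v $ i\<bar> \<le> vnorm v"
  unfolding vnorm_def
  by (intro real_le_rsqrt) (simp add: member_le_sum[of i "{..<dim_vec v}" "\<lambda>i. (v $ i)\<^sup>2"])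

lemma vnorm_nonneg: "vnorm v \<ge> 0"
  by (simp add: vnorm_def sum_nonneg)

text \<open>The moment is stated at time 0, and equality of laws transports it to all times.
  \<open>vecfun\<close> moves vectors into a product space, where joint laws can be
  compared.\<close>

locale iid_vectors = prob_space M for M :: "'a measure" +
  fixes d :: nat and z :: "nat \<Rightarrow> 'a \<Rightarrow> real Matrix.vec" and r :: real
  assumes dim: "\<And>t \<omega>. \<omega> \<in> space M \<Longrightarrow> z t \<omega> \<in> carrier_vec d"
    and meas: "\<And>t i. i < d \<Longrightarrow> (\<lambda>\<omega>. z t \<omega> $ i) \<in> borel_measurable M"
    and indep: "indep_sets (\<lambda>t. gen_sigma M (vcomps d (z t))) UNIV"
    and ident: "\<And>t. distr M (Pi\<^sub>M {..<d} (\<lambda>_. borel)) (vecfun d (z t)) = distr M (Pi\<^sub>M {..<d} (\<lambda>_. borel)) (vecfun d (z 0))"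
    and mom: "(\<integral>\<^sup>+\<omega>. ennreal (vnorm (z 0 \<omega>) powr r) \<partial>M) < \<infinity>" and r: "r > 2"
begin

lemma vecfun_measurable: "vecfun d (z t) \<in> measurable M (Pi\<^sub>M {..<d} (\<lambda>_. borel))"
proof -
  have "vecfun d (z t) = (\<lambda>\<omega>. \<lambda>i\<in>{..<d}. z t \<omega> $ i)" by (simp add: vecfun_def fun_eq_iff)
  then show ?thesis using meas by (auto intro!: measurable_restrict)
qed

lemma distr_eq:
  assumes g: "g \<in> borel_measurable (Pi\<^sub>M {..<d} (\<lambda>_. borel))" and X: "\<And>t \<omega>. \<omega> \<in> space M \<Longrightarrow> X t \<omega> = g (vecfun d (z t) \<omega>)"
  shows "distr M borel (X t) = distr M borel (X 0)"
proof -
  have *: "distr M borel (X t) = distr (distr M (Pi\<^sub>M {..<d} (\<lambda>_. borel)) (vecfun d (z t))) borel g" for t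
  proof -
    have "distr M borel (X t) = distr M borel (g \<circ> vecfun d (z t))"
      using X by (intro distr_cong) auto
    then show ?thesis by (simp add: distr_distr[OF g vecfun_measurable])
  qed
  show ?thesis unfolding * ident[of t] ..
qed

lemma coord_measurable: "i < d \<Longrightarrow> (\<lambda>v. v i) \<in> borel_measurable (Pi\<^sub>M {..<d} (\<lambda>_. borel))"
  by (rule measurable_component_singleton) simp

lemma vecfun_index: "i < d \<Longrightarrow> vecfun d (z t) \<omega> i = z t \<omega> $ i"
  by (simp add: vecfun_def)

lemma random_vec_z: "random_vec M (z t)"
  by (rule random_vec_carrierI[OF dim meas])

lemma vnorm_moment: "integrable M (\<lambda>\<omega>. vnorm (z 0 \<omega>) powr r)"
proof (rule integrableI_nonneg)
  show "(\<lambda>\<omega>. vnorm (z 0 \<omega>) powr r) \<in> borel_measurable M"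
    using vnorm_measurable[OF random_vec_z[of 0]] by measurable
qed (use mom in auto)

text \<open>A power of order at most r is dominated by 1 plus the power of order r.\<close>

lemma vnorm_moment_le:
  assumes s: "0 \<le> s" "s \<le> r" and Y: "Y \<in> borel_measurable M"
    and le: "\<And>\<omega>. \<omega> \<in> space M \<Longrightarrow> \<bar>Y \<omega>\<bar> \<le> vnorm (z 0 \<omega>) powr s"
  shows "integrable M Y"
proof (rule Bochner_Integration.integrable_bound)
  show "integrable M (\<lambda>\<omega>. 1 + vnorm (z 0 \<omega>) powr r)" using vnorm_moment by simp
  show "AE \<omega> in M. norm (Y \<omega>) \<le> norm (1 + vnorm (z 0 \<omega>) powr r)"
  proof (rule AE_I2)
    fix \<omega> assume \<omega>: "\<omega> \<in> space M"
    have "vnorm (z 0 \<omega>) powr s \<le> 1 + vnorm (z 0 \<omega>) powr r"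
    proof (cases "vnorm (z 0 \<omega>) \<le> 1")
      case True
      then have "vnorm (z 0 \<omega>) powr s \<le> 1 powr s" using s vnorm_nonneg by (intro powr_mono2) auto
      then have "vnorm (z 0 \<omega>) powr s \<le> 1" by simp
      then show ?thesis using powr_ge_zero[of "vnorm (z 0 \<omega>)" r] by linarith
    next
      case False
      then have "vnorm (z 0 \<omega>) powr s \<le> vnorm (z 0 \<omega>) powr r" using s by (intro powr_mono) auto
      then show ?thesis by simp
    qed
    then show "norm (Y \<omega>) \<le> norm (1 + vnorm (z 0 \<omega>) powr r)" using le[OF \<omega>] by simp
  qed
qed (rule Y)

lemma coord_le: "i < d \<Longrightarrow> \<omega> \<in> space M \<Longrightarrow> \<bar>z t \<omega> $ i\<bar> \<le> vnorm (z t \<omega>)"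
  using dim[of \<omega> t] by (intro vec_index_le_vnorm) auto

lemma AE_growth:
  assumes i: "i < d" and p: "p * r > 1"
  shows "AE \<omega> in M. \<forall>\<^sub>F t in sequentially. \<bar>z t \<omega> $ i\<bar> \<le> (real t + 1) powr p"
proof (rule AE_eventually_abs_le_powr[where r = r])
  have [measurable]: "(\<lambda>\<omega>. z t \<omega> $ i) \<in> borel_measurable M" for t using meas i by blast
  then show "(\<lambda>\<omega>. z t \<omega> $ i) \<in> borel_measurable M" for t .
  let ?X = "\<lambda>t \<omega>. \<bar>z t \<omega> $ i\<bar> powr r"
  have eq: "distr M borel (?X t) = distr M borel (?X 0)" for t
    using coord_measurable[OF i]
    by (intro distr_eq[where g = "\<lambda>v. \<bar>v i\<bar> powr r"]) (auto simp: vecfun_index i)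
  have i0: "integrable M (?X 0)"
  proof (rule vnorm_moment_le[of r])
    show "\<bar>\<bar>z 0 \<omega> $ i\<bar> powr r\<bar> \<le> vnorm (z 0 \<omega>) powr r" if "\<omega> \<in> space M" for \<omega>
      using coord_le[OF i that] r by (auto intro!: powr_mono2)
  qed (use r in auto)
  have "integrable M (?X t) \<longleftrightarrow> integrable (distr M borel (?X t)) (\<lambda>x. x)" for t
    by (rule integrable_distr_eq[symmetric]) auto
  then show "integrable M (?X t)" for t using i0 eq[of t] by simp
  have "expectation (?X t) = integral\<^sup>L (distr M borel (?X t)) (\<lambda>x. x)" for t
    by (rule integral_distr[symmetric]) auto
  then show "expectation (?X t) \<le> expectation (?X 0)" for t using eq[of t] by simp
qed (use p r in auto)

text \<open>The exponent s is the degree of growth of g: 1 for a coordinate, 2 for a product of two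
  coordinates.\<close>

lemma strong_law:
  assumes g: "g \<in> borel_measurable (Pi\<^sub>M {..<d} (\<lambda>_. borel))"
    and X: "\<And>t \<omega>. \<omega> \<in> space M \<Longrightarrow> X t \<omega> = g (vecfun d (z t) \<omega>)"
    and Xm: "\<And>t. X t \<in> borel_measurable (gen_measure M (vcomps d (z t)))" "\<And>t. X t \<in> borel_measurable M"
    and s: "0 \<le> s" "s \<le> 2" and le: "\<And>\<omega>. \<omega> \<in> space M \<Longrightarrow> \<bar>X 0 \<omega>\<bar> \<le> vnorm (z 0 \<omega>) powr s"
  shows "AE \<omega> in M. (\<lambda>n. (\<Sum>t<n. X t \<omega>) / real n) \<longlonglongrightarrow> expectation (X 0)"
proof -
  \<comment> \<open>\<open>2 * (1 + \<delta>) \<le> r\<close>, so that even a quadratic function of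
    the noise has a moment of order \<open>1 + \<delta>\<close>; this is where r > 2 enters.\<close>
  define \<delta> where "\<delta> = min 1 (r / 2 - 1)"
  have \<delta>: "0 < \<delta>" "\<delta> \<le> 1" "2 * (1 + \<delta>) \<le> r" using r by (auto simp: \<delta>_def min_def)
  show ?thesis
  proof (rule strong_law_iid[OF _ _ _ \<delta>(1,2)])
    show "distr M borel (X t) = distr M borel (X 0)" for t by (rule distr_eq[OF g X])
    show "indep_vars (\<lambda>_. borel) X UNIV" by (rule indep_vars_gen_sigma[OF indep Xm])
    show "integrable M (\<lambda>\<omega>. \<bar>X 0 \<omega>\<bar> powr (1 + \<delta>))"
    proof (rule vnorm_moment_le[of "s * (1 + \<delta>)"])
      have "s * (1 + \<delta>) \<le> 2 * (1 + \<delta>)" using s \<delta> by (intro mult_right_mono) auto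
      then show "s * (1 + \<delta>) \<le> r" using \<delta> by linarith
      show "(\<lambda>\<omega>. \<bar>X 0 \<omega>\<bar> powr (1 + \<delta>)) \<in> borel_measurable M" using Xm(2)[of 0] by measurable
      show "\<bar>\<bar>X 0 \<omega>\<bar> powr (1 + \<delta>)\<bar> \<le> vnorm (z 0 \<omega>) powr (s * (1 + \<delta>))" if "\<omega> \<in> space M" for \<omega>
      proof -
        have "\<bar>X 0 \<omega>\<bar> powr (1 + \<delta>) \<le> (vnorm (z 0 \<omega>) powr s) powr (1 + \<delta>)"
          using le[OF that] \<delta> by (intro powr_mono2) auto
        then show ?thesis by (simp add: powr_powr)
      qed
    qed (use s \<delta> in auto)
  qed
qed

lemma coord_gen: "i < d \<Longrightarrow> (\<lambda>\<omega>. z t \<omega> $ i) \<in> borel_measurable (gen_measure M (vcomps d (z t)))"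
  by (rule measurable_gen_measure) (auto simp: vcomps_def)

lemma strong_law_coord:
  assumes i: "i < d"
  shows "AE \<omega> in M. (\<lambda>n. (\<Sum>t<n. z t \<omega> $ i) / real n) \<longlonglongrightarrow> expectation (\<lambda>\<omega>. z 0 \<omega> $ i)"
proof (rule strong_law[where g = "\<lambda>v. v i" and s = 1])
  show "\<bar>z 0 \<omega> $ i\<bar> \<le> vnorm (z 0 \<omega>) powr 1" if "\<omega> \<in> space M" for \<omega>
    using coord_le[OF i that, of 0] vnorm_nonneg[of "z 0 \<omega>"] by simp
qed (auto simp: vecfun_index i coord_measurable coord_gen meas)

lemma strong_law_product:
  assumes i: "i < d" and j: "j < d"
  shows "AE \<omega> in M. (\<lambda>n. (\<Sum>t<n. z t \<omega> $ i * z t \<omega> $ j) / real n) \<longlonglongrightarrow> expectation (\<lambda>\<omega>. z 0 \<omega> $ i * z 0 \<omega> $ j)"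
proof (rule strong_law[where g = "\<lambda>v. v i * v j" and s = 2])
  show "(\<lambda>v :: nat \<Rightarrow> real. v i * v j) \<in> borel_measurable (Pi\<^sub>M {..<d} (\<lambda>_. borel))"
    by (intro borel_measurable_times coord_measurable i j)
  show "(\<lambda>\<omega>. z t \<omega> $ i * z t \<omega> $ j) \<in> borel_measurable (gen_measure M (vcomps d (z t)))" for t
    by (intro borel_measurable_times coord_gen i j)
  show "(\<lambda>\<omega>. z t \<omega> $ i * z t \<omega> $ j) \<in> borel_measurable M" for t
    by (intro borel_measurable_times meas i j)
  show "\<bar>z 0 \<omega> $ i * z 0 \<omega> $ j\<bar> \<le> vnorm (z 0 \<omega>) powr 2" if "\<omega> \<in> space M" for \<omega>
  proof -
    have "\<bar>z 0 \<omega> $ i * z 0 \<omega> $ j\<bar> \<le> vnorm (z 0 \<omega>) * vnorm (z 0 \<omega>)"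
      unfolding abs_mult using coord_le[OF i that] coord_le[OF j that] vnorm_nonneg by (intro mult_mono) auto
    then show ?thesis using vnorm_nonneg[of "z 0 \<omega>"] by (simp add: power2_eq_square)
  qed
qed (auto simp: vecfun_index i j)

end

text \<open>Here u and v are centred noise, c and e the unknown means. The mixed terms average to
  zero, and \<open>c * e\<close> cancels against the product of the sample means.\<close>

lemma sample_covariance_tendsto:
  fixes u v :: "nat \<Rightarrow> real"
  assumes u: "(\<lambda>n. (\<Sum>s<n. u s) / real n) \<longlonglongrightarrow> 0" and v: "(\<lambda>n. (\<Sum>s<n. v s) / real n) \<longlonglongrightarrow> 0"
    and uv: "(\<lambda>n. (\<Sum>s<n. u s * v s) / real n) \<longlonglongrightarrow> r"
  shows "(\<lambda>t. 1 / real t * (\<Sum>s\<le>t. (c + u s) * (e + v s))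
     - (1 / real t * (\<Sum>s<t. c + u s)) * (1 / real t * (\<Sum>s<t. e + v s))) \<longlonglongrightarrow> r"
proof -
  have shift: "(\<lambda>n. (\<Sum>s<n. k + w s) / real n) \<longlonglongrightarrow> k + l"
    if "(\<lambda>n. (\<Sum>s<n. w s) / real n) \<longlonglongrightarrow> l" for w k l
  proof -
    have "(\<lambda>n. k + (\<Sum>s<n. w s) / real n) \<longlonglongrightarrow> k + l" by (intro tendsto_intros that)
    moreover have "\<forall>\<^sub>F n in sequentially. k + (\<Sum>s<n. w s) / real n = (\<Sum>s<n. k + w s) / real n"
      using eventually_gt_at_top[of 0] by eventually_elim (simp add: sum.distrib add_divide_distrib)
    ultimately show ?thesis by (rule Lim_transform_eventually)
  qed
  have "(\<lambda>n. c * ((\<Sum>s<n. v s) / real n) + e * ((\<Sum>s<n. u s) / real n) + (\<Sum>s<n. u s * v s) / real n) \<longlonglongrightarrow> c * 0 + e * 0 + r"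
    by (intro tendsto_intros u v uv)
  then have "(\<lambda>n. (\<Sum>s<n. c * v s + e * u s + u s * v s) / real n) \<longlonglongrightarrow> r"
    by (simp add: sum.distrib sum_distrib_left add_divide_distrib)
  from shift[OF this, of "c * e"] have prod: "(\<lambda>n. (\<Sum>s<n. (c + u s) * (e + v s)) / real n) \<longlonglongrightarrow> c * e + r"
    by (simp add: algebra_simps)
  \<comment> \<open>The sum of products has t + 1 terms but is divided by t; the factor
    \<open>1 + 1 / real t\<close> corrects for this and tends to 1.\<close>
  have "(\<lambda>t. (1 + 1 / real t) * ((\<Sum>s<Suc t. (c + u s) * (e + v s)) / real (Suc t))) \<longlonglongrightarrow> (1 + 0) * (c * e + r)"
    by (intro tendsto_mult tendsto_add tendsto_const LIMSEQ_Suc[OF prod]) real_asymp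
  moreover have "\<forall>\<^sub>F t in sequentially. (1 + 1 / real t) * ((\<Sum>s<Suc t. (c + u s) * (e + v s)) / real (Suc t))
      = 1 / real t * (\<Sum>s\<le>t. (c + u s) * (e + v s))"
    using eventually_gt_at_top[of 0]
  proof eventually_elim
    case (elim t)
    then have "real t + real t * real t > 0" by (intro add_pos_pos) auto
    then have "(1 + 1 / real t) / real (Suc t) = 1 / real t" using elim by (simp add: field_simps)
    then show ?case unfolding lessThan_Suc_atMost
      by (metis times_divide_eq_left times_divide_eq_right)
  qed
  ultimately have "(\<lambda>t. 1 / real t * (\<Sum>s\<le>t. (c + u s) * (e + v s))) \<longlonglongrightarrow> (1 + 0) * (c * e + r)"
    by (rule Lim_transform_eventually)
  from tendsto_diff[OF this tendsto_mult[OF shift[OF u, of c] shift[OF v, of e]]] show ?thesis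
    by simp
qed

subsection \<open>The estimation algorithm\<close>

lemma index_mult_mat_vec_sum:
  assumes "A \<in> carrier_mat nr nc" "v \<in> carrier_vec nc" "i < nr"
  shows "(A *\<^sub>v v) $ i = (\<Sum>j<nc. A $$ (i, j) * v $ j)"
  using assms by (auto simp: scalar_prod_def lessThan_atLeast0 intro!: sum.cong)

text \<open>Separates the input, driven by the observation, from the linear feedback
  \<open>K * H\<close> acting on the estimate; this is the form treated in
  \<open>driven_estimates_disagreement\<close>.\<close>

lemma innovation_entry:
  fixes K H :: "real mat"
  assumes K: "K \<in> carrier_mat m d" and H: "H \<in> carrier_mat d m" and y: "y \<in> carrier_vec d" and x: "x \<in> carrier_vec m" and i: "i < m"
  shows "(K *\<^sub>v (y - H *\<^sub>v x)) $ i = (\<Sum>j<d. K $$ (i, j) * y $ j) - (\<Sum>j<m. (K * H) $$ (i, j) * x $ j)"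
proof -
  have "K *\<^sub>v (y - H *\<^sub>v x) = K *\<^sub>v y - K *\<^sub>v (H *\<^sub>v x)"
    using K H y x by (intro mult_minus_distrib_mat_vec) auto
  also have "K *\<^sub>v (H *\<^sub>v x) = (K * H) *\<^sub>v x"
    using K H x by (intro assoc_mult_mat_vec[symmetric]) auto
  finally have "(K *\<^sub>v (y - H *\<^sub>v x)) $ i = (K *\<^sub>v y) $ i - ((K * H) *\<^sub>v x) $ i"
    using K H y x i by simp
  then show ?thesis
    using index_mult_mat_vec_sum[OF K y i] index_mult_mat_vec_sum[OF mult_carrier_mat[OF K H] x i] by simp
qed

lemma vnorm_le_l1: "vnorm v \<le> (\<Sum>i<dim_vec v. \<bar>v $ i\<bar>)"
  using L2_set_le_sum_abs[of "\<lambda>i. v $ i" "{..<dim_vec v}"] by (simp add: vnorm_def L2_set_def)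

section \<open>Gains and estimates along one realization\<close>

context consensus_network
begin

text \<open>Entry by entry this is a scalar driven consensus with inputs from \<open>D k t\<close>,
  so all agents reach the average of the limits.\<close>

lemma gain_matrix_tendsto:
  fixes G :: "nat \<Rightarrow> nat \<Rightarrow> real mat" and D :: "nat \<Rightarrow> nat \<Rightarrow> real mat"
  assumes G_carr: "\<And>k t. k < N \<Longrightarrow> G k t \<in> carrier_mat m m"
    and G_step: "\<And>k t. k < N \<Longrightarrow> G k (Suc t) = G k t
          - \<beta> t \<cdot>\<^sub>m msum m m (\<lambda>j. G k t - G j t) {j. j < N \<and> A t k j} + \<alpha> t \<cdot>\<^sub>m (D k t - G k t)"
    and D: "\<And>k. k < N \<Longrightarrow> mat_tendsto m m (D k) (D' k)" and k: "k < N"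
  shows "mat_tendsto m m (G k) (Matrix.mat m m (\<lambda>(i, j). (1 / real N) * (\<Sum>k<N. D' k $$ (i, j))))"
proof (rule mat_tendstoI)
  show "\<forall>\<^sub>F t in sequentially. G k t \<in> carrier_mat m m" using G_carr[OF k] by simp
  fix i j assume ij: "i < m" "j < m"
  have ev: "\<forall>\<^sub>F t in sequentially. \<forall>k\<in>{..<N}. D k t \<in> carrier_mat m m"
    using D by (intro eventually_ball_finite) (auto simp: mat_tendsto_def)
  have "(\<lambda>t. G k t $$ (i, j)) \<longlonglongrightarrow> mean N (\<lambda>k. D' k $$ (i, j))"
  proof (rule driven_consensus_tendsto[where d = "\<lambda>t k. D k t $$ (i, j)" and z = "\<lambda>t k. G k t $$ (i, j)", OF _ _ k])
    show "(\<lambda>t. D k t $$ (i, j)) \<longlonglongrightarrow> D' k $$ (i, j)" if "k < N" for k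
      using D[OF that] ij by (simp add: mat_tendsto_def)
    show "\<forall>\<^sub>F t in sequentially. \<forall>k<N. G k (Suc t) $$ (i, j) = G k t $$ (i, j)
        - \<beta> t * lap N (A t) (\<lambda>k. G k t $$ (i, j)) k + \<alpha> t * (D k t $$ (i, j) - G k t $$ (i, j))"
      using ev
    proof eventually_elim
      case (elim t)
      show ?case
      proof (intro allI impI)
        fix k assume k: "k < N"
        have "(G k t - G l t) $$ (i, j) = G k t $$ (i, j) - G l t $$ (i, j)" if "l < N" for l
          using G_carr[OF that, of t] ij by simp
        then have "msum m m (\<lambda>j. G k t - G j t) {j. j < N \<and> A t k j} $$ (i, j) = lap N (A t) (\<lambda>k. G k t $$ (i, j)) k"
          unfolding msum_def lap_def using ij by (auto intro!: sum.cong)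
        then show "G k (Suc t) $$ (i, j) = G k t $$ (i, j)
            - \<beta> t * lap N (A t) (\<lambda>k. G k t $$ (i, j)) k + \<alpha> t * (D k t $$ (i, j) - G k t $$ (i, j))"
          unfolding G_step[OF k] using ij G_carr[OF k, of t] elim k by (simp add: msum_def)
      qed
    qed
  qed
  then show "(\<lambda>t. G k t $$ (i, j)) \<longlonglongrightarrow> Matrix.mat m m (\<lambda>(i, j). (1 / real N) * (\<Sum>k<N. D' k $$ (i, j))) $$ (i, j)"
    using ij by (simp add: mean_def)
qed simp

text \<open>Convergence is passed on from Q to G and then to the gains, each inverse being
  continuous at its invertible limit while the shift by \<open>\<gamma> t\<close> vanishes.\<close>

theorem estimates_disagreement:
  fixes H R :: "nat \<Rightarrow> real mat" and Q G :: "nat \<Rightarrow> nat \<Rightarrow> real mat" and x y :: "nat \<Rightarrow> nat \<Rightarrow> real Matrix.vec"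
  assumes H: "\<And>k. k < N \<Longrightarrow> H k \<in> carrier_mat (Md k) m"
    and R: "\<And>k. k < N \<Longrightarrow> invertible_mat (R k)"
    and Sig: "invertible_mat (Matrix.mat m m (\<lambda>(i,j).
        (1 / real N) * (\<Sum>k<N. (transpose_mat (H k) * minv (R k) * H k) $$ (i,j))))" (is "invertible_mat ?Sig")
    and Q: "\<And>k. k < N \<Longrightarrow> mat_tendsto (Md k) (Md k) (Q k) (R k)"
    and \<gamma>: "\<gamma> \<longlonglongrightarrow> 0"
    and G_carr: "\<And>k t. k < N \<Longrightarrow> G k t \<in> carrier_mat m m"
    and G_step: "\<And>k t. k < N \<Longrightarrow> G k (Suc t) = G k t
          - \<beta> t \<cdot>\<^sub>m msum m m (\<lambda>j. G k t - G j t) {j. j < N \<and> A t k j}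
          + \<alpha> t \<cdot>\<^sub>m (transpose_mat (H k) * minv (Q k t + \<gamma> t \<cdot>\<^sub>m 1\<^sub>m (Md k)) * H k - G k t)"
    and x_step: "\<And>k t. k < N \<Longrightarrow> x k (Suc t) = x k t
          - \<beta> t \<cdot>\<^sub>v vsum m (\<lambda>j. x k t - x j t) {j. j < N \<and> A t k j}
          + \<alpha> t \<cdot>\<^sub>v ((minv (G k t + \<gamma> t \<cdot>\<^sub>m 1\<^sub>m m) * transpose_mat (H k)
                        * minv (Q k t + \<gamma> t \<cdot>\<^sub>m 1\<^sub>m (Md k))) *\<^sub>v (y k t - H k *\<^sub>v x k t))"
    and y: "\<And>k t. k < N \<Longrightarrow> y k t \<in> carrier_vec (Md k)"
    and y_growth: "\<And>k i. k < N \<Longrightarrow> i < Md k \<Longrightarrow> \<exists>C. \<forall>\<^sub>F t in sequentially. \<bar>y k t $ i\<bar> \<le> C * (real t + 1) powr p"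
    and p: "p \<ge> 0"
  shows "\<forall>\<^sub>F t in sequentially. \<forall>k<N. x k t \<in> carrier_vec m"
    and "\<exists>C. \<forall>\<^sub>F t in sequentially. \<forall>k<N. \<forall>l<N. \<forall>i<m.
      \<bar>x k t $ i - x l t $ i\<bar> \<le> C * (real t + 1) powr (p - (\<tau>1 - \<tau>2 - \<delta>))"
proof -
  define K where "K = (\<lambda>k t. minv (G k t + \<gamma> t \<cdot>\<^sub>m 1\<^sub>m m) * transpose_mat (H k) * minv (Q k t + \<gamma> t \<cdot>\<^sub>m 1\<^sub>m (Md k)))"
  \<comment> \<open>The limit of the gains. Averaging \<open>K' k * H k\<close> over the agents
    produces the inverse of the mean information matrix times that matrix itself.\<close>
  define K' where "K' = (\<lambda>k. minv ?Sig * transpose_mat (H k) * minv (R k))"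
  have x_step': "x k (Suc t) = x k t - \<beta> t \<cdot>\<^sub>v vsum m (\<lambda>j. x k t - x j t) {j. j < N \<and> A t k j}
      + \<alpha> t \<cdot>\<^sub>v (K k t *\<^sub>v (y k t - H k *\<^sub>v x k t))" if "k < N" for k t
    unfolding K_def by (rule x_step[OF that])
  have Ht: "mat_tendsto (Md k) m (\<lambda>_. H k) (H k)" "mat_tendsto m (Md k) (\<lambda>_. transpose_mat (H k)) (transpose_mat (H k))"
    if "k < N" for k using H[OF that] by (auto intro!: mat_tendsto_const)
  have W: "mat_tendsto (Md k) (Md k) (\<lambda>t. minv (Q k t + \<gamma> t \<cdot>\<^sub>m 1\<^sub>m (Md k))) (minv (R k))" if "k < N" for k
    by (intro minv_tendsto mat_tendsto_add_smult_one Q \<gamma> R that)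
  have D: "mat_tendsto m m (\<lambda>t. transpose_mat (H k) * minv (Q k t + \<gamma> t \<cdot>\<^sub>m 1\<^sub>m (Md k)) * H k)
      (transpose_mat (H k) * minv (R k) * H k)" if "k < N" for k
    by (intro mat_tendsto_mult[OF mat_tendsto_mult[OF Ht(2) W] Ht(1)] that)
  have G: "mat_tendsto m m (G k) ?Sig" if "k < N" for k
    by (rule gain_matrix_tendsto[OF G_carr G_step D that])
  have K: "mat_tendsto m (Md k) (K k) (K' k)" if "k < N" for k
    unfolding K_def K'_def
    by (intro mat_tendsto_mult[OF mat_tendsto_mult[OF _ Ht(2)] W] minv_tendsto mat_tendsto_add_smult_one G \<gamma> Sig that)
  have KH: "mat_tendsto m m (\<lambda>t. K k t * H k) (K' k * H k)" if "k < N" for k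
    by (intro mat_tendsto_mult[OF K Ht(1)] that)
  have Kc: "\<forall>\<^sub>F t in sequentially. \<forall>k\<in>{..<N}. K k t \<in> carrier_mat m (Md k)"
    using K by (intro eventually_ball_finite) (auto simp: mat_tendsto_def)
  \<comment> \<open>A sum of vectors has the dimension of its last summand, here the number of rows
    of the gain. An estimate thus has the right dimension one step after the gain does, whatever
    happened earlier.\<close>
  have "\<forall>\<^sub>F t in sequentially. \<forall>k<N. x k (Suc t) \<in> carrier_vec m"
    using Kc
  proof eventually_elim
    case (elim t)
    then have "dim_row (K k t) = m" if "k < N" for k using that by auto
    then show ?case by (auto simp: x_step' intro!: carrier_vecI)
  qed
  then show xc: "\<forall>\<^sub>F t in sequentially. \<forall>k<N. x k t \<in> carrier_vec m"
    by (subst (asm) eventually_sequentially_Suc)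
  have cb: "\<exists>C. \<forall>\<^sub>F t in sequentially. \<bar>\<Sum>j<Md k. K k t $$ (i, j) * y k t $ j\<bar> \<le> C * (real t + 1) powr p"
    if k: "k < N" and i: "i < m" for k i
  proof -
    have "\<exists>C. \<forall>\<^sub>F t in sequentially. \<bar>K k t $$ (i, j) * y k t $ j\<bar> \<le> C * (real t + 1) powr p" if j: "j < Md k" for j
    proof -
      obtain C where C: "\<forall>\<^sub>F t in sequentially. \<bar>y k t $ j\<bar> \<le> C * (real t + 1) powr p" using y_growth[OF k j] by blast
      have "(\<lambda>t. K k t $$ (i, j)) \<longlonglongrightarrow> K' k $$ (i, j)" using K[OF k] i j by (simp add: mat_tendsto_def)
      then have "Bseq (\<lambda>t. K k t $$ (i, j))" by (intro convergent_imp_Bseq convergentI)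
      then obtain B where B: "\<And>t. \<bar>K k t $$ (i, j)\<bar> \<le> B" by (auto simp: Bseq_def)
      have "\<forall>\<^sub>F t in sequentially. \<bar>K k t $$ (i, j) * y k t $ j\<bar> \<le> (B * C) * (real t + 1) powr p"
        using C
      proof eventually_elim
        case (elim t)
        have "\<bar>K k t $$ (i, j)\<bar> * \<bar>y k t $ j\<bar> \<le> B * (C * (real t + 1) powr p)"
          using B[of t] elim by (intro mult_mono) auto
        then show ?case by (simp add: abs_mult)
      qed
      then show ?thesis by blast
    qed
    then have "\<forall>j. \<exists>C. j < Md k \<longrightarrow> (\<forall>\<^sub>F t in sequentially. \<bar>K k t $$ (i, j) * y k t $ j\<bar> \<le> C * (real t + 1) powr p)"
      by blast
    from choice[OF this] obtain C where
      C: "\<And>j. j < Md k \<Longrightarrow> \<forall>\<^sub>F t in sequentially. \<bar>K k t $$ (i, j) * y k t $ j\<bar> \<le> C j * (real t + 1) powr p"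
      by blast
    have "\<forall>\<^sub>F t in sequentially. \<forall>j\<in>{..<Md k}. \<bar>K k t $$ (i, j) * y k t $ j\<bar> \<le> C j * (real t + 1) powr p"
      using C by (intro eventually_ball_finite) auto
    then have "\<forall>\<^sub>F t in sequentially. \<bar>\<Sum>j<Md k. K k t $$ (i, j) * y k t $ j\<bar> \<le> (\<Sum>j<Md k. C j) * (real t + 1) powr p"
    proof eventually_elim
      case (elim t)
      have "\<bar>\<Sum>j<Md k. K k t $$ (i, j) * y k t $ j\<bar> \<le> (\<Sum>j<Md k. \<bar>K k t $$ (i, j) * y k t $ j\<bar>)" by (rule sum_abs)
      also have "\<dots> \<le> (\<Sum>j<Md k. C j * (real t + 1) powr p)" using elim by (intro sum_mono) auto
      finally show ?case by (simp add: sum_distrib_right)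
    qed
    then show ?thesis by blast
  qed
  have "\<forall>e. \<exists>C. fst e < N \<longrightarrow> snd e < m \<longrightarrow>
      (\<forall>\<^sub>F t in sequentially. \<bar>\<Sum>j<Md (fst e). K (fst e) t $$ (snd e, j) * y (fst e) t $ j\<bar> \<le> C * (real t + 1) powr p)"
    using cb by blast
  from choice[OF this] obtain C' where C': "\<forall>e. fst e < N \<longrightarrow> snd e < m \<longrightarrow>
      (\<forall>\<^sub>F t in sequentially. \<bar>\<Sum>j<Md (fst e). K (fst e) t $$ (snd e, j) * y (fst e) t $ j\<bar> \<le> C' e * (real t + 1) powr p)"
    by blast
  define C where "C = (\<lambda>k i. C' (k, i))"
  have C: "\<forall>\<^sub>F t in sequentially. \<bar>\<Sum>j<Md k. K k t $$ (i, j) * y k t $ j\<bar> \<le> C k i * (real t + 1) powr p"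
    if "k < N" "i < m" for k i
    using C'[rule_format, of "(k, i)"] that by (simp add: C_def)
  show "\<exists>C. \<forall>\<^sub>F t in sequentially. \<forall>k<N. \<forall>l<N. \<forall>i<m.
      \<bar>x k t $ i - x l t $ i\<bar> \<le> C * (real t + 1) powr (p - (\<tau>1 - \<tau>2 - \<delta>))"
  proof (rule driven_estimates_disagreement[where B = "\<lambda>t k i j. (K k t * H k) $$ (i, j)" and B' = "\<lambda>k i j. (K' k * H k) $$ (i, j)"
        and c = "\<lambda>t k i. \<Sum>j<Md k. K k t $$ (i, j) * y k t $ j" and Cc = "\<Sum>k<N. \<Sum>i<m. \<bar>C k i\<bar>", OF _ _ _ _ p])
    show "\<forall>\<^sub>F t in sequentially. \<forall>k<N. \<forall>i<m. x k (Suc t) $ i = x k t $ i - \<beta> t * lap N (A t) (\<lambda>k. x k t $ i) k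
        + \<alpha> t * ((\<Sum>j<Md k. K k t $$ (i, j) * y k t $ j) - (\<Sum>j<m. (K k t * H k) $$ (i, j) * x k t $ j))"
      using Kc xc
    proof eventually_elim
      case (elim t)
      show ?case
      proof (intro allI impI)
        fix k i assume k: "k < N" and i: "i < m"
        have Kk: "K k t \<in> carrier_mat m (Md k)" and xk: "x k t \<in> carrier_vec m" using elim k by auto
        have "vsum m (\<lambda>j. x k t - x j t) {j. j < N \<and> A t k j} $ i = lap N (A t) (\<lambda>k. x k t $ i) k"
          unfolding vsum_def lap_def using i elim(2) by (auto intro!: sum.cong)
        moreover have "x k (Suc t) $ i = x k t $ i - \<beta> t * vsum m (\<lambda>j. x k t - x j t) {j. j < N \<and> A t k j} $ i
           + \<alpha> t * (K k t *\<^sub>v (y k t - H k *\<^sub>v x k t)) $ i"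
          unfolding x_step'[OF k] using i Kk xk by (simp add: vsum_def del: index_mult_mat_vec)
        ultimately show "x k (Suc t) $ i = x k t $ i - \<beta> t * lap N (A t) (\<lambda>k. x k t $ i) k
          + \<alpha> t * ((\<Sum>j<Md k. K k t $$ (i, j) * y k t $ j) - (\<Sum>j<m. (K k t * H k) $$ (i, j) * x k t $ j))"
          by (simp only: innovation_entry[OF Kk H[OF k] y[OF k] xk i])
      qed
    qed
    show "(\<lambda>t. (K k t * H k) $$ (i, j)) \<longlonglongrightarrow> (K' k * H k) $$ (i, j)" if "k < N" "i < m" "j < m" for k i j
      using KH[OF that(1)] that by (simp add: mat_tendsto_def)
    show "mean N (\<lambda>k. (K' k * H k) $$ (i, j)) = of_bool (i = j)" if ij: "i < m" "j < m" for i j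
    proof -
      let ?D = "\<lambda>k. transpose_mat (H k) * minv (R k) * H k"
      have Sc: "?Sig \<in> carrier_mat m m" by simp
      have Si: "minv ?Sig \<in> carrier_mat m m"
        using minv_tendsto[OF mat_tendsto_const[OF Sc] Sig] by (simp add: mat_tendsto_def)
      have Dc: "?D k \<in> carrier_mat m m" "(K' k * H k) $$ (i, j) = (\<Sum>l<m. minv ?Sig $$ (i, l) * ?D k $$ (l, j))" if k: "k < N" for k
      proof -
        have Ri: "minv (R k) \<in> carrier_mat (Md k) (Md k)" using W[OF k] by (simp add: mat_tendsto_def)
        have Hk: "H k \<in> carrier_mat (Md k) m" "transpose_mat (H k) \<in> carrier_mat m (Md k)" using H[OF k] by auto
        show Dk: "?D k \<in> carrier_mat m m" using Ri Hk by (meson mult_carrier_mat)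
        have "K' k * H k = minv ?Sig * (transpose_mat (H k) * minv (R k)) * H k"
          unfolding K'_def using assoc_mult_mat[OF Si Hk(2) Ri] by simp
        also have "\<dots> = minv ?Sig * ?D k"
          by (rule assoc_mult_mat[OF Si mult_carrier_mat[OF Hk(2) Ri] Hk(1)])
        finally show "(K' k * H k) $$ (i, j) = (\<Sum>l<m. minv ?Sig $$ (i, l) * ?D k $$ (l, j))"
          using index_mult_mat_sum[OF Si Dk ij] by simp
      qed
      have "mean N (\<lambda>k. (K' k * H k) $$ (i, j)) = (\<Sum>k<N. \<Sum>l<m. minv ?Sig $$ (i, l) * ?D k $$ (l, j)) / real N"
        unfolding mean_def using Dc(2) by simp
      also have "\<dots> = (\<Sum>l<m. minv ?Sig $$ (i, l) * (1 / real N * (\<Sum>k<N. ?D k $$ (l, j))))"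
        by (subst sum.swap) (simp add: sum_divide_distrib sum_distrib_left)
      also have "\<dots> = (\<Sum>l<m. minv ?Sig $$ (i, l) * ?Sig $$ (l, j))"
        using ij by (intro sum.cong refl) simp
      also have "\<dots> = (minv ?Sig * ?Sig) $$ (i, j)" by (rule index_mult_mat_sum[OF Si Sc ij, symmetric])
      also have "minv ?Sig * ?Sig = 1\<^sub>m m" by (rule minv_mult_left[OF Sc invertible_mat_det[OF Sc Sig]])
      finally show ?thesis using ij by simp
    qed
    have "\<forall>\<^sub>F t in sequentially. \<forall>k\<in>{..<N}. \<forall>i\<in>{..<m}. \<bar>\<Sum>j<Md k. K k t $$ (i, j) * y k t $ j\<bar> \<le> C k i * (real t + 1) powr p"
      using C by (intro eventually_ball_finite ballI) auto
    then show "\<forall>\<^sub>F t in sequentially. \<forall>k<N. \<forall>i<m. \<bar>\<Sum>j<Md k. K k t $$ (i, j) * y k t $ j\<bar> \<le> (\<Sum>k<N. \<Sum>i<m. \<bar>C k i\<bar>) * (real t + 1) powr p"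
    proof eventually_elim
      case (elim t)
      show ?case
      proof (intro allI impI)
        fix k i assume k: "k < N" and i: "i < m"
        have "C k i \<le> \<bar>C k i\<bar>" by simp
        also have "\<dots> \<le> (\<Sum>i<m. \<bar>C k i\<bar>)" using i by (intro member_le_sum) auto
        also have "\<dots> \<le> (\<Sum>k<N. \<Sum>i<m. \<bar>C k i\<bar>)"
          using k by (intro member_le_sum[of k "{..<N}" "\<lambda>k. \<Sum>i<m. \<bar>C k i\<bar>"] sum_nonneg) auto
        finally have "C k i * (real t + 1) powr p \<le> (\<Sum>k<N. \<Sum>i<m. \<bar>C k i\<bar>) * (real t + 1) powr p" by (intro mult_right_mono) auto
        moreover have "\<bar>\<Sum>j<Md k. K k t $$ (i, j) * y k t $ j\<bar> \<le> C k i * (real t + 1) powr p" using elim k i by blast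
        ultimately show "\<bar>\<Sum>j<Md k. K k t $$ (i, j) * y k t $ j\<bar> \<le> (\<Sum>k<N. \<Sum>i<m. \<bar>C k i\<bar>) * (real t + 1) powr p" by linarith
      qed
    qed
  qed
qed

end

section \<open>Measurability of the quantities computed by the algorithm\<close>

lemma sample_covariance_entry:
  fixes y :: "nat \<Rightarrow> real Matrix.vec"
  assumes "\<And>s. y s \<in> carrier_vec d" "i < d" "j < d"
  shows "((1 / real t) \<cdot>\<^sub>m msum d d (\<lambda>s. outer (y s) (y s)) {..t}
          - outer ((1 / real t) \<cdot>\<^sub>v vsum d y {..<t}) ((1 / real t) \<cdot>\<^sub>v vsum d y {..<t})) $$ (i, j)
      = 1 / real t * (\<Sum>s\<le>t. y s $ i * y s $ j) - (1 / real t * (\<Sum>s<t. y s $ i)) * (1 / real t * (\<Sum>s<t. y s $ j))"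
proof -
  have "outer (y s) (y s) $$ (i, j) = y s $ i * y s $ j" for s
    using assms(1)[of s] assms(2,3) by (simp add: outer_def)
  then show ?thesis using assms(2,3) by (simp add: msum_def vsum_def outer_def[of "_ \<cdot>\<^sub>v _"])
qed

text \<open>The final claim gives the value of a probability, so the event has to be shown
  measurable. G keeps its dimensions even when an inverse is unspecified, because the outer factors
  \<open>transpose_mat (H k)\<close> and \<open>H k\<close> determine those of the product; the
  estimates enjoy no such protection.\<close>

lemma estimates_random_vec:
  fixes M :: "'a measure" and y x :: "nat \<Rightarrow> nat \<Rightarrow> 'a \<Rightarrow> real Matrix.vec" and Q G :: "nat \<Rightarrow> nat \<Rightarrow> 'a \<Rightarrow> real mat"
  assumes H: "\<And>k. k < N \<Longrightarrow> H k \<in> carrier_mat (Md k) m"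
    and y: "\<And>k t \<omega>. k < N \<Longrightarrow> \<omega> \<in> space M \<Longrightarrow> y k t \<omega> \<in> carrier_vec (Md k)"
    and ym: "\<And>k t i. k < N \<Longrightarrow> i < Md k \<Longrightarrow> (\<lambda>\<omega>. y k t \<omega> $ i) \<in> borel_measurable M"
    and Lm: "\<And>t i j. i < N \<Longrightarrow> j < N \<Longrightarrow> (\<lambda>\<omega>. L t \<omega> $$ (i, j) :: real) \<in> borel_measurable M"
    and Q01: "\<And>k. k < N \<Longrightarrow> Q0 k \<in> carrier_mat (Md k) (Md k)" "\<And>k. k < N \<Longrightarrow> Q1 k \<in> carrier_mat (Md k) (Md k)"
    and Q_init: "\<And>k \<omega>. k < N \<Longrightarrow> \<omega> \<in> space M \<Longrightarrow> Q k 0 \<omega> = Q0 k"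
      "\<And>k \<omega>. k < N \<Longrightarrow> \<omega> \<in> space M \<Longrightarrow> Q k 1 \<omega> = Q1 k"
    and Q_step: "\<And>k t \<omega>. k < N \<Longrightarrow> \<omega> \<in> space M \<Longrightarrow> t \<ge> 1 \<Longrightarrow>
        Q k (Suc t) \<omega> =
          (1 / real t) \<cdot>\<^sub>m msum (Md k) (Md k) (\<lambda>s. outer (y k s \<omega>) (y k s \<omega>)) {..t}
          - outer ((1 / real t) \<cdot>\<^sub>v vsum (Md k) (\<lambda>s. y k s \<omega>) {..<t})
                  ((1 / real t) \<cdot>\<^sub>v vsum (Md k) (\<lambda>s. y k s \<omega>) {..<t})"
    and G0: "\<And>k. k < N \<Longrightarrow> G0 k \<in> carrier_mat m m"
    and G_init: "\<And>k \<omega>. k < N \<Longrightarrow> \<omega> \<in> space M \<Longrightarrow> G k 0 \<omega> = G0 k"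
    and G_step: "\<And>k t \<omega>. k < N \<Longrightarrow> \<omega> \<in> space M \<Longrightarrow>
        G k (Suc t) \<omega> = G k t \<omega>
          - \<beta> t \<cdot>\<^sub>m msum m m (\<lambda>j. G k t \<omega> - G j t \<omega>) {j. j < N \<and> L t \<omega> $$ (k,j) = -1}
          + \<alpha> t \<cdot>\<^sub>m (transpose_mat (H k) * minv (Q k t \<omega> + \<gamma> t \<cdot>\<^sub>m 1\<^sub>m (Md k)) * H k - G k t \<omega>)"
    and x_init: "\<And>k \<omega>. k < N \<Longrightarrow> \<omega> \<in> space M \<Longrightarrow> x k 0 \<omega> = x0 k"
    and x_step: "\<And>k t \<omega>. k < N \<Longrightarrow> \<omega> \<in> space M \<Longrightarrow>
        x k (Suc t) \<omega> = x k t \<omega>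
          - \<beta> t \<cdot>\<^sub>v vsum m (\<lambda>j. x k t \<omega> - x j t \<omega>) {j. j < N \<and> L t \<omega> $$ (k,j) = -1}
          + \<alpha> t \<cdot>\<^sub>v ((minv (G k t \<omega> + \<gamma> t \<cdot>\<^sub>m 1\<^sub>m m) * transpose_mat (H k)
                        * minv (Q k t \<omega> + \<gamma> t \<cdot>\<^sub>m 1\<^sub>m (Md k)))
                      *\<^sub>v (y k t \<omega> - H k *\<^sub>v x k t \<omega>))"
    and k: "k < N"
  shows "\<omega> \<in> space M \<Longrightarrow> G k t \<omega> \<in> carrier_mat m m" and "random_vec M (x k t)"
proof -
  have Qc: "Q k t \<omega> \<in> carrier_mat (Md k) (Md k)" if "k < N" "\<omega> \<in> space M" for k t \<omega>
  proof -
    \<comment> \<open>The sample covariance formula applies from time 2 on; times 0 and 1 carry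
      given initial matrices, since for time 1 it would divide by zero.\<close>
    consider "t = 0" | "t = 1" | s where "t = Suc s" "s \<ge> 1" by (cases t) force+
    then show ?thesis
      using Q_init Q01 Q_step that by cases (auto simp: msum_def outer_def vsum_def)
  qed
  have Qm: "(\<lambda>\<omega>. Q k t \<omega> $$ (i, j)) \<in> borel_measurable M" if k: "k < N" and ij: "i < Md k" "j < Md k" for k t i j
  proof -
    consider "t = 0" | "t = 1" | s where "t = Suc s" "s \<ge> 1" by (cases t) force+
    then show ?thesis
    proof cases
      case 1
      then show ?thesis using Q_init(1)[OF k] by (simp cong: measurable_cong)
    next
      case 2
      then show ?thesis using Q_init(2)[OF k] by (simp cong: measurable_cong)
    next
      case 3
      have [measurable]: "(\<lambda>\<omega>. y k s \<omega> $ i) \<in> borel_measurable M" "(\<lambda>\<omega>. y k s \<omega> $ j) \<in> borel_measurable M" for s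
        using ym k ij by auto
      have "(\<lambda>\<omega>. 1 / real s * (\<Sum>r\<le>s. y k r \<omega> $ i * y k r \<omega> $ j)
          - (1 / real s * (\<Sum>r<s. y k r \<omega> $ i)) * (1 / real s * (\<Sum>r<s. y k r \<omega> $ j))) \<in> borel_measurable M"
        by measurable
      then show ?thesis unfolding 3
        by (rule measurable_cong[THEN iffD1, rotated])
          (simp only: Q_step[OF k _ 3(2)] sample_covariance_entry[OF y[OF k] ij])
    qed
  qed
  have W: "random_mat M (\<lambda>\<omega>. minv (Q k t \<omega> + \<gamma> t \<cdot>\<^sub>m 1\<^sub>m (Md k)))" if k: "k < N" for k t
  proof (rule random_mat_minv)
    show "Q k t \<omega> + \<gamma> t \<cdot>\<^sub>m 1\<^sub>m (Md k) \<in> carrier_mat (Md k) (Md k)" if "\<omega> \<in> space M" for \<omega>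
      using Qc[OF k that] by auto
    show "(\<lambda>\<omega>. (Q k t \<omega> + \<gamma> t \<cdot>\<^sub>m 1\<^sub>m (Md k)) $$ (i, j)) \<in> borel_measurable M" if ij: "i < Md k" "j < Md k" for i j
      using Qm[OF k ij] ij by simp
  qed
  have adj: "Measurable.pred M (\<lambda>\<omega>. L t \<omega> $$ (i, j) = -1)" if "i < N" "j < N" for t i j
    using Lm[OF that] by measurable
  have G: "(\<forall>\<omega>\<in>space M. G k t \<omega> \<in> carrier_mat m m) \<and> (\<forall>i<m. \<forall>j<m. (\<lambda>\<omega>. G k t \<omega> $$ (i, j)) \<in> borel_measurable M)"
    if "k < N" for k t
    using that
  proof (induction t arbitrary: k)
    case 0
    then show ?case using G_init G0 by (simp cong: measurable_cong)
  next
    case (Suc t)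
    note k = Suc.prems
    let ?D = "\<lambda>\<omega>. transpose_mat (H k) * minv (Q k t \<omega> + \<gamma> t \<cdot>\<^sub>m 1\<^sub>m (Md k)) * H k"
    have c: "G j t \<omega> \<in> carrier_mat m m" if "j < N" "\<omega> \<in> space M" for j \<omega> using Suc.IH[OF that(1)] that(2) by blast
    have Dc: "?D \<omega> \<in> carrier_mat m m" for \<omega> using H[OF k] by (intro carrier_matI) auto
    have "G k (Suc t) \<omega> \<in> carrier_mat m m" if "\<omega> \<in> space M" for \<omega>
      unfolding G_step[OF k that] using c[OF k that] by (intro carrier_matI) auto
    moreover have "(\<lambda>\<omega>. G k (Suc t) \<omega> $$ (i, j)) \<in> borel_measurable M" if ij: "i < m" "j < m" for i j
    proof -
      have [measurable]: "(\<lambda>\<omega>. ?D \<omega> $$ (i, j)) \<in> borel_measurable M"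
        by (rule random_mat_entry[OF _ Dc ij]) (intro random_mat_mult random_mat_const W k)
      have Gm: "(\<lambda>\<omega>. G l t \<omega> $$ (i, j)) \<in> borel_measurable M" if "l < N" for l using Suc.IH[OF that] ij by blast
      note [measurable] = Gm[OF k]
      have [measurable]: "(\<lambda>\<omega>. \<Sum>l<N. if L t \<omega> $$ (k, l) = -1 then G k t \<omega> $$ (i, j) - G l t \<omega> $$ (i, j) else 0) \<in> borel_measurable M"
        using adj[OF k] Gm k by (intro borel_measurable_sum measurable_If borel_measurable_diff) (auto simp: pred_def)
      have "(\<lambda>\<omega>. G k t \<omega> $$ (i, j) - \<beta> t * (\<Sum>l<N. if L t \<omega> $$ (k, l) = -1 then G k t \<omega> $$ (i, j) - G l t \<omega> $$ (i, j) else 0)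
         + \<alpha> t * (?D \<omega> $$ (i, j) - G k t \<omega> $$ (i, j))) \<in> borel_measurable M"
        by measurable
      then show ?thesis
      proof (rule measurable_cong[THEN iffD1, rotated])
        fix \<omega> assume \<omega>: "\<omega> \<in> space M"
        have "(G k t \<omega> - G l t \<omega>) $$ (i, j) = G k t \<omega> $$ (i, j) - G l t \<omega> $$ (i, j)" if "l < N" for l
          using c[OF that \<omega>] ij by simp
        then have "msum m m (\<lambda>j. G k t \<omega> - G j t \<omega>) {j. j < N \<and> L t \<omega> $$ (k,j) = -1} $$ (i, j)
            = (\<Sum>l<N. if L t \<omega> $$ (k, l) = -1 then G k t \<omega> $$ (i, j) - G l t \<omega> $$ (i, j) else 0)"
          unfolding sum_filter_lessThan[symmetric] msum_def using ij by (auto intro!: sum.cong)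
        then show "G k t \<omega> $$ (i, j) - \<beta> t * (\<Sum>l<N. if L t \<omega> $$ (k, l) = -1 then G k t \<omega> $$ (i, j) - G l t \<omega> $$ (i, j) else 0)
         + \<alpha> t * (?D \<omega> $$ (i, j) - G k t \<omega> $$ (i, j)) = G k (Suc t) \<omega> $$ (i, j)"
          unfolding G_step[OF k \<omega>] using ij c[OF k \<omega>] Dc[of \<omega>] by (simp add: msum_def del: index_mult_mat)
      qed
    qed
    ultimately show ?case by blast
  qed
  then show "\<omega> \<in> space M \<Longrightarrow> G k t \<omega> \<in> carrier_mat m m" using k by blast
  have V: "random_mat M (\<lambda>\<omega>. minv (G k t \<omega> + \<gamma> t \<cdot>\<^sub>m 1\<^sub>m m))" if k: "k < N" for k t
  proof (rule random_mat_minv)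
    show "G k t \<omega> + \<gamma> t \<cdot>\<^sub>m 1\<^sub>m m \<in> carrier_mat m m" if "\<omega> \<in> space M" for \<omega>
      using G[OF k] that by auto
    show "(\<lambda>\<omega>. (G k t \<omega> + \<gamma> t \<cdot>\<^sub>m 1\<^sub>m m) $$ (i, j)) \<in> borel_measurable M" if ij: "i < m" "j < m" for i j
    proof -
      have "(\<lambda>\<omega>. G k t \<omega> $$ (i, j)) \<in> borel_measurable M" using G[OF k] ij by blast
      then show ?thesis using ij by simp
    qed
  qed
  have "random_vec M (x k t)" if "k < N" for k
    using that
  proof (induction t arbitrary: k)
    case 0
    have "random_vec M (\<lambda>_. x0 k)" by (simp add: random_vec_def)
    then show ?case using random_vec_cong[of M "x k 0" "\<lambda>_. x0 k"] x_init[OF 0] by simp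
  next
    case (Suc t)
    note k = Suc.prems
    have "random_vec M (\<lambda>\<omega>. vsum m (\<lambda>j. x k t \<omega> - x j t \<omega>) {j. j < N \<and> L t \<omega> $$ (k,j) = -1})"
    proof (rule random_vec_carrierI)
      show "vsum m (\<lambda>j. x k t \<omega> - x j t \<omega>) {j. j < N \<and> L t \<omega> $$ (k,j) = -1} \<in> carrier_vec m" for \<omega>
        by (simp add: vsum_def)
      fix i assume i: "i < m"
      have "(\<lambda>\<omega>. (x k t \<omega> - x l t \<omega>) $ i) \<in> borel_measurable M" if "l < N" for l
        using random_vec_minus[OF Suc.IH[OF k] Suc.IH[OF that]] by (simp add: random_vec_def)
      then have "(\<lambda>\<omega>. \<Sum>l<N. if L t \<omega> $$ (k, l) = -1 then (x k t \<omega> - x l t \<omega>) $ i else 0) \<in> borel_measurable M"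
        using adj[OF k] k by (intro borel_measurable_sum measurable_If) (auto simp: pred_def)
      then show "(\<lambda>\<omega>. vsum m (\<lambda>j. x k t \<omega> - x j t \<omega>) {j. j < N \<and> L t \<omega> $$ (k,j) = -1} $ i) \<in> borel_measurable M"
        using i by (simp add: vsum_def sum_filter_lessThan)
    qed
    then have "random_vec M (\<lambda>\<omega>. x k t \<omega>
          - \<beta> t \<cdot>\<^sub>v vsum m (\<lambda>j. x k t \<omega> - x j t \<omega>) {j. j < N \<and> L t \<omega> $$ (k,j) = -1}
          + \<alpha> t \<cdot>\<^sub>v ((minv (G k t \<omega> + \<gamma> t \<cdot>\<^sub>m 1\<^sub>m m) * transpose_mat (H k)
                        * minv (Q k t \<omega> + \<gamma> t \<cdot>\<^sub>m 1\<^sub>m (Md k)))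
                      *\<^sub>v (y k t \<omega> - H k *\<^sub>v x k t \<omega>)))"
      by (intro random_vec_add random_vec_minus random_vec_smult random_vec_mult_mat_vec random_mat_mult
          random_mat_const V W k Suc.IH random_vec_carrierI[OF y[OF k] ym[OF k]])
    then show ?case by (subst random_vec_cong[OF x_step[OF k]])
  qed
  then show "random_vec M (x k t)" using k by blast
qed

section \<open>Almost sure rate of agreement under the stochastic assumptions\<close>

theorem theorem3p1:
  fixes M :: "'a measure" and F :: "nat \<Rightarrow> 'a measure"
    and N m :: nat and Md :: "nat \<Rightarrow> nat"
    and \<theta> :: "real Matrix.vec" and H :: "nat \<Rightarrow> real mat"
    and zeta :: "nat \<Rightarrow> nat \<Rightarrow> 'a \<Rightarrow> real Matrix.vec"
    and R :: "nat \<Rightarrow> real mat"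
    and y :: "nat \<Rightarrow> nat \<Rightarrow> 'a \<Rightarrow> real Matrix.vec"
    and L :: "nat \<Rightarrow> 'a \<Rightarrow> real mat"
    and a b \<tau>1 \<tau>2 \<epsilon>1 \<tau>0 :: real and \<gamma> :: "nat \<Rightarrow> real"
    and \<alpha> \<beta> :: "nat \<Rightarrow> real"
    and x :: "nat \<Rightarrow> nat \<Rightarrow> 'a \<Rightarrow> real Matrix.vec" and x0 :: "nat \<Rightarrow> real Matrix.vec"
    and Q G :: "nat \<Rightarrow> nat \<Rightarrow> 'a \<Rightarrow> real mat" and Q0 Q1 G0 :: "nat \<Rightarrow> real mat"
    and n l :: nat
  assumes prob: "prob_space M"
    and filt: "filtration (space M) F" and filt_sub: "\<And>t. sets (F t) \<subseteq> sets M"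
    (* observation model *)
    and theta_dim: "\<theta> \<in> carrier_vec m"
    and H_dim: "\<And>k. k < N \<Longrightarrow> H k \<in> carrier_mat (Md k) m"
    and zeta_dim: "\<And>k t \<omega>. k < N \<Longrightarrow> \<omega> \<in> space M \<Longrightarrow> zeta k t \<omega> \<in> carrier_vec (Md k)"
    and zeta_meas: "\<And>k t i. k < N \<Longrightarrow> i < Md k \<Longrightarrow>
        (\<lambda>\<omega>. zeta k t \<omega> $ i) \<in> borel_measurable (F (Suc t))"
    and zeta_indep_past: "\<And>k t. k < N \<Longrightarrow>
        prob_space.indep_sets M (\<lambda>c. if c then gen_sigma M (vcomps (Md k) (zeta k t)) else sets (F t)) UNIV"
    and zeta_indep_time: "\<And>k. k < N \<Longrightarrow>
        prob_space.indep_sets M (\<lambda>t. gen_sigma M (vcomps (Md k) (zeta k t))) UNIV"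
    and zeta_ident: "\<And>k t. k < N \<Longrightarrow>
        distr M (Pi\<^sub>M {..<Md k} (\<lambda>_. borel)) (vecfun (Md k) (zeta k t))
        = distr M (Pi\<^sub>M {..<Md k} (\<lambda>_. borel)) (vecfun (Md k) (zeta k 0))"
    and zeta_mean: "\<And>k t i. k < N \<Longrightarrow> i < Md k \<Longrightarrow>
        integrable M (\<lambda>\<omega>. zeta k t \<omega> $ i) \<and> (\<integral>\<omega>. zeta k t \<omega> $ i \<partial>M) = 0"
    and R_dim: "\<And>k. k < N \<Longrightarrow> R k \<in> carrier_mat (Md k) (Md k)"
    and R_inv: "\<And>k. k < N \<Longrightarrow> invertible_mat (R k)"
    and zeta_cov: "\<And>k t i j. k < N \<Longrightarrow> i < Md k \<Longrightarrow> j < Md k \<Longrightarrow>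
        integrable M (\<lambda>\<omega>. zeta k t \<omega> $ i * zeta k t \<omega> $ j) \<and>
        (\<integral>\<omega>. zeta k t \<omega> $ i * zeta k t \<omega> $ j \<partial>M) = R k $$ (i,j)"
    and zeta_uncorr: "\<And>k k' t s i j. k < N \<Longrightarrow> k' < N \<Longrightarrow> k \<noteq> k' \<Longrightarrow> i < Md k \<Longrightarrow> j < Md k' \<Longrightarrow>
        (\<integral>\<omega>. zeta k t \<omega> $ i * zeta k' s \<omega> $ j \<partial>M) = 0"
    and y_def: "\<And>k t \<omega>. k < N \<Longrightarrow> \<omega> \<in> space M \<Longrightarrow> y k t \<omega> = H k *\<^sub>v \<theta> + zeta k t \<omega>"
    (* communication model *)
    and L_lap: "\<And>t \<omega>. \<omega> \<in> space M \<Longrightarrow> is_graph_laplacian N (L t \<omega>)"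
    (* (A.1) *)
    and A1: "invertible_mat (Matrix.mat m m (\<lambda>(i,j).
        (1 / real N) * (\<Sum>k<N. (transpose_mat (H k) * minv (R k) * H k) $$ (i,j))))"
    (* (A.2) *)
    and L_meas: "\<And>t i j. i < N \<Longrightarrow> j < N \<Longrightarrow> (\<lambda>\<omega>. L t \<omega> $$ (i,j)) \<in> borel_measurable (F (Suc t))"
    and L_indep_past: "\<And>t. prob_space.indep_sets M
        (\<lambda>c. if c then gen_sigma M (mcomps N (L t)) else sets (F t)) UNIV"
    and L_indep_time: "prob_space.indep_sets M (\<lambda>t. gen_sigma M (mcomps N (L t))) UNIV"
    and L_ident: "\<And>t A. measure M {\<omega> \<in> space M. L t \<omega> = A} = measure M {\<omega> \<in> space M. L 0 \<omega> = A}"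
    and A2: "lambda2 (Matrix.mat N N (\<lambda>(i,j). \<integral>\<omega>. L 0 \<omega> $$ (i,j) \<partial>M)) > 0"
    (* (A.3) *)
    and A3: "prob_space.indep_sets M (\<lambda>c. if c
        then gen_sigma M (\<Union>t. mcomps N (L t))
        else gen_sigma M (\<Union>k\<in>{..<N}. \<Union>t. vcomps (Md k) (zeta k t))) UNIV"
    (* (A.4) *)
    and eps_pos: "\<epsilon>1 > 0"
    and A4: "\<And>k t. k < N \<Longrightarrow> (\<integral>\<^sup>+\<omega>. ennreal (vnorm (zeta k t \<omega>) powr (2 + \<epsilon>1)) \<partial>M) < \<infinity>"
    (* (A.5) *)
    and ab_pos: "a > 0" "b > 0"
    and tau_order: "0 < \<tau>2" "\<tau>2 \<le> \<tau>1" "\<tau>1 \<le> 1"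
    and tau_gap: "\<tau>1 > \<tau>2 + 1 / (2 + \<epsilon>1) + 1 / 2"
    (* algorithm *)
    and alpha_def: "\<And>t. \<alpha> t = a / (real t + 1) powr \<tau>1"
    and beta_def: "\<And>t. \<beta> t = b / (real t + 1) powr \<tau>2"
    and gamma_pos: "\<And>t. \<gamma> t > 0" and gamma_lim: "\<gamma> \<longlonglongrightarrow> 0"
    and x0_dim: "\<And>k. k < N \<Longrightarrow> x0 k \<in> carrier_vec m"
    and x_init: "\<And>k \<omega>. k < N \<Longrightarrow> \<omega> \<in> space M \<Longrightarrow> x k 0 \<omega> = x0 k"
    and x_step: "\<And>k t \<omega>. k < N \<Longrightarrow> \<omega> \<in> space M \<Longrightarrow>
        x k (Suc t) \<omega> = x k t \<omega>
          - \<beta> t \<cdot>\<^sub>v vsum m (\<lambda>j. x k t \<omega> - x j t \<omega>) {j. j < N \<and> L t \<omega> $$ (k,j) = -1}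
          + \<alpha> t \<cdot>\<^sub>v ((minv (G k t \<omega> + \<gamma> t \<cdot>\<^sub>m 1\<^sub>m m) * transpose_mat (H k)
                        * minv (Q k t \<omega> + \<gamma> t \<cdot>\<^sub>m 1\<^sub>m (Md k)))
                      *\<^sub>v (y k t \<omega> - H k *\<^sub>v x k t \<omega>))"
    and Q0_psd: "\<And>k. k < N \<Longrightarrow> psd_mat (Md k) (Q0 k)"
    and Q1_psd: "\<And>k. k < N \<Longrightarrow> psd_mat (Md k) (Q1 k)"
    and Q_init0: "\<And>k \<omega>. k < N \<Longrightarrow> \<omega> \<in> space M \<Longrightarrow> Q k 0 \<omega> = Q0 k"
    and Q_init1: "\<And>k \<omega>. k < N \<Longrightarrow> \<omega> \<in> space M \<Longrightarrow> Q k 1 \<omega> = Q1 k"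
    and Q_step: "\<And>k t \<omega>. k < N \<Longrightarrow> \<omega> \<in> space M \<Longrightarrow> t \<ge> 1 \<Longrightarrow>
        Q k (Suc t) \<omega> =
          (1 / real t) \<cdot>\<^sub>m msum (Md k) (Md k) (\<lambda>s. outer (y k s \<omega>) (y k s \<omega>)) {..t}
          - outer ((1 / real t) \<cdot>\<^sub>v vsum (Md k) (\<lambda>s. y k s \<omega>) {..<t})
                  ((1 / real t) \<cdot>\<^sub>v vsum (Md k) (\<lambda>s. y k s \<omega>) {..<t})"
    and G0_psd: "\<And>k. k < N \<Longrightarrow> psd_mat m (G0 k)"
    and G_init: "\<And>k \<omega>. k < N \<Longrightarrow> \<omega> \<in> space M \<Longrightarrow> G k 0 \<omega> = G0 k"
    and G_step: "\<And>k t \<omega>. k < N \<Longrightarrow> \<omega> \<in> space M \<Longrightarrow>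
        G k (Suc t) \<omega> = G k t \<omega>
          - \<beta> t \<cdot>\<^sub>m msum m m (\<lambda>j. G k t \<omega> - G j t \<omega>) {j. j < N \<and> L t \<omega> $$ (k,j) = -1}
          + \<alpha> t \<cdot>\<^sub>m (transpose_mat (H k) * minv (Q k t \<omega> + \<gamma> t \<cdot>\<^sub>m 1\<^sub>m (Md k)) * H k - G k t \<omega>)"
    (* conclusion parameters *)
    and tau0: "0 \<le> \<tau>0" "\<tau>0 < \<tau>1 - \<tau>2 - 1 / (2 + \<epsilon>1)"
    and agents: "n < N" "l < N"
  shows "measure M {\<omega> \<in> space M.
      ((\<lambda>t. (real t + 1) powr \<tau>0 * vnorm (x n t \<omega> - x l t \<omega>)) \<longlongrightarrow> 0) sequentially} = 1"
proof -
  interpret prob_space M by fact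
  interpret filtration "space M" F by fact
  have sub: "f \<in> borel_measurable M" if "f \<in> borel_measurable (F t)" for f :: "'a \<Rightarrow> real" and t
    using that filt_sub[of t] space_F[of t] unfolding measurable_def by auto
  have zm: "(\<lambda>\<omega>. zeta k t \<omega> $ i) \<in> borel_measurable M" if "k < N" "i < Md k" for k t i
    by (rule sub[OF zeta_meas[OF that]])
  have Lm: "(\<lambda>\<omega>. L t \<omega> $$ (i, j)) \<in> borel_measurable M" if "i < N" "j < N" for t i j
    by (rule sub[OF L_meas[OF that]])
  have y_dim: "y k t \<omega> \<in> carrier_vec (Md k)" if "k < N" "\<omega> \<in> space M" for k t \<omega>
    using zeta_dim[OF that, of t] by (intro carrier_vecI) (simp add: y_def[OF that])
  have y_index: "y k t \<omega> $ i = (H k *\<^sub>v \<theta>) $ i + zeta k t \<omega> $ i" if "k < N" "\<omega> \<in> space M" "i < Md k" for k t \<omega> i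
    using zeta_dim[OF that(1,2), of t] that(3) by (simp add: y_def[OF that(1,2)])
  have ym: "(\<lambda>\<omega>. y k t \<omega> $ i) \<in> borel_measurable M" if "k < N" "i < Md k" for k t i
  proof -
    have "(\<lambda>\<omega>. (H k *\<^sub>v \<theta>) $ i + zeta k t \<omega> $ i) \<in> borel_measurable M" using zm[OF that] by measurable
    then show ?thesis by (rule measurable_cong[THEN iffD1, rotated]) (simp only: y_index that)
  qed
  have carr: "\<And>k. k < N \<Longrightarrow> Q0 k \<in> carrier_mat (Md k) (Md k)" "\<And>k. k < N \<Longrightarrow> Q1 k \<in> carrier_mat (Md k) (Md k)"
    "\<And>k. k < N \<Longrightarrow> G0 k \<in> carrier_mat m m"
    using Q0_psd Q1_psd G0_psd by (auto simp: psd_mat_def)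
  note meas = estimates_random_vec[OF H_dim y_dim ym Lm carr(1,2) Q_init0 Q_init1 Q_step carr(3) G_init G_step x_init x_step]
  have x_random: "random_vec M (x k t)" if "k < N" for k t
    by (rule meas(2)) (assumption | rule that)+
  have G_carr: "G k t \<omega> \<in> carrier_mat m m" if "k < N" "\<omega> \<in> space M" for k t \<omega>
    by (rule meas(1)) (assumption | rule that)+
  define S where "S = {\<omega> \<in> space M. (\<lambda>t. (real t + 1) powr \<tau>0 * vnorm (x n t \<omega> - x l t \<omega>)) \<longlonglongrightarrow> 0}"
  have S_sets: "S \<in> sets M"
    unfolding S_def using random_vec_minus[OF x_random[OF agents(1)] x_random[OF agents(2)]]
    by (intro sets_tendsto_zero borel_measurable_times borel_measurable_const vnorm_measurable)

  define r where "r = 2 + \<epsilon>1"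
  \<comment> \<open>g is the slack in the strict bound on \<open>\<tau>0\<close>. The noise exponent
    p spends a quarter of it and the window exponent \<delta> at most another, so
    \<open>p - (\<tau>1 - \<tau>2 - \<delta>) + \<tau>0 \<le> - g / 2\<close>. The other two terms
    of the minimum keep \<delta> below \<open>\<tau>2\<close> and \<open>1 - \<tau>2\<close>, as the
    consensus rate requires.\<close>
  define g where "g = \<tau>1 - \<tau>2 - 1 / r - \<tau>0"
  define \<delta> where "\<delta> = min (g / 4) (min (\<tau>2 / 2) ((1 - \<tau>2) / 2))"
  define p where "p = 1 / r + g / 4"
  have r: "r > 2" using eps_pos by (simp add: r_def)
  have g: "g > 0" using tau0 by (simp add: g_def r_def)
  have r1: "1 / r > 0" using r by simp
  have \<tau>2: "\<tau>2 < 1" using tau_gap tau_order r1 unfolding r_def by linarith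
  have \<delta>: "0 < \<delta>" "\<delta> \<le> g / 4" "\<delta> \<le> \<tau>2 / 2" "\<delta> \<le> (1 - \<tau>2) / 2"
  proof -
    show "0 < \<delta>" using g \<tau>2 tau_order by (simp add: \<delta>_def)
    show "\<delta> \<le> g / 4" "\<delta> \<le> \<tau>2 / 2" unfolding \<delta>_def by simp_all
    show "\<delta> \<le> (1 - \<tau>2) / 2" unfolding \<delta>_def by linarith
  qed
  have p: "p \<ge> 0" "p * r > 1" using g r r1 by (auto simp: p_def distrib_right)
  have N: "N > 0" using agents by simp
  have "\<tau>1 - \<tau>2 - 1 / r = g + \<tau>0" by (simp add: g_def)
  then have neg: "p - (\<tau>1 - \<tau>2 - \<delta>) + \<tau>0 < 0" unfolding p_def using \<delta>(2) g by linarith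
  have \<kappa>: "0 < \<tau>1 - \<tau>2 - \<delta>" using neg p tau0 by linarith

  \<comment> \<open>Defined through time 0; since the laws agree, each of these edges has the same
    positive probability at all times, as the window argument demands.\<close>
  define E where "E = {(i, j). i < N \<and> j < N \<and> prob {\<omega>\<in>space M. L 0 \<omega> $$ (i, j) = -1} > 0}"
  have conn: "connected_edges N E" unfolding E_def by (rule expected_graph_connected[OF L_lap Lm A2])
  have finE: "finite E" by (rule finite_subset[of _ "{..<N} \<times> {..<N}"]) (auto simp: E_def)
  have hit: "AE \<omega> in M. \<forall>\<^sub>F t in sequentially. \<exists>s. t - nat \<lceil>real t powr \<delta>\<rceil> \<le> s \<and> s < t \<and> L s \<omega> $$ (i, j) = -1"
    if ij: "(i, j) \<in> E" for i j
  proof -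
    have ij': "i < N" "j < N" "prob {\<omega>\<in>space M. L 0 \<omega> $$ (i, j) = -1} > 0" using ij by (auto simp: E_def)
    let ?B = "\<lambda>s. {\<omega>\<in>space M. L s \<omega> $$ (i, j) = -1}"
    have "AE \<omega> in M. \<forall>\<^sub>F t in sequentially. \<exists>s. t - nat \<lceil>real t powr \<delta>\<rceil> \<le> s \<and> s < t \<and> \<omega> \<in> ?B s"
    proof (rule AE_eventually_window_hit[where S = "\<lambda>t. gen_measure M (mcomps N (L t))" and B = ?B and \<pi> = "prob (?B 0)"])
      show "indep_sets (\<lambda>t. sets (gen_measure M (mcomps N (L t)))) UNIV"
        unfolding sets_gen_measure by (rule L_indep_time)
      show "?B t \<in> sets (gen_measure M (mcomps N (L t)))" for t
      proof -
        have "(\<lambda>\<omega>. L t \<omega> $$ (i, j)) \<in> borel_measurable (gen_measure M (mcomps N (L t)))"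
          using ij' by (intro measurable_gen_measure) (auto simp: mcomps_def)
        then have "{\<omega> \<in> space (gen_measure M (mcomps N (L t))). L t \<omega> $$ (i, j) = -1} \<in> sets (gen_measure M (mcomps N (L t)))"
          by measurable
        then show ?thesis by (simp add: space_gen_measure)
      qed
      show "prob (?B t) = prob (?B 0)" for t
        by (rule edge_prob_eq[OF L_lap L_lap Lm Lm L_ident])
    qed (use ij' \<delta> \<tau>2 tau_order in \<open>auto simp: space_gen_measure\<close>)
    then show ?thesis
    proof eventually_elim
      case (elim \<omega>)
      then show ?case by eventually_elim auto
    qed
  qed
  then have "AE \<omega> in M. \<forall>e\<in>E. \<forall>\<^sub>F t in sequentially. \<exists>s. t - nat \<lceil>real t powr \<delta>\<rceil> \<le> s \<and> s < t \<and> L s \<omega> $$ (fst e, snd e) = -1"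
    using countable_finite[OF finE] by (subst AE_ball_countable) auto
  moreover have iid: "iid_vectors M (Md k) (zeta k) r" if k: "k < N" for k
    by (intro iid_vectors.intro iid_vectors_axioms.intro prob zeta_dim[OF k] zm[OF k] zeta_indep_time[OF k]
        zeta_ident[OF k] A4[OF k, folded r_def] r)
  have "AE \<omega> in M. \<forall>k\<in>{..<N}. \<forall>i\<in>{..<Md k}. \<forall>\<^sub>F t in sequentially. \<bar>zeta k t \<omega> $ i\<bar> \<le> (real t + 1) powr p"
    using iid_vectors.AE_growth[OF iid _ p(2)] by (simp add: AE_ball_countable)
  moreover have "AE \<omega> in M. \<forall>k\<in>{..<N}. \<forall>i\<in>{..<Md k}. (\<lambda>n. (\<Sum>t<n. zeta k t \<omega> $ i) / real n) \<longlonglongrightarrow> 0"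
    using iid_vectors.strong_law_coord[OF iid] zeta_mean by (simp add: AE_ball_countable)
  moreover have "AE \<omega> in M. \<forall>k\<in>{..<N}. \<forall>i\<in>{..<Md k}. \<forall>j\<in>{..<Md k}.
      (\<lambda>n. (\<Sum>t<n. zeta k t \<omega> $ i * zeta k t \<omega> $ j) / real n) \<longlonglongrightarrow> R k $$ (i, j)"
    using iid_vectors.strong_law_product[OF iid] zeta_cov by (simp add: AE_ball_countable)
  ultimately have "AE \<omega> in M. \<omega> \<in> S"
    using AE_space
  proof eventually_elim
    case (elim \<omega>)
    note \<omega> = elim(5)
    let ?A = "\<lambda>t i j. L t \<omega> $$ (i, j) = -1"
    interpret consensus_network N E ?A a b \<tau>1 \<tau>2 \<delta> \<alpha> \<beta>
    proof unfold_locales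
      show "E \<subseteq> {..<N} \<times> {..<N}" by (auto simp: E_def)
      show "?A s i j = ?A s j i" if "i < N" "j < N" for s i j
        by (rule laplacian_edge(1)[OF L_lap[OF \<omega>] that])
      show "\<forall>\<^sub>F t in sequentially. \<forall>(i, j)\<in>E. \<exists>s. t - nat \<lceil>real t powr \<delta>\<rceil> \<le> s \<and> s < t \<and> ?A s i j"
        using eventually_ball_finite[OF finE elim(1)] by (simp add: split_beta)
    qed (use N conn ab_pos alpha_def beta_def \<delta> \<tau>2 tau_order \<kappa> in auto)
    have Q: "mat_tendsto (Md k) (Md k) (\<lambda>t. Q k t \<omega>) (R k)" if k: "k < N" for k
    proof (rule mat_tendstoI[OF _ R_dim[OF k]])
      have "\<forall>\<^sub>F t in sequentially. Q k (Suc t) \<omega> \<in> carrier_mat (Md k) (Md k)"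
        using eventually_ge_at_top[of 1]
        by eventually_elim (auto simp: Q_step[OF k \<omega>] msum_def outer_def vsum_def)
      then show "\<forall>\<^sub>F t in sequentially. Q k t \<omega> \<in> carrier_mat (Md k) (Md k)"
        by (subst (asm) eventually_sequentially_Suc)
      fix i j assume ij: "i < Md k" "j < Md k"
      let ?c = "\<lambda>i. (H k *\<^sub>v \<theta>) $ i" and ?z = "\<lambda>s i. zeta k s \<omega> $ i"
      have "(\<lambda>t. 1 / real t * (\<Sum>s\<le>t. (?c i + ?z s i) * (?c j + ?z s j))
         - (1 / real t * (\<Sum>s<t. ?c i + ?z s i)) * (1 / real t * (\<Sum>s<t. ?c j + ?z s j))) \<longlonglongrightarrow> R k $$ (i, j)"
        using elim(3,4) k ij by (intro sample_covariance_tendsto) auto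
      moreover have "\<forall>\<^sub>F t in sequentially. 1 / real t * (\<Sum>s\<le>t. (?c i + ?z s i) * (?c j + ?z s j))
         - (1 / real t * (\<Sum>s<t. ?c i + ?z s i)) * (1 / real t * (\<Sum>s<t. ?c j + ?z s j)) = Q k (Suc t) \<omega> $$ (i, j)"
        using eventually_ge_at_top[of 1]
        by eventually_elim (simp only: Q_step[OF k \<omega>] sample_covariance_entry[OF y_dim[OF k \<omega>] ij] y_index[OF k \<omega>] ij)
      ultimately have "(\<lambda>t. Q k (Suc t) \<omega> $$ (i, j)) \<longlonglongrightarrow> R k $$ (i, j)"
        by (rule Lim_transform_eventually)
      then show "(\<lambda>t. Q k t \<omega> $$ (i, j)) \<longlonglongrightarrow> R k $$ (i, j)" by (rule LIMSEQ_imp_Suc)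
    qed
    have growth: "\<exists>C. \<forall>\<^sub>F t in sequentially. \<bar>y k t \<omega> $ i\<bar> \<le> C * (real t + 1) powr p" if k: "k < N" and i: "i < Md k" for k i
    proof -
      have "\<forall>\<^sub>F t in sequentially. \<bar>zeta k t \<omega> $ i\<bar> \<le> (real t + 1) powr p" using elim(2) k i by auto
      \<comment> \<open>The deterministic part of the observation is constant and is absorbed
        because \<open>(real t + 1) powr p \<ge> 1\<close>.\<close>
      then have "\<forall>\<^sub>F t in sequentially. \<bar>y k t \<omega> $ i\<bar> \<le> (\<bar>(H k *\<^sub>v \<theta>) $ i\<bar> + 1) * (real t + 1) powr p"
      proof eventually_elim
        case (elim t)
        have "1 \<le> (real t + 1) powr p" using p by (intro ge_one_powr_ge_zero) auto
        then have "\<bar>(H k *\<^sub>v \<theta>) $ i\<bar> * 1 \<le> \<bar>(H k *\<^sub>v \<theta>) $ i\<bar> * (real t + 1) powr p" by (intro mult_left_mono) auto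
        then show ?case using elim unfolding y_index[OF k \<omega> i] distrib_right by linarith
      qed
      then show ?thesis by blast
    qed
    note est = estimates_disagreement[OF H_dim R_inv A1 Q gamma_lim G_carr[OF _ \<omega>] G_step[OF _ \<omega>] x_step[OF _ \<omega>] y_dim[OF _ \<omega>] growth p(1)]
    have xc: "\<forall>\<^sub>F t in sequentially. \<forall>k<N. x k t \<omega> \<in> carrier_vec m" by (rule est(1)) assumption+
    have "\<exists>C. \<forall>\<^sub>F t in sequentially. \<forall>k<N. \<forall>l<N. \<forall>i<m.
      \<bar>x k t \<omega> $ i - x l t \<omega> $ i\<bar> \<le> C * (real t + 1) powr (p - (\<tau>1 - \<tau>2 - \<delta>))" by (rule est(2)) assumption+
    then obtain C where C: "\<forall>\<^sub>F t in sequentially. \<forall>k<N. \<forall>l<N. \<forall>i<m.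
      \<bar>x k t \<omega> $ i - x l t \<omega> $ i\<bar> \<le> C * (real t + 1) powr (p - (\<tau>1 - \<tau>2 - \<delta>))" by blast
    have "(\<lambda>t. (real t + 1) powr \<tau>0 * vnorm (x n t \<omega> - x l t \<omega>)) \<longlonglongrightarrow> 0"
    proof (rule Lim_null_comparison)
      have "(\<lambda>t. (real t + 1) powr (p - (\<tau>1 - \<tau>2 - \<delta>) + \<tau>0)) \<longlonglongrightarrow> 0" using neg by real_asymp
      then have "(\<lambda>t. real m * C * (real t + 1) powr (p - (\<tau>1 - \<tau>2 - \<delta>) + \<tau>0)) \<longlonglongrightarrow> real m * C * 0"
        by (intro tendsto_mult tendsto_const)
      then show "(\<lambda>t. real m * C * (real t + 1) powr (p - (\<tau>1 - \<tau>2 - \<delta>) + \<tau>0)) \<longlonglongrightarrow> 0" by simp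
      show "\<forall>\<^sub>F t in sequentially. norm ((real t + 1) powr \<tau>0 * vnorm (x n t \<omega> - x l t \<omega>))
          \<le> real m * C * (real t + 1) powr (p - (\<tau>1 - \<tau>2 - \<delta>) + \<tau>0)"
        using xc C
      proof eventually_elim
        case (elim t)
        have xs: "x n t \<omega> \<in> carrier_vec m" "x l t \<omega> \<in> carrier_vec m" using elim(1) agents by auto
        have "vnorm (x n t \<omega> - x l t \<omega>) \<le> (\<Sum>i<m. \<bar>x n t \<omega> $ i - x l t \<omega> $ i\<bar>)"
          using vnorm_le_l1[of "x n t \<omega> - x l t \<omega>"] xs by simp
        also have "\<dots> \<le> (\<Sum>i<m. C * (real t + 1) powr (p - (\<tau>1 - \<tau>2 - \<delta>)))"
          using elim(2) agents by (intro sum_mono) auto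
        finally have "(real t + 1) powr \<tau>0 * vnorm (x n t \<omega> - x l t \<omega>)
            \<le> (real t + 1) powr \<tau>0 * (real m * (C * (real t + 1) powr (p - (\<tau>1 - \<tau>2 - \<delta>))))"
          by (intro mult_left_mono) auto
        then show ?case using vnorm_nonneg[of "x n t \<omega> - x l t \<omega>"] by (simp add: abs_mult powr_add ac_simps)
      qed
    qed
    then show ?case using \<omega> by (simp add: S_def)
  qed
  then have "prob S = 1" using S_sets by (simp add: prob_eq_1)
  then show ?thesis by (simp add: S_def)
qed

end
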